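(* Let $\Sigma$ be a signature, $\mathcal A$ the set of axioms of preadditive semicategories in $\Sigma$, and $\varphi$ any $\Sigma$-formula. The semi-decision procedure described in the context, run on input $(\Sigma,\varphi)$, terminates and outputs $\top$ if and only if $\mathcal A\models\varphi$ (and otherwise runs forever).
   Context: Many-sorted first-order logic with equality. Signature $\Sigma=(O,C,F,\sigma)$: sorts are pairs $(u,v)\in O\times O$; $C$ contains zero constants $0_{u,v}$ of sort $(u,v)$; $F$ contains arithmetic symbols $-_{u,v}:(u,v)\to(u,v)$, $+_{u,v}:(u,v)\times(u,v)\to(u,v)$, $\cdot_{u,v,w}:(w,v)\times(u,w)\to(u,v)$ for all $u,v,w\in O$ (other function symbols are non-arithmetic). Formulas: $s\approx t$ for same-sort terms, closed under $\lnot,\vee,\wedge,\rightarrow,\exists,\forall$; $\mathcal A\models\varphi$: every model of $\mathcal A$ is a model of $\varphi$. Axioms $\mathcal A$ (for all $u,u',v,v'\in O$, $x^{(a,b)}$ a variable of sort $(a,b)$): associativity $\forall x^{(v',v)},y^{(u',v')},z^{(u,u')}\colon x\cdot(y\cdot z)\approx(x\cdot y)\cdot z$; $\forall x,y,z$ of sort $(u,v)$: $x+(y+z)\approx(x+y)+z$; $\forall x^{(u,v)}\colon x+0_{u,v}\approx x$; $\forall x^{(u,v)}\colon x+(-x)\approx0_{u,v}$; $\forall x^{(u,v)},y^{(u,v)}\colon x+y\approx y+x$; $\forall x^{(v',v)},y^{(u,v')},z^{(u,v')}\colon x\cdot(y+z)\approx x\cdot y+x\cdot z$; $\forall x^{(v',v)},y^{(v',v)},z^{(u,v')}\colon(x+y)\cdot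 z\approx x\cdot z+y\cdot z$. Herbrand normal form of $\varphi$: universally close free variables, convert to prenex normal form, then Herbrandise by exhaustively replacing $\forall y\colon\psi$ by $\psi[y\mapsto c]$ (new constant $c$ of the sort of $y$) and $\exists x_1,\dots,x_n\forall y\colon\psi$ by $\exists x_1,\dots,x_n\colon\psi[y\mapsto f(x_1,\dots,x_n)]$ (new function symbol $f$ of type $\sigma(x_1)\times\dots\times\sigma(x_n)\to\sigma(y)$), extending the signature; result $\varphi^H=\exists x_1\dots x_n\colon\varphi^*$. Herbrand expansion $H(\varphi^H)$: all $\varphi^*[x_i\mapsto t_i]$ with $t_i$ ground terms of matching sorts ($=\{\varphi^H\}$ if $n=0$). Ackermann reduction removing a function symbol $f$ from a quantifier-free $\psi$: with $f_i=f(t^{(i)}_1,\dots,t^{(i)}_k)$, $i=1..m$, the distinct $f$-subterms, replace each by a new constant $c_i$ (map $\mathrm{ack}$; outermost instance constant kept in nesting), form $\psi^{\mathrm{flat}}=\mathrm{ack}(\psi)$, $\psi^{\mathrm{FC}}=\bigwedge_{i<j}((\bigwedge_l\mathrm{ack}(t^{(i)}_l)\approx\mathrm{ack}(t^{(j)}_l))\rightarrow c_i\approx c_j)$, output $\psi^{\mathrm{FC}}\rightarrow\psi^{\mathrm{flat}}$; repeat for every non-arithmetic function symbol. Idealisation $I$ of an arithmetic ground sentence: translate terms into $\mathbb Z\langle X\rangle$ (one indeterminate per non-zero constant, $0_{u,v}\mapsto0$, arithmetic symbols to ring operations); compute the CNF (eliminate $\rightarrow$, push $\lnot$ inward, distribute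 $\vee$ over $\wedge$); a clause $\bigvee_j s_j\not\approx t_j\vee\bigvee_k p_k\approx q_k$ has $I=\top$ iff some $p_k-q_k$ lies in the two-sided ideal generated by the $s_j-t_j$; $I(\varphi)$ is the conjunction over clauses. Procedure: compute $\varphi^H$ and an enumeration $\varphi_1,\varphi_2,\dots$ of $H(\varphi^H)$; set $\psi_1=\varphi_1$ and $\psi_1^{\mathrm{Ack}}$ its Ackermann reduction removing all non-arithmetic function symbols. For $n=1,2,\dots$: for $k=1,\dots,n$, if $I(\psi_k^{\mathrm{Ack}})=\top$ can be verified within $n$ operations of a fixed semi-decision procedure for ideal membership in finitely generated ideals of $\mathbb Z\langle X\rangle$, return $\top$; then if $\varphi^H$ is ground set $\psi_{n+1}^{\mathrm{Ack}}=\psi_n^{\mathrm{Ack}}$, otherwise set $\psi_{n+1}=\psi_n\vee\varphi_{n+1}$ and $\psi_{n+1}^{\mathrm{Ack}}$ its Ackermann reduction removing all non-arithmetic function symbols. *)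

theory Defs
  imports HOL.Hull "HOL-Library.Poly_Mapping" "HOL-Library.While_Combinator"
begin

section \<open>Signatures, terms and formulas\<close>

type_synonym 'o sort = "'o \<times> 'o"

text \<open>Every sort has countably many variables, and a variable carries its sort.\<close>

type_synonym 'o var = "nat \<times> 'o sort"

text \<open>
  The symbols that every signature contains are constructors of their own, so a signature only has
  to list its remaining symbols: the constant symbols of a signature are the \<open>Zero u v\<close>
  together with \<open>Con c\<close> for \<open>c\<close> in \<open>con_syms\<close>, and likewise for function symbols.
  \<open>Times u v w\<close> has the type \<open>(w,v) \<times> (u,w) \<rightarrow> (u,v)\<close>.
\<close>

datatype ('o, 'c) const_sym = Zero 'o 'o | Con 'c

datatype ('o, 'f) fun_sym = Uminus 'o 'o | Plus 'o 'o | Times 'o 'o 'o | Fun 'f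

record ('o, 'c, 'f) signature =
  objs :: "'o set"
  con_syms :: "'c set"
  fun_syms :: "'f set"
  con_sort :: "'c \<Rightarrow> 'o sort"
  fun_sort :: "'f \<Rightarrow> 'o sort list \<times> 'o sort"

definition sorts :: "('o, 'c, 'f, 'z) signature_scheme \<Rightarrow> 'o sort set" where
  "sorts \<Sigma> = objs \<Sigma> \<times> objs \<Sigma>"

definition wf_signature :: "('o, 'c, 'f) signature \<Rightarrow> bool" where
  "wf_signature \<Sigma> \<longleftrightarrow>
     (\<forall>c\<in>con_syms \<Sigma>. con_sort \<Sigma> c \<in> sorts \<Sigma>) \<and>
     (\<forall>f\<in>fun_syms \<Sigma>. set (fst (fun_sort \<Sigma> f)) \<subseteq> sorts \<Sigma> \<and> snd (fun_sort \<Sigma> f) \<in> sorts \<Sigma>)"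

fun const_sort :: "('o, 'c, 'f) signature \<Rightarrow> ('o, 'c) const_sym \<Rightarrow> 'o sort" where
  "const_sort \<Sigma> (Zero u v) = (u, v)"
| "const_sort \<Sigma> (Con c) = con_sort \<Sigma> c"

fun func_sort :: "('o, 'c, 'f) signature \<Rightarrow> ('o, 'f) fun_sym \<Rightarrow> 'o sort list \<times> 'o sort" where
  "func_sort \<Sigma> (Uminus u v) = ([(u, v)], (u, v))"
| "func_sort \<Sigma> (Plus u v) = ([(u, v), (u, v)], (u, v))"
| "func_sort \<Sigma> (Times u v w) = ([(w, v), (u, w)], (u, v))"
| "func_sort \<Sigma> (Fun f) = fun_sort \<Sigma> f"

definition all_consts :: "('o, 'c, 'f) signature \<Rightarrow> ('o, 'c) const_sym set" where
  "all_consts \<Sigma> = {Zero u v | u v. u \<in> objs \<Sigma> \<and> v \<in> objs \<Sigma>} \<union> Con ` con_syms \<Sigma>"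

definition all_funs :: "('o, 'c, 'f) signature \<Rightarrow> ('o, 'f) fun_sym set" where
  "all_funs \<Sigma> =
     {Uminus u v | u v. u \<in> objs \<Sigma> \<and> v \<in> objs \<Sigma>} \<union>
     {Plus u v | u v. u \<in> objs \<Sigma> \<and> v \<in> objs \<Sigma>} \<union>
     {Times u v w | u v w. u \<in> objs \<Sigma> \<and> v \<in> objs \<Sigma> \<and> w \<in> objs \<Sigma>} \<union>
     Fun ` fun_syms \<Sigma>"

datatype ('o, 'c, 'f) tm =
    Var "'o var"
  | Const "('o, 'c) const_sym"
  | App "('o, 'f) fun_sym" "('o, 'c, 'f) tm list"

datatype ('o, 'c, 'f) fm =
    Eq "('o, 'c, 'f) tm" "('o, 'c, 'f) tm"
  | Neg "('o, 'c, 'f) fm"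
  | Or "('o, 'c, 'f) fm" "('o, 'c, 'f) fm"
  | And "('o, 'c, 'f) fm" "('o, 'c, 'f) fm"
  | Imp "('o, 'c, 'f) fm" "('o, 'c, 'f) fm"
  | Ex "'o var" "('o, 'c, 'f) fm"
  | All "'o var" "('o, 'c, 'f) fm"

inductive has_sort :: "('o, 'c, 'f) signature \<Rightarrow> ('o, 'c, 'f) tm \<Rightarrow> 'o sort \<Rightarrow> bool"
  for \<Sigma> where
  "snd x \<in> sorts \<Sigma> \<Longrightarrow> has_sort \<Sigma> (Var x) (snd x)"
| "c \<in> all_consts \<Sigma> \<Longrightarrow> has_sort \<Sigma> (Const c) (const_sort \<Sigma> c)"
| "f \<in> all_funs \<Sigma> \<Longrightarrow> list_all2 (has_sort \<Sigma>) ts (fst (func_sort \<Sigma> f)) \<Longrightarrow>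
     has_sort \<Sigma> (App f ts) (snd (func_sort \<Sigma> f))"

fun is_formula :: "('o, 'c, 'f) signature \<Rightarrow> ('o, 'c, 'f) fm \<Rightarrow> bool" where
  "is_formula \<Sigma> (Eq s t) \<longleftrightarrow> (\<exists>a. has_sort \<Sigma> s a \<and> has_sort \<Sigma> t a)"
| "is_formula \<Sigma> (Neg \<phi>) \<longleftrightarrow> is_formula \<Sigma> \<phi>"
| "is_formula \<Sigma> (Or \<phi> \<psi>) \<longleftrightarrow> is_formula \<Sigma> \<phi> \<and> is_formula \<Sigma> \<psi>"
| "is_formula \<Sigma> (And \<phi> \<psi>) \<longleftrightarrow> is_formula \<Sigma> \<phi> \<and> is_formula \<Sigma> \<psi>"
| "is_formula \<Sigma> (Imp \<phi> \<psi>) \<longleftrightarrow> is_formula \<Sigma> \<phi> \<and> is_formula \<Sigma> \<psi>"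
| "is_formula \<Sigma> (Ex x \<phi>) \<longleftrightarrow> snd x \<in> sorts \<Sigma> \<and> is_formula \<Sigma> \<phi>"
| "is_formula \<Sigma> (All x \<phi>) \<longleftrightarrow> snd x \<in> sorts \<Sigma> \<and> is_formula \<Sigma> \<phi>"

section \<open>Semantics\<close>

record ('o, 'c, 'f, 'm) interp =
  dom_set :: "'o sort \<Rightarrow> 'm set"
  con :: "('o, 'c) const_sym \<Rightarrow> 'm"
  fn :: "('o, 'f) fun_sym \<Rightarrow> 'm list \<Rightarrow> 'm"

definition is_interp :: "('o, 'c, 'f) signature \<Rightarrow> ('o, 'c, 'f, 'm) interp \<Rightarrow> bool" where
  "is_interp \<Sigma> \<I> \<longleftrightarrow>
     (\<forall>s\<in>sorts \<Sigma>. dom_set \<I> s \<noteq> {}) \<and>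
     (\<forall>c\<in>all_consts \<Sigma>. con \<I> c \<in> dom_set \<I> (const_sort \<Sigma> c)) \<and>
     (\<forall>f\<in>all_funs \<Sigma>. \<forall>as. list_all2 (\<lambda>a s. a \<in> dom_set \<I> s) as (fst (func_sort \<Sigma> f)) \<longrightarrow>
        fn \<I> f as \<in> dom_set \<I> (snd (func_sort \<Sigma> f)))"

fun eval :: "('o, 'c, 'f, 'm) interp \<Rightarrow> ('o var \<Rightarrow> 'm) \<Rightarrow> ('o, 'c, 'f) tm \<Rightarrow> 'm" where
  "eval \<I> \<beta> (Var x) = \<beta> x"
| "eval \<I> \<beta> (Const c) = con \<I> c"
| "eval \<I> \<beta> (App f ts) = fn \<I> f (map (eval \<I> \<beta>) ts)"

fun sat :: "('o, 'c, 'f, 'm) interp \<Rightarrow> ('o var \<Rightarrow> 'm) \<Rightarrow> ('o, 'c, 'f) fm \<Rightarrow> bool" where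
  "sat \<I> \<beta> (Eq s t) \<longleftrightarrow> eval \<I> \<beta> s = eval \<I> \<beta> t"
| "sat \<I> \<beta> (Neg \<phi>) \<longleftrightarrow> \<not> sat \<I> \<beta> \<phi>"
| "sat \<I> \<beta> (Or \<phi> \<psi>) \<longleftrightarrow> sat \<I> \<beta> \<phi> \<or> sat \<I> \<beta> \<psi>"
| "sat \<I> \<beta> (And \<phi> \<psi>) \<longleftrightarrow> sat \<I> \<beta> \<phi> \<and> sat \<I> \<beta> \<psi>"
| "sat \<I> \<beta> (Imp \<phi> \<psi>) \<longleftrightarrow> (sat \<I> \<beta> \<phi> \<longrightarrow> sat \<I> \<beta> \<psi>)"
| "sat \<I> \<beta> (Ex x \<phi>) \<longleftrightarrow> (\<exists>a\<in>dom_set \<I> (snd x). sat \<I> (\<beta>(x := a)) \<phi>)"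
| "sat \<I> \<beta> (All x \<phi>) \<longleftrightarrow> (\<forall>a\<in>dom_set \<I> (snd x). sat \<I> (\<beta>(x := a)) \<phi>)"

text \<open>Free variables are read universally: a model satisfies the formula under all assignments.\<close>

definition is_model ::
  "('o, 'c, 'f) signature \<Rightarrow> ('o, 'c, 'f, 'm) interp \<Rightarrow> ('o, 'c, 'f) fm \<Rightarrow> bool" where
  "is_model \<Sigma> \<I> \<phi> \<longleftrightarrow> is_interp \<Sigma> \<I> \<and>
     (\<forall>\<beta>. (\<forall>x. snd x \<in> sorts \<Sigma> \<longrightarrow> \<beta> x \<in> dom_set \<I> (snd x)) \<longrightarrow> sat \<I> \<beta> \<phi>)"

text \<open>
  HOL cannot quantify over all types inside a formula, so entailment ranges over the interpretations
  whose domains are subsets of a given type \<open>'m\<close>.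
\<close>

definition entails ::
  "'m itself \<Rightarrow> ('o, 'c, 'f) signature \<Rightarrow> ('o, 'c, 'f) fm set \<Rightarrow> ('o, 'c, 'f) fm \<Rightarrow> bool" where
  "entails _ \<Sigma> \<A> \<phi> \<longleftrightarrow>
     (\<forall>\<I> :: ('o, 'c, 'f, 'm) interp.
        is_interp \<Sigma> \<I> \<and> (\<forall>\<alpha>\<in>\<A>. is_model \<Sigma> \<I> \<alpha>) \<longrightarrow> is_model \<Sigma> \<I> \<phi>)"

section \<open>The axioms of preadditive semicategories\<close>

abbreviation tm_mult :: "'o \<Rightarrow> 'o \<Rightarrow> 'o \<Rightarrow> ('o, 'c, 'f) tm \<Rightarrow> ('o, 'c, 'f) tm \<Rightarrow> ('o, 'c, 'f) tm" where
  "tm_mult u v w s t \<equiv> App (Times u v w) [s, t]"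

abbreviation tm_add :: "'o \<Rightarrow> 'o \<Rightarrow> ('o, 'c, 'f) tm \<Rightarrow> ('o, 'c, 'f) tm \<Rightarrow> ('o, 'c, 'f) tm" where
  "tm_add u v s t \<equiv> App (Plus u v) [s, t]"

definition ax_mult_assoc :: "'o \<Rightarrow> 'o \<Rightarrow> 'o \<Rightarrow> 'o \<Rightarrow> ('o, 'c, 'f) fm" where
  "ax_mult_assoc u u' v v' =
     (let x = (0, (v', v)); y = (1, (u', v')); z = (2, (u, u')) in
      All x (All y (All z
        (Eq (tm_mult u v v' (Var x) (tm_mult u v' u' (Var y) (Var z)))
            (tm_mult u v u' (tm_mult u' v v' (Var x) (Var y)) (Var z))))))"

definition ax_add_assoc :: "'o \<Rightarrow> 'o \<Rightarrow> ('o, 'c, 'f) fm" where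
  "ax_add_assoc u v =
     (let x = (0, (u, v)); y = (1, (u, v)); z = (2, (u, v)) in
      All x (All y (All z
        (Eq (tm_add u v (Var x) (tm_add u v (Var y) (Var z)))
            (tm_add u v (tm_add u v (Var x) (Var y)) (Var z))))))"

definition ax_add_zero :: "'o \<Rightarrow> 'o \<Rightarrow> ('o, 'c, 'f) fm" where
  "ax_add_zero u v =
     (let x = (0, (u, v)) in
      All x (Eq (tm_add u v (Var x) (Const (Zero u v))) (Var x)))"

definition ax_add_minus :: "'o \<Rightarrow> 'o \<Rightarrow> ('o, 'c, 'f) fm" where
  "ax_add_minus u v =
     (let x = (0, (u, v)) in
      All x (Eq (tm_add u v (Var x) (App (Uminus u v) [Var x])) (Const (Zero u v))))"

definition ax_add_comm :: "'o \<Rightarrow> 'o \<Rightarrow> ('o, 'c, 'f) fm" where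
  "ax_add_comm u v =
     (let x = (0, (u, v)); y = (1, (u, v)) in
      All x (All y (Eq (tm_add u v (Var x) (Var y)) (tm_add u v (Var y) (Var x)))))"

definition ax_distrib_left :: "'o \<Rightarrow> 'o \<Rightarrow> 'o \<Rightarrow> ('o, 'c, 'f) fm" where
  "ax_distrib_left u v v' =
     (let x = (0, (v', v)); y = (1, (u, v')); z = (2, (u, v')) in
      All x (All y (All z
        (Eq (tm_mult u v v' (Var x) (tm_add u v' (Var y) (Var z)))
            (tm_add u v (tm_mult u v v' (Var x) (Var y)) (tm_mult u v v' (Var x) (Var z)))))))"

definition ax_distrib_right :: "'o \<Rightarrow> 'o \<Rightarrow> 'o \<Rightarrow> ('o, 'c, 'f) fm" where
  "ax_distrib_right u v v' =
     (let x = (0, (v', v)); y = (1, (v', v)); z = (2, (u, v')) in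
      All x (All y (All z
        (Eq (tm_mult u v v' (tm_add v' v (Var x) (Var y)) (Var z))
            (tm_add u v (tm_mult u v v' (Var x) (Var z)) (tm_mult u v v' (Var y) (Var z)))))))"

definition axioms :: "('o, 'c, 'f) signature \<Rightarrow> ('o, 'c, 'f) fm set" where
  "axioms \<Sigma> = (\<Union>u\<in>objs \<Sigma>. \<Union>u'\<in>objs \<Sigma>. \<Union>v\<in>objs \<Sigma>. \<Union>v'\<in>objs \<Sigma>.
     {ax_mult_assoc u u' v v', ax_add_assoc u v, ax_add_zero u v, ax_add_minus u v,
      ax_add_comm u v, ax_distrib_left u v v', ax_distrib_right u v v'})"

section \<open>Substitution and free variables\<close>

fun subst_tm :: "('o var \<Rightarrow> ('o, 'c, 'f) tm) \<Rightarrow> ('o, 'c, 'f) tm \<Rightarrow> ('o, 'c, 'f) tm" where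
  "subst_tm \<tau> (Var x) = \<tau> x"
| "subst_tm \<tau> (Const c) = Const c"
| "subst_tm \<tau> (App f ts) = App f (map (subst_tm \<tau>) ts)"

text \<open>
  Apply a map on terms to all the terms of a formula. It ignores binders and is only used on
  quantifier-free formulas, so that no variable can be captured.
\<close>

fun map_terms ::
  "(('o, 'c, 'f) tm \<Rightarrow> ('o, 'c, 'f) tm) \<Rightarrow> ('o, 'c, 'f) fm \<Rightarrow> ('o, 'c, 'f) fm" where
  "map_terms h (Eq s t) = Eq (h s) (h t)"
| "map_terms h (Neg \<phi>) = Neg (map_terms h \<phi>)"
| "map_terms h (Or \<phi> \<psi>) = Or (map_terms h \<phi>) (map_terms h \<psi>)"
| "map_terms h (And \<phi> \<psi>) = And (map_terms h \<phi>) (map_terms h \<psi>)"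
| "map_terms h (Imp \<phi> \<psi>) = Imp (map_terms h \<phi>) (map_terms h \<psi>)"
| "map_terms h (Ex x \<phi>) = Ex x (map_terms h \<phi>)"
| "map_terms h (All x \<phi>) = All x (map_terms h \<phi>)"

fun vars_tm :: "('o, 'c, 'f) tm \<Rightarrow> 'o var list" where
  "vars_tm (Var x) = [x]"
| "vars_tm (Const c) = []"
| "vars_tm (App f ts) = concat (map vars_tm ts)"

fun free_vars :: "('o, 'c, 'f) fm \<Rightarrow> 'o var list" where
  "free_vars (Eq s t) = vars_tm s @ vars_tm t"
| "free_vars (Neg \<phi>) = free_vars \<phi>"
| "free_vars (Or \<phi> \<psi>) = free_vars \<phi> @ free_vars \<psi>"
| "free_vars (And \<phi> \<psi>) = free_vars \<phi> @ free_vars \<psi>"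
| "free_vars (Imp \<phi> \<psi>) = free_vars \<phi> @ free_vars \<psi>"
| "free_vars (Ex x \<phi>) = removeAll x (free_vars \<phi>)"
| "free_vars (All x \<phi>) = removeAll x (free_vars \<phi>)"

fun ground_fm :: "('o, 'c, 'f) fm \<Rightarrow> bool" where
  "ground_fm (Eq s t) \<longleftrightarrow> vars_tm s = [] \<and> vars_tm t = []"
| "ground_fm (Neg \<phi>) \<longleftrightarrow> ground_fm \<phi>"
| "ground_fm (Or \<phi> \<psi>) \<longleftrightarrow> ground_fm \<phi> \<and> ground_fm \<psi>"
| "ground_fm (And \<phi> \<psi>) \<longleftrightarrow> ground_fm \<phi> \<and> ground_fm \<psi>"
| "ground_fm (Imp \<phi> \<psi>) \<longleftrightarrow> ground_fm \<phi> \<and> ground_fm \<psi>"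
| "ground_fm (Ex x \<phi>) \<longleftrightarrow> False"
| "ground_fm (All x \<phi>) \<longleftrightarrow> False"

section \<open>Herbrand normal form and Herbrand expansion\<close>

definition universal_closure :: "('o, 'c, 'f) fm \<Rightarrow> ('o, 'c, 'f) fm" where
  "universal_closure \<phi> = foldr All (remdups (free_vars \<phi>)) \<phi>"

datatype quant = Exq | Allq

fun dual :: "quant \<times> 'o var \<Rightarrow> quant \<times> 'o var" where
  "dual (Exq, x) = (Allq, x)"
| "dual (Allq, x) = (Exq, x)"

text \<open>
  \<open>prenex k \<rho> \<phi>\<close> is the quantifier prefix and the matrix of a prenex form of \<open>\<phi>\<close>. Each quantified
  variable is renamed to the next unused index, starting with \<open>k\<close>; \<open>\<rho>\<close> records the renaming of the
  variables in whose scope \<open>\<phi>\<close> stands, and the last component is the next unused index.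
\<close>

fun prenex :: "nat \<Rightarrow> ('o var \<Rightarrow> 'o var) \<Rightarrow> ('o, 'c, 'f) fm \<Rightarrow>
    (quant \<times> 'o var) list \<times> ('o, 'c, 'f) fm \<times> nat" where
  "prenex k \<rho> (Eq s t) = ([], Eq (subst_tm (Var \<circ> \<rho>) s) (subst_tm (Var \<circ> \<rho>) t), k)"
| "prenex k \<rho> (Neg \<phi>) =
     (let (P, M, k') = prenex k \<rho> \<phi> in (map dual P, Neg M, k'))"
| "prenex k \<rho> (Or \<phi> \<psi>) =
     (let (P, M, k') = prenex k \<rho> \<phi>; (Q, N, k'') = prenex k' \<rho> \<psi> in (P @ Q, Or M N, k''))"
| "prenex k \<rho> (And \<phi> \<psi>) =
     (let (P, M, k') = prenex k \<rho> \<phi>; (Q, N, k'') = prenex k' \<rho> \<psi> in (P @ Q, And M N, k''))"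
| "prenex k \<rho> (Imp \<phi> \<psi>) =
     (let (P, M, k') = prenex k \<rho> \<phi>; (Q, N, k'') = prenex k' \<rho> \<psi>
      in (map dual P @ Q, Imp M N, k''))"
| "prenex k \<rho> (Ex x \<phi>) =
     (let y = (k, snd x); (P, M, k') = prenex (Suc k) (\<rho>(x := y)) \<phi> in ((Exq, y) # P, M, k'))"
| "prenex k \<rho> (All x \<phi>) =
     (let y = (k, snd x); (P, M, k') = prenex (Suc k) (\<rho>(x := y)) \<phi> in ((Allq, y) # P, M, k'))"

datatype 'a ext = Old 'a | New nat

type_synonym ('o, 'c, 'f) hfm = "('o, 'c ext, 'f ext) fm"

text \<open>
  \<open>herbrandise i xs P M\<close> works off the prefix \<open>P\<close> of the prenex sentence with matrix \<open>M\<close>, where \<open>xs\<close>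
  are the existential variables met so far and \<open>New i\<close> is the next fresh symbol. It returns the
  remaining (existential) prefix, the new matrix, and the types of the fresh symbols in order; an
  empty list of argument sorts marks a fresh constant. The quantified variables are assumed to be
  pairwise distinct, which holds for the result of \<open>prenex\<close>.
\<close>

fun herbrandise :: "nat \<Rightarrow> 'o var list \<Rightarrow> (quant \<times> 'o var) list \<Rightarrow> ('o, 'c, 'f) hfm \<Rightarrow>
    'o var list \<times> ('o, 'c, 'f) hfm \<times> ('o sort list \<times> 'o sort) list" where
  "herbrandise i xs [] M = (xs, M, [])"
| "herbrandise i xs ((Exq, x) # P) M = herbrandise i (xs @ [x]) P M"
| "herbrandise i xs ((Allq, y) # P) M =
     (let t = (if xs = [] then Const (Con (New i)) else App (Fun (New i)) (map Var xs));
          (zs, N, ss) = herbrandise (Suc i) xs P (map_terms (subst_tm (Var(y := t))) M)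
      in (zs, N, (map snd xs, snd y) # ss))"

definition herbrand_data ::
  "('o, 'c, 'f) fm \<Rightarrow> 'o var list \<times> ('o, 'c, 'f) hfm \<times> ('o sort list \<times> 'o sort) list" where
  "herbrand_data \<phi> =
     (let (P, M, _) = prenex 0 id (universal_closure \<phi>)
      in herbrandise 0 [] P (map_fm id Old Old M))"

text \<open>For \<open>\<phi>\<^sup>H = \<exists>x\<^sub>1 \<dots> x\<^sub>n. \<phi>\<^sup>*\<close>: the variables, the matrix, and the sentence itself.\<close>

definition herbrand_vars :: "('o, 'c, 'f) fm \<Rightarrow> 'o var list" where
  "herbrand_vars \<phi> = fst (herbrand_data \<phi>)"

definition herbrand_matrix :: "('o, 'c, 'f) fm \<Rightarrow> ('o, 'c, 'f) hfm" where
  "herbrand_matrix \<phi> = fst (snd (herbrand_data \<phi>))"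

definition herbrand_nf :: "('o, 'c, 'f) fm \<Rightarrow> ('o, 'c, 'f) hfm" where
  "herbrand_nf \<phi> = foldr Ex (herbrand_vars \<phi>) (herbrand_matrix \<phi>)"

definition herbrand_sig ::
  "('o, 'c, 'f) signature \<Rightarrow> ('o, 'c, 'f) fm \<Rightarrow> ('o, 'c ext, 'f ext) signature" where
  "herbrand_sig \<Sigma> \<phi> =
     (let ss = snd (snd (herbrand_data \<phi>)) in
      \<lparr> objs = objs \<Sigma>,
        con_syms = Old ` con_syms \<Sigma> \<union> New ` {i. i < length ss \<and> fst (ss ! i) = []},
        fun_syms = Old ` fun_syms \<Sigma> \<union> New ` {i. i < length ss \<and> fst (ss ! i) \<noteq> []},
        con_sort = case_ext (con_sort \<Sigma>) (\<lambda>i. snd (ss ! i)),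
        fun_sort = case_ext (fun_sort \<Sigma>) (\<lambda>i. ss ! i) \<rparr>)"

definition herbrand_expansion ::
  "('o, 'c, 'f) signature \<Rightarrow> ('o, 'c, 'f) fm \<Rightarrow> ('o, 'c, 'f) hfm set" where
  "herbrand_expansion \<Sigma> \<phi> =
     {map_terms (subst_tm \<tau>) (herbrand_matrix \<phi>) | \<tau>.
        \<forall>x. if x \<in> set (herbrand_vars \<phi>)
            then has_sort (herbrand_sig \<Sigma> \<phi>) (\<tau> x) (snd x) \<and> vars_tm (\<tau> x) = []
            else \<tau> x = Var x}"

section \<open>Ackermann reduction\<close>

text \<open>\<open>Inst f i\<close> is the fresh constant for the \<open>i\<close>-th instance of \<open>f\<close>, counting from 0.\<close>

datatype ('c, 'f) ack_const = Keep 'c | Inst 'f nat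

type_synonym ('o, 'c, 'f) afm = "('o, ('c, 'f) ack_const, 'f) fm"
type_synonym ('o, 'c, 'f) atm = "('o, ('c, 'f) ack_const, 'f) tm"

fun instances_tm :: "'f \<Rightarrow> ('o, 'c, 'f) tm \<Rightarrow> ('o, 'c, 'f) tm list" where
  "instances_tm f (Var x) = []"
| "instances_tm f (Const c) = []"
| "instances_tm f (App g ts) =
     concat (map (instances_tm f) ts) @ (if g = Fun f then [App g ts] else [])"

fun terms_fm :: "('o, 'c, 'f) fm \<Rightarrow> ('o, 'c, 'f) tm list" where
  "terms_fm (Eq s t) = [s, t]"
| "terms_fm (Neg \<phi>) = terms_fm \<phi>"
| "terms_fm (Or \<phi> \<psi>) = terms_fm \<phi> @ terms_fm \<psi>"
| "terms_fm (And \<phi> \<psi>) = terms_fm \<phi> @ terms_fm \<psi>"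
| "terms_fm (Imp \<phi> \<psi>) = terms_fm \<phi> @ terms_fm \<psi>"
| "terms_fm (Ex x \<phi>) = terms_fm \<phi>"
| "terms_fm (All x \<phi>) = terms_fm \<phi>"

definition instances :: "'f \<Rightarrow> ('o, 'c, 'f) fm \<Rightarrow> ('o, 'c, 'f) tm list" where
  "instances f \<psi> = remdups (concat (map (instances_tm f) (terms_fm \<psi>)))"

fun args :: "('o, 'c, 'f) tm \<Rightarrow> ('o, 'c, 'f) tm list" where
  "args (App f ts) = ts"
| "args _ = []"

definition position :: "'a \<Rightarrow> 'a list \<Rightarrow> nat" where
  "position x xs = length (takeWhile (\<lambda>y. y \<noteq> x) xs)"

fun ack_tm :: "'f \<Rightarrow> ('o, 'c, 'f) atm list \<Rightarrow> ('o, 'c, 'f) atm \<Rightarrow> ('o, 'c, 'f) atm" where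
  "ack_tm f fs (Var x) = Var x"
| "ack_tm f fs (Const c) = Const c"
| "ack_tm f fs (App g ts) =
     (if g = Fun f then Const (Con (Inst f (position (App g ts) fs)))
      else App g (map (ack_tm f fs) ts))"

fun conj_list :: "('o, 'c, 'f) fm list \<Rightarrow> ('o, 'c, 'f) fm" where
  "conj_list [\<phi>] = \<phi>"
| "conj_list (\<phi> # \<phi>s) = And \<phi> (conj_list \<phi>s)"

text \<open>
  The implication from the conjunction of a list of formulas. There is no formula for truth, so an
  empty premise is dropped.
\<close>

definition imp_list :: "('o, 'c, 'f) fm list \<Rightarrow> ('o, 'c, 'f) fm \<Rightarrow> ('o, 'c, 'f) fm" where
  "imp_list \<phi>s \<psi> = (if \<phi>s = [] then \<psi> else Imp (conj_list \<phi>s) \<psi>)"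

definition ack_flat :: "'f \<Rightarrow> ('o, 'c, 'f) afm \<Rightarrow> ('o, 'c, 'f) afm" where
  "ack_flat f \<psi> = map_terms (ack_tm f (instances f \<psi>)) \<psi>"

definition ack_fc :: "'f \<Rightarrow> ('o, 'c, 'f) afm \<Rightarrow> ('o, 'c, 'f) afm list" where
  "ack_fc f \<psi> =
     (let fs = instances f \<psi>; ack = ack_tm f fs in
      [imp_list (map2 (\<lambda>s t. Eq (ack s) (ack t)) (args (fs ! i)) (args (fs ! j)))
           (Eq (Const (Con (Inst f i))) (Const (Con (Inst f j)))).
       j \<leftarrow> [0..<length fs], i \<leftarrow> [0..<j]])"

definition ack_remove :: "'f \<Rightarrow> ('o, 'c, 'f) afm \<Rightarrow> ('o, 'c, 'f) afm" where
  "ack_remove f \<psi> = imp_list (ack_fc f \<psi>) (ack_flat f \<psi>)"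

fun nonarith_funs_tm :: "('o, 'c, 'f) tm \<Rightarrow> 'f list" where
  "nonarith_funs_tm (Var x) = []"
| "nonarith_funs_tm (Const c) = []"
| "nonarith_funs_tm (App g ts) =
     (case g of Fun f \<Rightarrow> [f] | _ \<Rightarrow> []) @ concat (map nonarith_funs_tm ts)"

definition nonarith_funs :: "('o, 'c, 'f) fm \<Rightarrow> 'f list" where
  "nonarith_funs \<psi> = remdups (concat (map nonarith_funs_tm (terms_fm \<psi>)))"

definition ackermann :: "('o, 'c, 'f) fm \<Rightarrow> ('o, 'c, 'f) afm" where
  "ackermann \<psi> = fold ack_remove (nonarith_funs \<psi>) (map_fm id Keep id \<psi>)"

section \<open>The free algebra and idealisation\<close>

text \<open>
  The free monoid over \<open>'x\<close>, written additively because \<open>Poly_Mapping\<close> multiplies by convolution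
  along an additive monoid of exponents. The free algebra is then its monoid ring over the integers.
\<close>

datatype 'x mon = Mon (letters: "'x list")

instantiation mon :: (type) monoid_add
begin

definition "0 = Mon []"
definition "m + n = Mon (letters m @ letters n)"

instance
  by standard (simp_all add: zero_mon_def plus_mon_def)

end

type_synonym 'x free_alg = "'x mon \<Rightarrow>\<^sub>0 int"

definition indet :: "'x \<Rightarrow> 'x free_alg" where
  "indet x = Poly_Mapping.single (Mon [x]) 1"

definition two_sided_ideal :: "'a::ring_1 set \<Rightarrow> bool" where
  "two_sided_ideal J \<longleftrightarrow> 0 \<in> J \<and> (\<forall>a\<in>J. \<forall>b\<in>J. a - b \<in> J) \<and> (\<forall>a\<in>J. \<forall>r. r * a \<in> J \<and> a * r \<in> J)"

text \<open>Only meant for ground terms without non-arithmetic function symbols.\<close>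

fun to_alg :: "('o, 'x, 'f) tm \<Rightarrow> 'x free_alg" where
  "to_alg (Const (Zero u v)) = 0"
| "to_alg (Const (Con c)) = indet c"
| "to_alg (App (Uminus u v) [s]) = - to_alg s"
| "to_alg (App (Plus u v) [s, t]) = to_alg s + to_alg t"
| "to_alg (App (Times u v w) [s, t]) = to_alg s * to_alg t"
| "to_alg _ = undefined"

fun elim_imp :: "('o, 'c, 'f) fm \<Rightarrow> ('o, 'c, 'f) fm" where
  "elim_imp (Imp \<phi> \<psi>) = Or (Neg (elim_imp \<phi>)) (elim_imp \<psi>)"
| "elim_imp (Neg \<phi>) = Neg (elim_imp \<phi>)"
| "elim_imp (Or \<phi> \<psi>) = Or (elim_imp \<phi>) (elim_imp \<psi>)"
| "elim_imp (And \<phi> \<psi>) = And (elim_imp \<phi>) (elim_imp \<psi>)"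
| "elim_imp \<phi> = \<phi>"

fun push_neg :: "('o, 'c, 'f) fm \<Rightarrow> ('o, 'c, 'f) fm" where
  "push_neg (Neg (Neg \<phi>)) = push_neg \<phi>"
| "push_neg (Neg (Or \<phi> \<psi>)) = And (push_neg (Neg \<phi>)) (push_neg (Neg \<psi>))"
| "push_neg (Neg (And \<phi> \<psi>)) = Or (push_neg (Neg \<phi>)) (push_neg (Neg \<psi>))"
| "push_neg (Or \<phi> \<psi>) = Or (push_neg \<phi>) (push_neg \<psi>)"
| "push_neg (And \<phi> \<psi>) = And (push_neg \<phi>) (push_neg \<psi>)"
| "push_neg \<phi> = \<phi>"

text \<open>Distribution of disjunction over conjunction; a clause is the list of its literals.\<close>

fun distribute :: "('o, 'c, 'f) fm \<Rightarrow> ('o, 'c, 'f) fm list list" where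
  "distribute (And \<phi> \<psi>) = distribute \<phi> @ distribute \<psi>"
| "distribute (Or \<phi> \<psi>) = [C @ D. C \<leftarrow> distribute \<phi>, D \<leftarrow> distribute \<psi>]"
| "distribute \<phi> = [[\<phi>]]"

definition cnf :: "('o, 'c, 'f) fm \<Rightarrow> ('o, 'c, 'f) fm list list" where
  "cnf \<phi> = distribute (push_neg (elim_imp \<phi>))"

definition generators :: "('o, 'x, 'f) fm list \<Rightarrow> 'x free_alg list" where
  "generators C = [to_alg s - to_alg t. Neg (Eq s t) \<leftarrow> C]"

definition candidates :: "('o, 'x, 'f) fm list \<Rightarrow> 'x free_alg list" where
  "candidates C = [to_alg p - to_alg q. Eq p q \<leftarrow> C]"

definition idealisation :: "('o, 'x, 'f) fm \<Rightarrow> bool" where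
  "idealisation \<phi> \<longleftrightarrow>
     (\<forall>C\<in>set (cnf \<phi>). \<exists>p\<in>set (candidates C). p \<in> two_sided_ideal hull set (generators C))"

section \<open>The semi-decision procedure\<close>

text \<open>
  A procedure taking a finite list of generators and an element, with one application of \<open>step\<close> per
  operation.
\<close>

record ('x, 's) membership_proc =
  init :: "'x free_alg list \<Rightarrow> 'x free_alg \<Rightarrow> 's"
  step :: "'s \<Rightarrow> 's"
  accepting :: "'s \<Rightarrow> bool"

definition accepts_within ::
  "('x, 's) membership_proc \<Rightarrow> nat \<Rightarrow> 'x free_alg list \<Rightarrow> 'x free_alg \<Rightarrow> bool" where
  "accepts_within \<P> n G p \<longleftrightarrow> (\<exists>m\<le>n. accepting \<P> ((step \<P> ^^ m) (init \<P> G p)))"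

definition semi_decides_membership :: "('x, 's) membership_proc \<Rightarrow> bool" where
  "semi_decides_membership \<P> \<longleftrightarrow>
     (\<forall>G p. (\<exists>n. accepts_within \<P> n G p) \<longleftrightarrow> p \<in> two_sided_ideal hull set G)"

text \<open>
  \<open>idealisation \<phi>\<close> can be verified with at most \<open>n\<close> operations altogether: \<open>ms\<close> distributes the
  operations to the clauses.
\<close>

definition verified_within ::
  "('x, 's) membership_proc \<Rightarrow> nat \<Rightarrow> ('o, 'x, 'f) fm \<Rightarrow> bool" where
  "verified_within \<P> n \<phi> \<longleftrightarrow>
     (\<exists>ms. sum_list ms \<le> n \<and>
        list_all2 (\<lambda>C m. \<exists>p\<in>set (candidates C). accepts_within \<P> m (generators C) p) (cnf \<phi>) ms)"

lemma ex_verified_within_iff: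
  assumes "semi_decides_membership \<P>"
  shows "(\<exists>n. verified_within \<P> n \<phi>) \<longleftrightarrow> idealisation \<phi>"
proof -
  let ?R = "\<lambda>C m. \<exists>p\<in>set (candidates C). accepts_within \<P> m (generators C) p"
  have "(\<exists>n. verified_within \<P> n \<phi>) \<longleftrightarrow> (\<exists>ms. list_all2 ?R (cnf \<phi>) ms)"
    by (auto simp: verified_within_def)
  also have "\<dots> \<longleftrightarrow> (\<forall>C\<in>set (cnf \<phi>). \<exists>m. ?R C m)"
  proof -
    have "(\<exists>ms. list_all2 ?R Cs ms) \<longleftrightarrow> (\<forall>C\<in>set Cs. \<exists>m. ?R C m)" for Cs
    proof (induction Cs)
      case (Cons C Cs)
      have "(\<exists>ms. list_all2 ?R (C # Cs) ms) \<longleftrightarrow> (\<exists>m. ?R C m) \<and> (\<exists>ms. list_all2 ?R Cs ms)"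
        unfolding list_all2_Cons1 by blast
      then show ?case
        by (simp only: Cons.IH list.set ball_simps)
    qed simp
    then show ?thesis .
  qed
  also have "\<dots> \<longleftrightarrow> (\<forall>C\<in>set (cnf \<phi>). \<exists>p\<in>set (candidates C). \<exists>m. accepts_within \<P> m (generators C) p)"
    by blast
  also have "\<dots> \<longleftrightarrow> idealisation \<phi>"
    using assms by (simp add: semi_decides_membership_def idealisation_def)
  finally show ?thesis .
qed

text \<open>
  The state at the beginning of the \<open>n\<close>-th pass: \<open>disj\<close> is \<open>\<psi>\<^sub>n\<close> and \<open>acks\<close> lists the Ackermann
  reductions of \<open>\<psi>\<^sub>1, \<dots>, \<psi>\<^sub>n\<close>; \<open>returned\<close> is set once the procedure returns.
\<close>

record ('o, 'c, 'f) state =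
  pass :: nat
  disj :: "('o, 'c, 'f) hfm"
  acks :: "('o, 'c ext, 'f ext) afm list"
  returned :: "bool option"

text \<open>The enumeration is indexed from 0, so \<open>enum n\<close> is \<open>\<phi>\<^bsub>n+1\<^esub>\<close>.\<close>

definition start :: "(nat \<Rightarrow> ('o, 'c, 'f) hfm) \<Rightarrow> ('o, 'c, 'f) state" where
  "start enum = \<lparr> pass = 1, disj = enum 0, acks = [ackermann (enum 0)], returned = None \<rparr>"

definition one_pass ::
  "(('c ext, 'f ext) ack_const, 's) membership_proc \<Rightarrow> (nat \<Rightarrow> ('o, 'c, 'f) hfm) \<Rightarrow>
   ('o, 'c, 'f) fm \<Rightarrow> ('o, 'c, 'f) state \<Rightarrow> ('o, 'c, 'f) state" where
  "one_pass \<P> enum \<phi> st =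
     (let n = pass st in
      if \<exists>k\<in>{1..n}. verified_within \<P> n (acks st ! (k - 1)) then st \<lparr> returned := Some True \<rparr>
      else if ground_fm (herbrand_nf \<phi>) then
        st \<lparr> pass := n + 1, acks := acks st @ [last (acks st)] \<rparr>
      else
        let \<psi> = Or (disj st) (enum n) in
        st \<lparr> pass := n + 1, disj := \<psi>, acks := acks st @ [ackermann \<psi>] \<rparr>)"

text \<open>The output of the procedure, or \<open>None\<close> if it runs forever.\<close>

definition procedure ::
  "(('c ext, 'f ext) ack_const, 's) membership_proc \<Rightarrow> (nat \<Rightarrow> ('o, 'c, 'f) hfm) \<Rightarrow>
   ('o, 'c, 'f) fm \<Rightarrow> bool option" where
  "procedure \<P> enum \<phi> =
     Option.bind (while_option (\<lambda>st. returned st = None) (one_pass \<P> enum \<phi>) (start enum)) returned"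

end

theory Submission
  imports "HOL-Algebra.Free_Abelian_Groups" "HOL-Library.Diagonal_Subsequence"
    "HOL-Library.Countable" Defs
begin

text \<open>
  By prenexing, Skolemisation of countermodels and a compactness argument over the countably many
  ground terms of a subsignature with finitely many old symbols, \<open>\<phi>\<close> is entailed iff some finite
  disjunction of Herbrand instances is valid in all preadditive semicategories. The compactness step
  takes a diagonal subsequence along which the truth value of every ground equation stabilises, so the
  countermodel is a countable quotient of ground terms. Ackermann reduction preserves refutability in
  both directions, which leaves clauses of equations between arithmetic ground terms.

  If a clause is not idealised, the quotient of the free algebra by the ideal of its negative
  literals, used as the domain of every sort, refutes it. Conversely, in a semicategory that satisfies
  the negated literals, the words over the constants compose, where sorts match, to elements; extending
  this linearly, sort by sort, gives maps on the free algebra whose common kernel is a two-sided ideal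
  containing the generators. An element of the ideal is thus zero in the semicategory, although the
  free algebra ignores sorts.
\<close>

section \<open>Semantics\<close>

text \<open>Entailment refers to one fixed infinite type \<open>'m\<close>, whereas the
  countermodels that a failed idealisation yields live in a free algebra and differ from disjunction
  to disjunction. A common countermodel must therefore also be countable, so that it can be moved
  into \<open>'m\<close>. An ultraproduct could be too large, and the signature itself may be
  uncountable; hence the limit along a subsequence and the restriction to the symbols of \<phi>
  together with the objects of their sorts. The other obstacle is that the free algebra multiplies
  words whose sorts do not match, so it has no ring homomorphism into the semicategory. Sending
  ill-sorted words to zero gives maps that are merely additive, and the kernel of one such map need
  not be an ideal: a word of the wrong sort lies in it, but may acquire the right sort by a further
  multiplication. Requiring a zero value between all surrounding elements on both sides repairs
  this.\<close>

declare split_paired_All [simp del] split_paired_Ex [simp del]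

definition well_assigned ::
  "('o, 'c, 'f) signature \<Rightarrow> ('o, 'c, 'f, 'm) interp \<Rightarrow> ('o var \<Rightarrow> 'm) \<Rightarrow> bool" where
  "well_assigned \<Sigma> \<I> \<beta> \<longleftrightarrow> (\<forall>x. snd x \<in> sorts \<Sigma> \<longrightarrow> \<beta> x \<in> dom_set \<I> (snd x))"

lemma well_assigned_upd:
  "well_assigned \<Sigma> \<I> \<beta> \<Longrightarrow> a \<in> dom_set \<I> (snd x) \<Longrightarrow> well_assigned \<Sigma> \<I> (\<beta>(x := a))"
  by (auto simp: well_assigned_def)

lemma ex_well_assigned: "is_interp \<Sigma> \<I> \<Longrightarrow> \<exists>\<beta>. well_assigned \<Sigma> \<I> \<beta>"
  by (rule exI[of _ "\<lambda>x. SOME a. a \<in> dom_set \<I> (snd x)"])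
    (auto simp: well_assigned_def is_interp_def some_in_eq)

lemma is_model_iff:
  "is_model \<Sigma> \<I> \<phi> \<longleftrightarrow> is_interp \<Sigma> \<I> \<and> (\<forall>\<beta>. well_assigned \<Sigma> \<I> \<beta> \<longrightarrow> sat \<I> \<beta> \<phi>)"
  by (simp add: is_model_def well_assigned_def)

lemma eval_cong: "(\<And>x. x \<in> set (vars_tm t) \<Longrightarrow> \<beta> x = \<beta>' x) \<Longrightarrow> eval \<I> \<beta> t = eval \<I> \<beta>' t"
proof (induction t)
  case (App f ts)
  then have "map (eval \<I> \<beta>) ts = map (eval \<I> \<beta>') ts"
    by fastforce
  then show ?case by (metis eval.simps(3))
qed auto

lemma sat_cong:
  "(\<And>x. x \<in> set (free_vars \<phi>) \<Longrightarrow> \<beta> x = \<beta>' x) \<Longrightarrow> sat \<I> \<beta> \<phi> \<longleftrightarrow> sat \<I> \<beta>' \<phi>"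
proof (induction \<phi> arbitrary: \<beta> \<beta>')
  case (Eq s t)
  then show ?case using eval_cong[of s \<beta> \<beta>'] eval_cong[of t \<beta> \<beta>'] by auto
next
  case (Or \<phi>1 \<phi>2)
  from Or.IH(1)[of \<beta> \<beta>'] Or.IH(2)[of \<beta> \<beta>'] Or.prems show ?case by auto
next
  case (And \<phi>1 \<phi>2)
  from And.IH(1)[of \<beta> \<beta>'] And.IH(2)[of \<beta> \<beta>'] And.prems show ?case by auto
next
  case (Imp \<phi>1 \<phi>2)
  from Imp.IH(1)[of \<beta> \<beta>'] Imp.IH(2)[of \<beta> \<beta>'] Imp.prems show ?case by auto
next
  case (Neg \<phi>)
  from Neg.IH[of \<beta> \<beta>'] Neg.prems show ?case by auto
next
  case (Ex x \<phi>)
  have "sat \<I> (\<beta>(x := a)) \<phi> \<longleftrightarrow> sat \<I> (\<beta>'(x := a)) \<phi>" for a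
    by (rule Ex.IH) (use Ex.prems in auto)
  then show ?case by simp
next
  case (All x \<phi>)
  have "sat \<I> (\<beta>(x := a)) \<phi> \<longleftrightarrow> sat \<I> (\<beta>'(x := a)) \<phi>" for a
    by (rule All.IH) (use All.prems in auto)
  then show ?case by simp
qed

lemma eval_subst: "eval \<I> \<beta> (subst_tm \<tau> t) = eval \<I> (\<lambda>x. eval \<I> \<beta> (\<tau> x)) t"
proof (induction t)
  case (App f ts)
  then have "map (eval \<I> \<beta>) (map (subst_tm \<tau>) ts) = map (eval \<I> (\<lambda>x. eval \<I> \<beta> (\<tau> x))) ts"
    by simp
  then show ?case by (metis eval.simps(3) subst_tm.simps(3))
qed auto

fun quantifier_free :: "('o, 'c, 'f) fm \<Rightarrow> bool" where
  "quantifier_free (Eq s t) \<longleftrightarrow> True"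
| "quantifier_free (Neg \<phi>) \<longleftrightarrow> quantifier_free \<phi>"
| "quantifier_free (Or \<phi> \<psi>) \<longleftrightarrow> quantifier_free \<phi> \<and> quantifier_free \<psi>"
| "quantifier_free (And \<phi> \<psi>) \<longleftrightarrow> quantifier_free \<phi> \<and> quantifier_free \<psi>"
| "quantifier_free (Imp \<phi> \<psi>) \<longleftrightarrow> quantifier_free \<phi> \<and> quantifier_free \<psi>"
| "quantifier_free (Ex x \<phi>) \<longleftrightarrow> False"
| "quantifier_free (All x \<phi>) \<longleftrightarrow> False"

text \<open>The two sides may use different interpretations and assignments, so the lemma serves
  both substitution and Ackermann flattening. Under a binder the assignments would change while
  \<open>h\<close> stays fixed, hence the restriction to quantifier-free formulas.\<close>

lemma sat_map_terms:
  "quantifier_free \<phi> \<Longrightarrow> (\<And>t. t \<in> set (terms_fm \<phi>) \<Longrightarrow> eval \<I> \<beta> (h t) = eval \<J> \<beta>' t) \<Longrightarrow>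
   sat \<I> \<beta> (map_terms h \<phi>) \<longleftrightarrow> sat \<J> \<beta>' \<phi>"
  by (induction \<phi>) auto

lemma sat_subst:
  "quantifier_free \<phi> \<Longrightarrow>
   sat \<I> \<beta> (map_terms (subst_tm \<tau>) \<phi>) \<longleftrightarrow> sat \<I> (\<lambda>x. eval \<I> \<beta> (\<tau> x)) \<phi>"
  by (rule sat_map_terms) (auto simp: eval_subst)

lemma quantifier_free_map_terms [simp]: "quantifier_free (map_terms h \<phi>) \<longleftrightarrow> quantifier_free \<phi>"
  by (induction \<phi>) auto

lemma terms_fm_map_terms [simp]: "terms_fm (map_terms h \<phi>) = map h (terms_fm \<phi>)"
  by (induction \<phi>) auto

lemma free_vars_quantifier_free:
  "quantifier_free \<phi> \<Longrightarrow> set (free_vars \<phi>) = (\<Union>t\<in>set (terms_fm \<phi>). set (vars_tm t))"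
  by (induction \<phi>) auto

lemma is_formula_quantifier_free_cases:
  "quantifier_free \<phi> \<Longrightarrow> is_formula \<Sigma> \<phi> \<Longrightarrow> t \<in> set (terms_fm \<phi>) \<Longrightarrow> \<exists>a. has_sort \<Sigma> t a"
  by (induction \<phi>) auto

lemma is_formula_map_terms:
  "quantifier_free \<phi> \<Longrightarrow> is_formula \<Sigma> \<phi> \<Longrightarrow>
   (\<And>t a. t \<in> set (terms_fm \<phi>) \<Longrightarrow> has_sort \<Sigma> t a \<Longrightarrow> has_sort \<Sigma>' (h t) a) \<Longrightarrow>
   is_formula \<Sigma>' (map_terms h \<phi>)"
proof (induction \<phi>)
  case (Eq s t)
  then obtain a where "has_sort \<Sigma> s a" "has_sort \<Sigma> t a" by auto
  with Eq.prems(3)[of s a] Eq.prems(3)[of t a] show ?case by auto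
qed auto

lemma eval_in_dom:
  assumes "has_sort \<Sigma> t a" "is_interp \<Sigma> \<I>" "well_assigned \<Sigma> \<I> \<beta>"
  shows "eval \<I> \<beta> t \<in> dom_set \<I> a"
  using assms(1)
proof (induction rule: has_sort.induct)
  case (1 x)
  then show ?case using assms(3) by (simp add: well_assigned_def del: split_paired_All)
next
  case (2 c)
  then show ?case using assms(2) by (simp add: is_interp_def)
next
  case (3 f ts)
  from 3(2) have "list_all2 (\<lambda>a s. a \<in> dom_set \<I> s) (map (eval \<I> \<beta>) ts) (fst (func_sort \<Sigma> f))"
    by (auto simp: list_all2_conv_all_nth)
  with 3(1) assms(2) have "fn \<I> f (map (eval \<I> \<beta>) ts) \<in> dom_set \<I> (snd (func_sort \<Sigma> f))"
    unfolding is_interp_def by blast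
  then show ?case by (metis eval.simps(3))
qed

lemma has_sort_vars: "has_sort \<Sigma> t a \<Longrightarrow> x \<in> set (vars_tm t) \<Longrightarrow> snd x \<in> sorts \<Sigma>"
proof (induction rule: has_sort.induct)
  case (3 f ts)
  then obtain t where "t \<in> set ts" "x \<in> set (vars_tm t)" by auto
  then obtain i where "i < length ts" "x \<in> set (vars_tm (ts ! i))"
    by (metis in_set_conv_nth)
  with 3(2) show ?case by (auto simp: list_all2_conv_all_nth)
qed auto

lemma has_sort_subst:
  assumes "has_sort \<Sigma> t a" "\<And>x. snd x \<in> sorts \<Sigma> \<Longrightarrow> x \<in> set (vars_tm t) \<Longrightarrow> has_sort \<Sigma> (\<tau> x) (snd x)"
  shows "has_sort \<Sigma> (subst_tm \<tau> t) a"
  using assms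
proof (induction rule: has_sort.induct)
  case (2 c)
  then show ?case by (simp add: has_sort.intros(2))
next
  case (3 f ts)
  have "has_sort \<Sigma> (subst_tm \<tau> (ts ! i)) (fst (func_sort \<Sigma> f) ! i)" if i: "i < length ts" for i
  proof -
    have "set (vars_tm (ts ! i)) \<subseteq> set (vars_tm (App f ts))"
      using nth_mem[OF i] by (simp, blast)
    with 3(2,3) i show ?thesis
      unfolding list_all2_conv_all_nth by blast
  qed
  then have "list_all2 (has_sort \<Sigma>) (map (subst_tm \<tau>) ts) (fst (func_sort \<Sigma> f))"
    using 3(2) unfolding list_all2_conv_all_nth by simp
  with 3(1) show ?case by (simp add: has_sort.intros(3))
qed auto

lemma vars_subst: "set (vars_tm (subst_tm \<tau> t)) = (\<Union>x\<in>set (vars_tm t). set (vars_tm (\<tau> x)))"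
  by (induction t) auto

lemma has_sort_sorts:
  assumes "wf_signature \<Sigma>" "has_sort \<Sigma> t a"
  shows "a \<in> sorts \<Sigma>"
  using assms(2,1)
  by (induction rule: has_sort.induct)
    (auto simp: all_consts_def all_funs_def wf_signature_def sorts_def)

section \<open>Renaming of symbols and reducts\<close>

definition reduct :: "('c \<Rightarrow> 'c2) \<Rightarrow> ('f \<Rightarrow> 'f2) \<Rightarrow> ('o, 'c2, 'f2, 'm) interp \<Rightarrow> ('o, 'c, 'f, 'm) interp" where
  "reduct g h \<J> = \<lparr> dom_set = dom_set \<J>, con = con \<J> \<circ> map_const_sym id g,
     fn = fn \<J> \<circ> map_fun_sym id h \<rparr>"

text \<open>The map function of the datatype also renames the objects inside the sort that a
  variable carries; for \<open>id\<close> this action has to disappear before variables can be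
  compared.\<close>

lemma map_tm_simps_id [simp]:
  "map_tm id g h (Var x) = Var x"
  "map_fm id g h (Ex x \<phi>) = Ex x (map_fm id g h \<phi>)"
  "map_fm id g h (All x \<phi>) = All x (map_fm id g h \<phi>)"
  by (simp_all add: prod.map_id0)

lemma eval_map_tm: "eval \<J> \<beta> (map_tm id g h t) = eval (reduct g h \<J>) \<beta> t"
proof (induction t)
  case (App f ts)
  then have "map (eval \<J> \<beta> \<circ> map_tm id g h) ts = map (eval (reduct g h \<J>) \<beta>) ts"
    unfolding map_eq_conv o_def by blast
  then show ?case by (simp add: reduct_def id_def del: map_eq_conv)
qed (auto simp: reduct_def id_def map_tm_simps_id(1)[unfolded id_def] simp del: tm.map(1))

lemma dom_reduct [simp]: "dom_set (reduct g h \<J>) = dom_set \<J>"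
  by (simp add: reduct_def)

text \<open>Moves truth between signatures: \<open>Old\<close> leads into the Herbrand signature and
  \<open>Keep\<close> into the Ackermann signature.\<close>

lemma sat_map_fm: "sat \<J> \<beta> (map_fm id g h \<phi>) \<longleftrightarrow> sat (reduct g h \<J>) \<beta> \<phi>"
  by (induction \<phi> arbitrary: \<beta>) (simp_all add: eval_map_tm prod.map_id0)

lemma vars_map_tm [simp]: "vars_tm (map_tm id g h t) = vars_tm t"
proof (induction t)
  case (App f ts)
  then have "map (vars_tm \<circ> map_tm id g h) ts = map vars_tm ts"
    unfolding map_eq_conv o_def by blast
  then show ?case by (simp add: id_def del: map_eq_conv)
qed (auto simp: prod.map_id0)

lemma quantifier_free_map_fm [simp]: "quantifier_free (map_fm f g h \<phi>) \<longleftrightarrow> quantifier_free \<phi>"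
  by (induction \<phi>) auto

lemma terms_fm_map_fm [simp]: "terms_fm (map_fm f g h \<phi>) = map (map_tm f g h) (terms_fm \<phi>)"
  by (induction \<phi>) auto

section \<open>Prenex normal form\<close>

text \<open>The semantic counterpart of "no variable of \<open>X\<close> occurs free". It is stated
  for arbitrary functions of the assignment and thus covers formulas, values of terms and quantified
  predicates alike.\<close>

definition independent_of :: "'o var set \<Rightarrow> (('o var \<Rightarrow> 'm) \<Rightarrow> 'b) \<Rightarrow> bool" where
  "independent_of X A \<longleftrightarrow> (\<forall>\<beta> \<beta>'. (\<forall>x. x \<notin> X \<longrightarrow> \<beta> x = \<beta>' x) \<longrightarrow> A \<beta> = A \<beta>')"

lemma independent_upd: "independent_of X A \<Longrightarrow> x \<in> X \<Longrightarrow> A (\<beta>(x := a)) = A \<beta>"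
  unfolding independent_of_def by (metis fun_upd_apply)

lemma independent_mono: "independent_of X A \<Longrightarrow> Y \<subseteq> X \<Longrightarrow> independent_of Y A"
  unfolding independent_of_def by (meson subsetD)

lemma independent_sat: "set (free_vars \<phi>) \<inter> X = {} \<Longrightarrow> independent_of X (\<lambda>\<beta>. sat \<I> \<beta> \<phi>)"
  unfolding independent_of_def by (meson disjoint_iff sat_cong)

lemma independent_eval: "set (vars_tm t) \<inter> X = {} \<Longrightarrow> independent_of X (\<lambda>\<beta>. eval \<I> \<beta> t)"
  unfolding independent_of_def by (meson disjoint_iff eval_cong)

text \<open>A prefix acts on a predicate on assignments instead of a formula, so that prefixes can
  be split, dualised and moved past one another without building formulas.\<close>

fun sat_prefix :: "('o, 'c, 'f, 'm) interp \<Rightarrow> (quant \<times> 'o var) list \<Rightarrow>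
    (('o var \<Rightarrow> 'm) \<Rightarrow> bool) \<Rightarrow> ('o var \<Rightarrow> 'm) \<Rightarrow> bool" where
  "sat_prefix \<I> [] A \<beta> \<longleftrightarrow> A \<beta>"
| "sat_prefix \<I> ((Exq, x) # P) A \<beta> \<longleftrightarrow> (\<exists>a\<in>dom_set \<I> (snd x). sat_prefix \<I> P A (\<beta>(x := a)))"
| "sat_prefix \<I> ((Allq, x) # P) A \<beta> \<longleftrightarrow> (\<forall>a\<in>dom_set \<I> (snd x). sat_prefix \<I> P A (\<beta>(x := a)))"

lemma snd_dual [simp]: "snd (dual p) = snd p"
  by (cases p rule: dual.cases) auto

lemma snd_dual_comp [simp]: "snd \<circ> dual = snd"
  by auto

lemma sat_prefix_dom:
  "dom_set \<I> = dom_set \<J> \<Longrightarrow> sat_prefix \<I> P A \<beta> \<longleftrightarrow> sat_prefix \<J> P A \<beta>"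
proof (induction P arbitrary: \<beta>)
  case (Cons p P)
  obtain q x where "p = (q, x)" by fastforce
  with Cons show ?case by (cases q) (auto simp: fun_upd_def)
qed auto

lemma sat_prefix_dual:
  "sat_prefix \<I> (map dual P) (\<lambda>\<beta>. \<not> A \<beta>) \<beta> \<longleftrightarrow> \<not> sat_prefix \<I> P A \<beta>"
proof (induction P arbitrary: \<beta>)
  case (Cons p P)
  obtain q x where "p = (q, x)" by fastforce
  with Cons show ?case by (cases q) (auto simp: fun_upd_def)
qed auto

lemma sat_prefix_append:
  "sat_prefix \<I> (P @ Q) A \<beta> \<longleftrightarrow> sat_prefix \<I> P (sat_prefix \<I> Q A) \<beta>"
proof (induction P arbitrary: \<beta>)
  case (Cons p P)
  obtain q x where "p = (q, x)" by fastforce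
  with Cons show ?case by (cases q) (auto simp: fun_upd_def)
qed auto

lemma independent_sat_prefix:
  assumes "independent_of X A"
  shows "independent_of X (sat_prefix \<I> P A)"
proof -
  have "sat_prefix \<I> P A \<beta> \<longleftrightarrow> sat_prefix \<I> P A \<beta>'" if "\<forall>x. x \<notin> X \<longrightarrow> \<beta> x = \<beta>' x" for \<beta> \<beta>'
    using that
  proof (induction P arbitrary: \<beta> \<beta>')
    case Nil
    then show ?case using assms by (simp add: independent_of_def)
  next
    case (Cons p P)
    obtain q x where p: "p = (q, x)" by fastforce
    have "sat_prefix \<I> P A (\<beta>(x := a)) \<longleftrightarrow> sat_prefix \<I> P A (\<beta>'(x := a))" for a
      by (rule Cons.IH) (use Cons.prems in auto)
    then show ?case by (cases q) (auto simp: p)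
  qed
  then show ?thesis by (auto simp: independent_of_def)
qed

text \<open>The variables of the prefix are overwritten before \<open>A\<close> is evaluated, so
  their initial values are forgotten.\<close>

lemma independent_sat_prefix_bound:
  assumes "independent_of X A"
  shows "independent_of (X \<union> snd ` set P) (sat_prefix \<I> P A)"
proof -
  have "sat_prefix \<I> P A \<beta> \<longleftrightarrow> sat_prefix \<I> P A \<beta>'"
    if "\<forall>x. x \<notin> X \<union> snd ` set P \<longrightarrow> \<beta> x = \<beta>' x" for \<beta> \<beta>'
    using that
  proof (induction P arbitrary: \<beta> \<beta>')
    case Nil
    then show ?case using assms by (simp add: independent_of_def)
  next
    case (Cons p P)
    obtain q x where p: "p = (q, x)" by fastforce
    have "sat_prefix \<I> P A (\<beta>(x := a)) \<longleftrightarrow> sat_prefix \<I> P A (\<beta>'(x := a))" for a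
      by (rule Cons.IH) (use Cons.prems in \<open>auto simp: p\<close>)
    then show ?case by (cases q) (auto simp: p)
  qed
  then show ?thesis by (auto simp: independent_of_def)
qed

text \<open>Nonempty domains are essential: an existential quantifier over an empty domain would
  make the left side false even where \<open>B\<close> holds.\<close>

lemma sat_prefix_disj_right:
  assumes "independent_of (snd ` set P) B" "\<forall>x\<in>snd ` set P. dom_set \<I> (snd x) \<noteq> {}"
  shows "sat_prefix \<I> P (\<lambda>\<beta>. A \<beta> \<or> B \<beta>) \<beta> \<longleftrightarrow> sat_prefix \<I> P A \<beta> \<or> B \<beta>"
  using assms
proof (induction P arbitrary: \<beta>)
  case (Cons p P)
  obtain q x where p: "p = (q, x)" by fastforce
  have ne: "dom_set \<I> (snd x) \<noteq> {}" using Cons.prems(2) p by simp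
  have IH: "sat_prefix \<I> P (\<lambda>\<beta>. A \<beta> \<or> B \<beta>) (\<beta>(x := a)) \<longleftrightarrow> sat_prefix \<I> P A (\<beta>(x := a)) \<or> B \<beta>" for a
  proof -
    have "independent_of (snd ` set P) B"
      using Cons.prems(1) by (rule independent_mono) auto
    moreover have "B (\<beta>(x := a)) = B \<beta>"
      using Cons.prems(1) by (rule independent_upd) (simp add: p)
    ultimately show ?thesis using Cons.IH[of "\<beta>(x := a)"] Cons.prems(2) by (metis (no_types, lifting) image_eqI list.set_intros(2) imageE)
  qed
  show ?case using ne by (cases q) (auto simp: p IH)
qed simp

lemma sat_prefix_disj_left:
  assumes "independent_of (snd ` set P) B" "\<forall>x\<in>snd ` set P. dom_set \<I> (snd x) \<noteq> {}"
  shows "sat_prefix \<I> P (\<lambda>\<beta>. B \<beta> \<or> A \<beta>) \<beta> \<longleftrightarrow> B \<beta> \<or> sat_prefix \<I> P A \<beta>"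
  using sat_prefix_disj_right[OF assms, of A \<beta>] by (simp add: disj_commute)

lemma sat_prefix_disj:
  assumes "independent_of (snd ` set P) B" "independent_of (snd ` set Q) A"
    and "\<forall>x\<in>snd ` set (P @ Q). dom_set \<I> (snd x) \<noteq> {}"
  shows "sat_prefix \<I> (P @ Q) (\<lambda>\<beta>. A \<beta> \<or> B \<beta>) \<beta> \<longleftrightarrow> sat_prefix \<I> P A \<beta> \<or> sat_prefix \<I> Q B \<beta>"
proof -
  have "sat_prefix \<I> (P @ Q) (\<lambda>\<beta>. A \<beta> \<or> B \<beta>) \<beta> \<longleftrightarrow>
      sat_prefix \<I> P (sat_prefix \<I> Q (\<lambda>\<beta>. A \<beta> \<or> B \<beta>)) \<beta>"
    by (rule sat_prefix_append)
  also have "sat_prefix \<I> Q (\<lambda>\<beta>. A \<beta> \<or> B \<beta>) = (\<lambda>\<beta>. A \<beta> \<or> sat_prefix \<I> Q B \<beta>)"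
    by (intro ext sat_prefix_disj_left) (use assms(2,3) in auto)
  also have "sat_prefix \<I> P \<dots> \<beta> \<longleftrightarrow> sat_prefix \<I> P A \<beta> \<or> sat_prefix \<I> Q B \<beta>"
    by (rule sat_prefix_disj_right) (use assms in \<open>auto intro: independent_sat_prefix\<close>)
  finally show ?thesis .
qed

text \<open>Follows from the case of disjunction by De Morgan, since negation turns a prefix into
  its dual.\<close>

lemma sat_prefix_conj:
  assumes "independent_of (snd ` set P) B" "independent_of (snd ` set Q) A"
    and "\<forall>x\<in>snd ` set (P @ Q). dom_set \<I> (snd x) \<noteq> {}"
  shows "sat_prefix \<I> (P @ Q) (\<lambda>\<beta>. A \<beta> \<and> B \<beta>) \<beta> \<longleftrightarrow> sat_prefix \<I> P A \<beta> \<and> sat_prefix \<I> Q B \<beta>"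
proof -
  have "\<not> sat_prefix \<I> (P @ Q) (\<lambda>\<beta>. A \<beta> \<and> B \<beta>) \<beta> \<longleftrightarrow>
      sat_prefix \<I> (map dual P @ map dual Q) (\<lambda>\<beta>. \<not> A \<beta> \<or> \<not> B \<beta>) \<beta>"
    using sat_prefix_dual[of \<I> "P @ Q" "\<lambda>\<beta>. A \<beta> \<and> B \<beta>" \<beta>] by simp
  also have "\<dots> \<longleftrightarrow> sat_prefix \<I> (map dual P) (\<lambda>\<beta>. \<not> A \<beta>) \<beta> \<or> sat_prefix \<I> (map dual Q) (\<lambda>\<beta>. \<not> B \<beta>) \<beta>"
  proof (rule sat_prefix_disj)
    show "independent_of (snd ` set (map dual P)) (\<lambda>\<beta>. \<not> B \<beta>)"
      "independent_of (snd ` set (map dual Q)) (\<lambda>\<beta>. \<not> A \<beta>)"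
      using assms(1,2) by (auto simp: independent_of_def image_image)
  qed (use assms(3) in \<open>auto simp: image_image image_Un\<close>)
  finally show ?thesis by (auto simp: sat_prefix_dual)
qed

text \<open>The value \<open>e\<close> does not depend on the variables bound by \<open>P\<close>,
  and \<open>P\<close> does not rebind \<open>y\<close>, so the update commutes with the
  quantifiers. This justifies replacing a universal variable by a term in the matrix while
  quantifiers still stand in front of it.\<close>

lemma sat_prefix_upd:
  assumes "independent_of (snd ` set P) e" "y \<notin> snd ` set P"
  shows "sat_prefix \<I> P (\<lambda>\<beta>. A (\<beta>(y := e \<beta>))) \<beta> \<longleftrightarrow> sat_prefix \<I> P A (\<beta>(y := e \<beta>))"
  using assms
proof (induction P arbitrary: \<beta>)
  case (Cons p P)
  obtain q x where p: "p = (q, x)" by fastforce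
  have "sat_prefix \<I> P (\<lambda>\<beta>. A (\<beta>(y := e \<beta>))) (\<beta>(x := a)) \<longleftrightarrow> sat_prefix \<I> P A (\<beta>(y := e \<beta>, x := a))" for a
  proof -
    have "x \<noteq> y" using Cons.prems(2) by (auto simp: p)
    have e: "e (\<beta>(x := a)) = e \<beta>"
      using Cons.prems(1) by (rule independent_upd) (simp add: p)
    have "sat_prefix \<I> P (\<lambda>\<beta>. A (\<beta>(y := e \<beta>))) (\<beta>(x := a)) \<longleftrightarrow>
        sat_prefix \<I> P A (\<beta>(x := a, y := e (\<beta>(x := a))))"
    proof (rule Cons.IH)
      show "independent_of (snd ` set P) e"
        using Cons.prems(1) by (rule independent_mono) auto
    qed (use Cons.prems(2) in auto)
    then show ?thesis unfolding e fun_upd_twist[OF \<open>x \<noteq> y\<close>] .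
  qed
  then show ?case by (cases q) (auto simp: p fun_upd_def)
qed simp

section \<open>Correctness of the prenex form\<close>

lemma bounds_append:
  fixes k k1 k2 :: nat
  assumes "k \<le> k1" "\<forall>x\<in>A. k \<le> f x \<and> f x < k1" "k1 \<le> k2" "\<forall>x\<in>B. k1 \<le> f x \<and> f x < k2"
  shows "k \<le> k2" "\<forall>x\<in>A \<union> B. k \<le> f x \<and> f x < k2" "A \<inter> B = {}"
  using assms by fastforce+

text \<open>Each subformula receives its own interval of indices, and neighbouring intervals are
  disjoint by \<open>bounds_append\<close>. Distinctness of the prefix and the absence of capture
  both rest on this bookkeeping.\<close>

lemma prenex_props:
  assumes "prenex k \<rho> \<phi> = (P, M, k')"
  shows "k \<le> k'" "\<And>x. x \<in> set (map snd P) \<Longrightarrow> k \<le> fst x \<and> fst x < k'" "distinct (map snd P)"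
    "quantifier_free M" "set (free_vars M) \<subseteq> \<rho> ` set (free_vars \<phi>) \<union> set (map snd P)"
proof -
  have "k \<le> k' \<and> (\<forall>x\<in>set (map snd P). k \<le> fst x \<and> fst x < k') \<and> distinct (map snd P) \<and>
      quantifier_free M \<and> set (free_vars M) \<subseteq> \<rho> ` set (free_vars \<phi>) \<union> set (map snd P)"
    using assms
  proof (induction k \<rho> \<phi> arbitrary: P M k' rule: prenex.induct)
    case (1 k \<rho> s t)
    then have [simp]: "P = []" "k' = k" "M = Eq (subst_tm (Var \<circ> \<rho>) s) (subst_tm (Var \<circ> \<rho>) t)"
      by simp_all
    show ?case by (auto simp: vars_subst)
  next
    case (2 k \<rho> \<phi>)
    obtain P1 M1 k1 where 1: "prenex k \<rho> \<phi> = (P1, M1, k1)" by (cases "prenex k \<rho> \<phi>") auto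
    have "P = map dual P1" "M = Neg M1" "k' = k1" using 2(2) 1 by simp_all
    then show ?case using 2(1)[OF 1] by (simp add: image_image)
  next
    case (3 k \<rho> \<phi> \<psi>)
    obtain P1 M1 k1 where 1: "prenex k \<rho> \<phi> = (P1, M1, k1)" by (cases "prenex k \<rho> \<phi>") auto
    obtain P2 M2 k2 where 2: "prenex k1 \<rho> \<psi> = (P2, M2, k2)" by (cases "prenex k1 \<rho> \<psi>") auto
    note I1 = 3(1)[OF 1] and I2 = 3(2)[OF 1[symmetric] refl refl 2]
    have eqs: "P = P1 @ P2" "M = Or M1 M2" "k' = k2" using 1 2 3(3) by simp_all
    have b: "k \<le> k2" "\<forall>x\<in>set (map snd P1) \<union> set (map snd P2). k \<le> fst x \<and> fst x < k2"
        "set (map snd P1) \<inter> set (map snd P2) = {}"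
      using bounds_append[of k k1 "set (map snd P1)" fst k2 "set (map snd P2)"] I1 I2
      by blast+
    have P: "set (map snd P) = set (map snd P1) \<union> set (map snd P2)"
      by (simp add: eqs image_image image_Un)
    have "distinct (map snd P)"
      using b(3) I1 I2 by (simp add: eqs)
    moreover have "set (free_vars M) \<subseteq> \<rho> ` set (free_vars (Or \<phi> \<psi>)) \<union> set (map snd P)"
      unfolding P eqs(2) free_vars.simps set_append image_Un using I1 I2 by blast
    moreover have "quantifier_free M" using I1 I2 by (simp add: eqs)
    ultimately show ?case using b(1,2) unfolding P eqs(3) by blast
  next
    case (4 k \<rho> \<phi> \<psi>)
    obtain P1 M1 k1 where 1: "prenex k \<rho> \<phi> = (P1, M1, k1)" by (cases "prenex k \<rho> \<phi>") auto
    obtain P2 M2 k2 where 2: "prenex k1 \<rho> \<psi> = (P2, M2, k2)" by (cases "prenex k1 \<rho> \<psi>") auto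
    note I1 = 4(1)[OF 1] and I2 = 4(2)[OF 1[symmetric] refl refl 2]
    have eqs: "P = P1 @ P2" "M = And M1 M2" "k' = k2" using 1 2 4(3) by simp_all
    have b: "k \<le> k2" "\<forall>x\<in>set (map snd P1) \<union> set (map snd P2). k \<le> fst x \<and> fst x < k2"
        "set (map snd P1) \<inter> set (map snd P2) = {}"
      using bounds_append[of k k1 "set (map snd P1)" fst k2 "set (map snd P2)"] I1 I2
      by blast+
    have P: "set (map snd P) = set (map snd P1) \<union> set (map snd P2)"
      by (simp add: eqs image_image image_Un)
    have "distinct (map snd P)"
      using b(3) I1 I2 by (simp add: eqs)
    moreover have "set (free_vars M) \<subseteq> \<rho> ` set (free_vars (And \<phi> \<psi>)) \<union> set (map snd P)"
      unfolding P eqs(2) free_vars.simps set_append image_Un using I1 I2 by blast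
    moreover have "quantifier_free M" using I1 I2 by (simp add: eqs)
    ultimately show ?case using b(1,2) unfolding P eqs(3) by blast
  next
    case (5 k \<rho> \<phi> \<psi>)
    obtain P1 M1 k1 where 1: "prenex k \<rho> \<phi> = (P1, M1, k1)" by (cases "prenex k \<rho> \<phi>") auto
    obtain P2 M2 k2 where 2: "prenex k1 \<rho> \<psi> = (P2, M2, k2)" by (cases "prenex k1 \<rho> \<psi>") auto
    note I1 = 5(1)[OF 1] and I2 = 5(2)[OF 1[symmetric] refl refl 2]
    have eqs: "P = map dual P1 @ P2" "M = Imp M1 M2" "k' = k2" using 1 2 5(3) by simp_all
    have b: "k \<le> k2" "\<forall>x\<in>set (map snd P1) \<union> set (map snd P2). k \<le> fst x \<and> fst x < k2"
        "set (map snd P1) \<inter> set (map snd P2) = {}"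
      using bounds_append[of k k1 "set (map snd P1)" fst k2 "set (map snd P2)"] I1 I2
      by blast+
    have P: "set (map snd P) = set (map snd P1) \<union> set (map snd P2)"
      by (simp add: eqs image_image image_Un)
    have "distinct (map snd P)"
      using b(3) I1 I2 by (simp add: eqs)
    moreover have "set (free_vars M) \<subseteq> \<rho> ` set (free_vars (Imp \<phi> \<psi>)) \<union> set (map snd P)"
      unfolding P eqs(2) free_vars.simps set_append image_Un using I1 I2 by blast
    moreover have "quantifier_free M" using I1 I2 by (simp add: eqs)
    ultimately show ?case using b(1,2) unfolding P eqs(3) by blast
  next
    case (6 k \<rho> x \<phi>)
    obtain P1 M1 k1 where 1: "prenex (Suc k) (\<rho>(x := (k, snd x))) \<phi> = (P1, M1, k1)"
      by (cases "prenex (Suc k) (\<rho>(x := (k, snd x))) \<phi>") auto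
    note I1 = 6(1)[OF refl 1]
    have "(k, snd x) \<notin> set (map snd P1)"
      using I1 by fastforce
    moreover have "set (free_vars M1) \<subseteq> \<rho> ` set (free_vars (Ex x \<phi>)) \<union> insert (k, snd x) (set (map snd P1))"
      using I1 by (auto split: if_splits)
    moreover have "\<forall>y\<in>set (map snd P1). k \<le> fst y \<and> fst y < k1"
      using I1 by fastforce
    moreover have "P = (Exq, k, snd x) # P1" "M = M1" "k' = k1" using 1 6(2) by simp_all
    ultimately show ?case using I1 by simp
  next
    case (7 k \<rho> x \<phi>)
    obtain P1 M1 k1 where 1: "prenex (Suc k) (\<rho>(x := (k, snd x))) \<phi> = (P1, M1, k1)"
      by (cases "prenex (Suc k) (\<rho>(x := (k, snd x))) \<phi>") auto
    note I1 = 7(1)[OF refl 1]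
    have "(k, snd x) \<notin> set (map snd P1)"
      using I1 by fastforce
    moreover have "set (free_vars M1) \<subseteq> \<rho> ` set (free_vars (All x \<phi>)) \<union> insert (k, snd x) (set (map snd P1))"
      using I1 by (auto split: if_splits)
    moreover have "\<forall>y\<in>set (map snd P1). k \<le> fst y \<and> fst y < k1"
      using I1 by fastforce
    moreover have "P = (Allq, k, snd x) # P1" "M = M1" "k' = k1" using 1 7(2) by simp_all
    ultimately show ?case using I1 by simp
  qed
  then show "k \<le> k'" "\<And>x. x \<in> set (map snd P) \<Longrightarrow> k \<le> fst x \<and> fst x < k'" "distinct (map snd P)"
    "quantifier_free M" "set (free_vars M) \<subseteq> \<rho> ` set (free_vars \<phi>) \<union> set (map snd P)"
    by blast+
qed

lemma prenex_is_formula: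
  assumes "prenex k \<rho> \<phi> = (P, M, k')" "is_formula \<Sigma> \<phi>" "\<And>x. snd (\<rho> x) = snd x"
  shows "is_formula \<Sigma> M" "\<And>x. x \<in> snd ` set P \<Longrightarrow> snd x \<in> sorts \<Sigma>"
proof -
  have "is_formula \<Sigma> M \<and> (\<forall>x\<in>snd ` set P. snd x \<in> sorts \<Sigma>)"
    using assms
  proof (induction k \<rho> \<phi> arbitrary: P M k' rule: prenex.induct)
    case (1 k \<rho> s t)
    then obtain a where "has_sort \<Sigma> s a" "has_sort \<Sigma> t a" by auto
    moreover have "has_sort \<Sigma> ((Var \<circ> \<rho>) x) (snd x)" if "snd x \<in> sorts \<Sigma>" for x
      using has_sort.intros(1)[of "\<rho> x" \<Sigma>] 1 that by simp
    ultimately have "has_sort \<Sigma> (subst_tm (Var \<circ> \<rho>) s) a" "has_sort \<Sigma> (subst_tm (Var \<circ> \<rho>) t) a"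
      by (blast intro: has_sort_subst)+
    with 1(1) show ?case by auto
  next
    case (2 k \<rho> \<phi>)
    obtain P1 M1 k1 where 1: "prenex k \<rho> \<phi> = (P1, M1, k1)" by (cases "prenex k \<rho> \<phi>") auto
    have "P = map dual P1" "M = Neg M1" using 2(2) 1 by simp_all
    then show ?case using 2(1)[OF 1] 2(3-) by (simp add: image_image)
  next
    case (3 k \<rho> \<phi> \<psi>)
    obtain P1 M1 k1 where 1: "prenex k \<rho> \<phi> = (P1, M1, k1)" by (cases "prenex k \<rho> \<phi>") auto
    obtain P2 M2 k2 where 2: "prenex k1 \<rho> \<psi> = (P2, M2, k2)" by (cases "prenex k1 \<rho> \<psi>") auto
    have "P = P1 @ P2" "M = Or M1 M2" using 1 2 3(3) by simp_all
    then show ?case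
      using 3(1)[OF 1 _ 3(5)] 3(2)[OF 1[symmetric] refl refl 2 _ 3(5)] 3(4)
      by (simp add: image_Un image_image ball_Un)
  next
    case (4 k \<rho> \<phi> \<psi>)
    obtain P1 M1 k1 where 1: "prenex k \<rho> \<phi> = (P1, M1, k1)" by (cases "prenex k \<rho> \<phi>") auto
    obtain P2 M2 k2 where 2: "prenex k1 \<rho> \<psi> = (P2, M2, k2)" by (cases "prenex k1 \<rho> \<psi>") auto
    have "P = P1 @ P2" "M = And M1 M2" using 1 2 4(3) by simp_all
    then show ?case
      using 4(1)[OF 1 _ 4(5)] 4(2)[OF 1[symmetric] refl refl 2 _ 4(5)] 4(4)
      by (simp add: image_Un image_image ball_Un)
  next
    case (5 k \<rho> \<phi> \<psi>)
    obtain P1 M1 k1 where 1: "prenex k \<rho> \<phi> = (P1, M1, k1)" by (cases "prenex k \<rho> \<phi>") auto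
    obtain P2 M2 k2 where 2: "prenex k1 \<rho> \<psi> = (P2, M2, k2)" by (cases "prenex k1 \<rho> \<psi>") auto
    have "P = map dual P1 @ P2" "M = Imp M1 M2" using 1 2 5(3) by simp_all
    then show ?case
      using 5(1)[OF 1 _ 5(5)] 5(2)[OF 1[symmetric] refl refl 2 _ 5(5)] 5(4)
      by (simp add: image_Un image_image ball_Un)
  next
    case (6 k \<rho> x \<phi>)
    obtain P1 M1 k1 where 1: "prenex (Suc k) (\<rho>(x := (k, snd x))) \<phi> = (P1, M1, k1)"
      by (cases "prenex (Suc k) (\<rho>(x := (k, snd x))) \<phi>") auto
    have "is_formula \<Sigma> M1 \<and> (\<forall>x\<in>snd ` set P1. snd x \<in> sorts \<Sigma>)"
      by (rule 6(1)[OF refl 1]) (use 6(3,4) in auto)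
    moreover have "P = (Exq, k, snd x) # P1" "M = M1" using 1 6(2) by simp_all
    ultimately show ?case using 6(3) by simp
  next
    case (7 k \<rho> x \<phi>)
    obtain P1 M1 k1 where 1: "prenex (Suc k) (\<rho>(x := (k, snd x))) \<phi> = (P1, M1, k1)"
      by (cases "prenex (Suc k) (\<rho>(x := (k, snd x))) \<phi>") auto
    have "is_formula \<Sigma> M1 \<and> (\<forall>x\<in>snd ` set P1. snd x \<in> sorts \<Sigma>)"
      by (rule 7(1)[OF refl 1]) (use 7(3,4) in auto)
    moreover have "P = (Allq, k, snd x) # P1" "M = M1" using 1 7(2) by simp_all
    ultimately show ?case using 7(3) by simp
  qed
  then show "is_formula \<Sigma> M" "\<And>x. x \<in> snd ` set P \<Longrightarrow> snd x \<in> sorts \<Sigma>" by blast+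
qed

text \<open>A free variable of \<open>M2\<close> is either the new name of a free variable, with
  index below \<open>k\<close>, or bound by \<open>P2\<close>, with index at least
  \<open>k1\<close>; the indices of \<open>P1\<close> lie between these. The argument for
  \<open>M1\<close> and \<open>P2\<close> is symmetric.\<close>

lemma prenex_independent:
  assumes 1: "prenex k \<rho> \<phi> = (P1, M1, k1)" and 2: "prenex k1 \<rho> \<psi> = (P2, M2, k2)"
    and \<rho>: "\<forall>x\<in>set (free_vars \<phi>) \<union> set (free_vars \<psi>). fst (\<rho> x) < k"
  shows "independent_of (snd ` set P1) (\<lambda>\<beta>. sat \<I> \<beta> M2)" "independent_of (snd ` set P2) (\<lambda>\<beta>. sat \<I> \<beta> M1)"
proof -
  note p1 = prenex_props[OF 1] and p2 = prenex_props[OF 2]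
  have low: "fst x < k" if "x \<in> \<rho> ` (set (free_vars \<phi>) \<union> set (free_vars \<psi>))" for x
    using that \<rho> by blast
  have P1: "k \<le> fst x \<and> fst x < k1" if "x \<in> snd ` set P1" for x
    using p1(2)[of x] that by simp
  have P2: "k1 \<le> fst x" if "x \<in> snd ` set P2" for x
    using p2(2)[of x] that by simp
  have "x \<notin> snd ` set P1" if "x \<in> set (free_vars M2)" for x
  proof -
    from that p2(5) have "x \<in> \<rho> ` (set (free_vars \<phi>) \<union> set (free_vars \<psi>)) \<or> x \<in> snd ` set P2"
      unfolding set_map by blast
    then show ?thesis using low P1 P2 by (metis leD)
  qed
  then show "independent_of (snd ` set P1) (\<lambda>\<beta>. sat \<I> \<beta> M2)"
    by (intro independent_sat) blast
  have "x \<notin> snd ` set P2" if "x \<in> set (free_vars M1)" for x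
  proof -
    from that p1(5) have "x \<in> \<rho> ` (set (free_vars \<phi>) \<union> set (free_vars \<psi>)) \<or> x \<in> snd ` set P1"
      unfolding set_map by blast
    then show ?thesis using low P1 P2 p1(1) by (metis leD order_less_le_trans)
  qed
  then show "independent_of (snd ` set P2) (\<lambda>\<beta>. sat \<I> \<beta> M1)"
    by (intro independent_sat) blast
qed

text \<open>The matrix is read under \<beta> and the original formula under \<beta> composed with
  \<rho>, because a variable has to look up the value of its current name. The bound by
  \<open>k\<close> keeps the names already in use away from those still to be allotted.\<close>

lemma sat_prefix_prenex:
  assumes "prenex k \<rho> \<phi> = (P, M, k')" "is_formula \<Sigma> \<phi>" "\<And>x. snd (\<rho> x) = snd x"
    "\<forall>x\<in>set (free_vars \<phi>). fst (\<rho> x) < k" "\<forall>s\<in>sorts \<Sigma>. dom_set \<I> s \<noteq> {}"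
  shows "sat_prefix \<I> P (\<lambda>\<beta>. sat \<I> \<beta> M) \<beta> \<longleftrightarrow> sat \<I> (\<beta> \<circ> \<rho>) \<phi>"
  using assms
proof (induction k \<rho> \<phi> arbitrary: P M k' \<beta> rule: prenex.induct)
  case (1 k \<rho> s t)
  then show ?case by (auto simp: eval_subst o_def)
next
  case (2 k \<rho> \<phi>)
  obtain P1 M1 k1 where 1: "prenex k \<rho> \<phi> = (P1, M1, k1)" by (cases "prenex k \<rho> \<phi>") auto
  show ?case using 2(1)[OF 1, of \<beta>] 2(2-) 1 by (auto simp: sat_prefix_dual)
next
  case (3 k \<rho> \<phi> \<psi>)
  obtain P1 M1 k1 where 1: "prenex k \<rho> \<phi> = (P1, M1, k1)" by (cases "prenex k \<rho> \<phi>") auto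
  obtain P2 M2 k2 where 2: "prenex k1 \<rho> \<psi> = (P2, M2, k2)" by (cases "prenex k1 \<rho> \<psi>") auto
  have "is_formula \<Sigma> \<phi>" "is_formula \<Sigma> \<psi>" using 3(4) by auto
  note ne' = prenex_is_formula(2)[OF 1 this(1) 3(5)] prenex_is_formula(2)[OF 2 this(2) 3(5)]
  have ne: "\<forall>x\<in>snd ` set (P1 @ P2). dom_set \<I> (snd x) \<noteq> {}"
    unfolding set_append image_Un set_map image_image snd_dual using ne' 3(7) by blast
  have "\<forall>x\<in>set (free_vars \<psi>). fst (\<rho> x) < k1"
    using 3(6) prenex_props(1)[OF 1] by (simp add: ball_Un) (meson order_less_le_trans)
  moreover have "sat_prefix \<I> (P1 @ P2) (\<lambda>\<beta>. sat \<I> \<beta> M1 \<or> sat \<I> \<beta> M2) \<beta> \<longleftrightarrow>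
      sat_prefix \<I> P1 (\<lambda>\<beta>. sat \<I> \<beta> M1) \<beta> \<or> sat_prefix \<I> P2 (\<lambda>\<beta>. sat \<I> \<beta> M2) \<beta>"
    by (rule sat_prefix_disj[OF prenex_independent[OF 1 2] ne]) (use 3(6) in auto)
  moreover have "sat_prefix \<I> P1 (\<lambda>\<beta>. sat \<I> \<beta> M1) \<beta> \<longleftrightarrow> sat \<I> (\<beta> \<circ> \<rho>) \<phi>"
    by (rule 3(1)[OF 1]) (use 3(4-) in auto)
  moreover have "sat_prefix \<I> P2 (\<lambda>\<beta>. sat \<I> \<beta> M2) \<beta> \<longleftrightarrow> sat \<I> (\<beta> \<circ> \<rho>) \<psi>"
    if "\<forall>x\<in>set (free_vars \<psi>). fst (\<rho> x) < k1"
    by (rule 3(2)[OF 1[symmetric] refl refl 2]) (use 3(4,5,7) that in auto)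
  moreover have "P = P1 @ P2" "M = Or M1 M2" using 1 2 3(3) by simp_all
  ultimately show ?case by (simp add: o_def)
next
  case (4 k \<rho> \<phi> \<psi>)
  obtain P1 M1 k1 where 1: "prenex k \<rho> \<phi> = (P1, M1, k1)" by (cases "prenex k \<rho> \<phi>") auto
  obtain P2 M2 k2 where 2: "prenex k1 \<rho> \<psi> = (P2, M2, k2)" by (cases "prenex k1 \<rho> \<psi>") auto
  have "is_formula \<Sigma> \<phi>" "is_formula \<Sigma> \<psi>" using 4(4) by auto
  note ne' = prenex_is_formula(2)[OF 1 this(1) 4(5)] prenex_is_formula(2)[OF 2 this(2) 4(5)]
  have ne: "\<forall>x\<in>snd ` set (P1 @ P2). dom_set \<I> (snd x) \<noteq> {}"
    unfolding set_append image_Un set_map image_image snd_dual using ne' 4(7) by blast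
  have "\<forall>x\<in>set (free_vars \<psi>). fst (\<rho> x) < k1"
    using 4(6) prenex_props(1)[OF 1] by (simp add: ball_Un) (meson order_less_le_trans)
  moreover have "sat_prefix \<I> (P1 @ P2) (\<lambda>\<beta>. sat \<I> \<beta> M1 \<and> sat \<I> \<beta> M2) \<beta> \<longleftrightarrow>
      sat_prefix \<I> P1 (\<lambda>\<beta>. sat \<I> \<beta> M1) \<beta> \<and> sat_prefix \<I> P2 (\<lambda>\<beta>. sat \<I> \<beta> M2) \<beta>"
    by (rule sat_prefix_conj[OF prenex_independent[OF 1 2] ne]) (use 4(6) in auto)
  moreover have "sat_prefix \<I> P1 (\<lambda>\<beta>. sat \<I> \<beta> M1) \<beta> \<longleftrightarrow> sat \<I> (\<beta> \<circ> \<rho>) \<phi>"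
    by (rule 4(1)[OF 1]) (use 4(4-) in auto)
  moreover have "sat_prefix \<I> P2 (\<lambda>\<beta>. sat \<I> \<beta> M2) \<beta> \<longleftrightarrow> sat \<I> (\<beta> \<circ> \<rho>) \<psi>"
    if "\<forall>x\<in>set (free_vars \<psi>). fst (\<rho> x) < k1"
    by (rule 4(2)[OF 1[symmetric] refl refl 2]) (use 4(4,5,7) that in auto)
  moreover have "P = P1 @ P2" "M = And M1 M2" using 1 2 4(3) by simp_all
  ultimately show ?case by (simp add: o_def)
next
  case (5 k \<rho> \<phi> \<psi>)
  obtain P1 M1 k1 where 1: "prenex k \<rho> \<phi> = (P1, M1, k1)" by (cases "prenex k \<rho> \<phi>") auto
  obtain P2 M2 k2 where 2: "prenex k1 \<rho> \<psi> = (P2, M2, k2)" by (cases "prenex k1 \<rho> \<psi>") auto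
  have "is_formula \<Sigma> \<phi>" "is_formula \<Sigma> \<psi>" using 5(4) by auto
  note ne' = prenex_is_formula(2)[OF 1 this(1) 5(5)] prenex_is_formula(2)[OF 2 this(2) 5(5)]
  have ne: "\<forall>x\<in>snd ` set (map dual P1 @ P2). dom_set \<I> (snd x) \<noteq> {}"
    unfolding set_append image_Un set_map image_image snd_dual using ne' 5(7) by blast
  have ind: "independent_of (snd ` set (map dual P1)) (\<lambda>\<beta>. sat \<I> \<beta> M2)"
    "independent_of (snd ` set P2) (\<lambda>\<beta>. \<not> sat \<I> \<beta> M1)"
    using prenex_independent[OF 1 2, of \<I>] 5(6) by (auto simp: independent_of_def image_image)
  have "\<forall>x\<in>set (free_vars \<psi>). fst (\<rho> x) < k1"
    using 5(6) prenex_props(1)[OF 1] by (simp add: ball_Un) (meson order_less_le_trans)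
  \<comment> \<open>The implication is treated as a disjunction with the negated premise, which
    explains the dual prefix.\<close>
  moreover have "sat_prefix \<I> (map dual P1 @ P2) (\<lambda>\<beta>. \<not> sat \<I> \<beta> M1 \<or> sat \<I> \<beta> M2) \<beta> \<longleftrightarrow>
      \<not> sat_prefix \<I> P1 (\<lambda>\<beta>. sat \<I> \<beta> M1) \<beta> \<or> sat_prefix \<I> P2 (\<lambda>\<beta>. sat \<I> \<beta> M2) \<beta>"
    unfolding sat_prefix_disj[OF ind ne] sat_prefix_dual ..
  moreover have "sat_prefix \<I> P1 (\<lambda>\<beta>. sat \<I> \<beta> M1) \<beta> \<longleftrightarrow> sat \<I> (\<beta> \<circ> \<rho>) \<phi>"
    by (rule 5(1)[OF 1]) (use 5(4-) in auto)
  moreover have "sat_prefix \<I> P2 (\<lambda>\<beta>. sat \<I> \<beta> M2) \<beta> \<longleftrightarrow> sat \<I> (\<beta> \<circ> \<rho>) \<psi>"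
    if "\<forall>x\<in>set (free_vars \<psi>). fst (\<rho> x) < k1"
    by (rule 5(2)[OF 1[symmetric] refl refl 2]) (use 5(4,5,7) that in auto)
  moreover have "P = map dual P1 @ P2" "M = Imp M1 M2" using 1 2 5(3) by simp_all
  ultimately show ?case by (simp add: o_def)
next
  case (6 k \<rho> x \<phi>)
  let ?\<rho> = "\<rho>(x := (k, snd x))"
  obtain P1 M1 k1 where 1: "prenex (Suc k) ?\<rho> \<phi> = (P1, M1, k1)"
    by (cases "prenex (Suc k) ?\<rho> \<phi>") auto
  have fr: "fst (\<rho> z) < k" if "z \<in> set (free_vars \<phi>)" "z \<noteq> x" for z
    using that 6(5) by auto
  have "sat_prefix \<I> P1 (\<lambda>\<beta>. sat \<I> \<beta> M1) (\<beta>((k, snd x) := a)) \<longleftrightarrow> sat \<I> (\<beta>((k, snd x) := a) \<circ> ?\<rho>) \<phi>" for a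
  proof (rule 6(1)[OF refl 1])
    show "snd (?\<rho> z) = snd z" for z using 6(4) by simp
    show "\<forall>z\<in>set (free_vars \<phi>). fst (?\<rho> z) < Suc k"
      using fr by (simp add: less_Suc_eq)
  qed (use 6(3,6) in simp_all)
  \<comment> \<open>The new name has index \<open>k\<close>, while all other free variables have
    names of smaller index; so updating the new name changes the value of \<open>x\<close>
    alone.\<close>
  moreover have "sat \<I> (\<beta>((k, snd x) := a) \<circ> ?\<rho>) \<phi> \<longleftrightarrow> sat \<I> ((\<beta> \<circ> \<rho>)(x := a)) \<phi>" for a
    by (rule sat_cong) (use fr in fastforce)
  moreover have "P = (Exq, k, snd x) # P1" "M = M1" using 1 6(2) by simp_all
  ultimately show ?case by (simp add: o_def)
next
  case (7 k \<rho> x \<phi>)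
  let ?\<rho> = "\<rho>(x := (k, snd x))"
  obtain P1 M1 k1 where 1: "prenex (Suc k) ?\<rho> \<phi> = (P1, M1, k1)"
    by (cases "prenex (Suc k) ?\<rho> \<phi>") auto
  have fr: "fst (\<rho> z) < k" if "z \<in> set (free_vars \<phi>)" "z \<noteq> x" for z
    using that 7(5) by auto
  have "sat_prefix \<I> P1 (\<lambda>\<beta>. sat \<I> \<beta> M1) (\<beta>((k, snd x) := a)) \<longleftrightarrow> sat \<I> (\<beta>((k, snd x) := a) \<circ> ?\<rho>) \<phi>" for a
  proof (rule 7(1)[OF refl 1])
    show "snd (?\<rho> z) = snd z" for z using 7(4) by simp
    show "\<forall>z\<in>set (free_vars \<phi>). fst (?\<rho> z) < Suc k"
      using fr by (simp add: less_Suc_eq)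
  qed (use 7(3,6) in simp_all)
  moreover have "sat \<I> (\<beta>((k, snd x) := a) \<circ> ?\<rho>) \<phi> \<longleftrightarrow> sat \<I> ((\<beta> \<circ> \<rho>)(x := a)) \<phi>" for a
    by (rule sat_cong) (use fr in fastforce)
  moreover have "P = (Allq, k, snd x) # P1" "M = M1" using 1 7(2) by simp_all
  ultimately show ?case by (simp add: o_def)
qed

section \<open>Universal closure\<close>

lemma free_vars_sorts: "is_formula \<Sigma> \<phi> \<Longrightarrow> x \<in> set (free_vars \<phi>) \<Longrightarrow> snd x \<in> sorts \<Sigma>"
  by (induction \<phi>) (auto dest: has_sort_vars)

text \<open>From left to right, \<open>x\<close> is given the value it already has under \<beta>,
  which is in the domain because the sort of \<open>x\<close> belongs to the signature. From right
  to left, the updated assignment is again well-sorted.\<close>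

lemma sat_All_well_assigned:
  assumes "snd x \<in> sorts \<Sigma>"
  shows "(\<forall>\<beta>. well_assigned \<Sigma> \<I> \<beta> \<longrightarrow> sat \<I> \<beta> (All x \<phi>)) \<longleftrightarrow>
    (\<forall>\<beta>. well_assigned \<Sigma> \<I> \<beta> \<longrightarrow> sat \<I> \<beta> \<phi>)" (is "?L \<longleftrightarrow> ?R")
proof
  assume ?L
  show ?R
  proof (intro allI impI)
    fix \<beta> assume \<beta>: "well_assigned \<Sigma> \<I> \<beta>"
    then have "\<beta> x \<in> dom_set \<I> (snd x)" using assms by (simp add: well_assigned_def)
    with \<open>?L\<close> \<beta> show "sat \<I> \<beta> \<phi>" by fastforce
  qed
next
  assume ?R
  then show ?L by (auto intro: well_assigned_upd)
qed

lemma sat_foldr_All_well_assigned: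
  "snd ` set xs \<subseteq> sorts \<Sigma> \<Longrightarrow>
   (\<forall>\<beta>. well_assigned \<Sigma> \<I> \<beta> \<longrightarrow> sat \<I> \<beta> (foldr All xs \<phi>)) \<longleftrightarrow>
   (\<forall>\<beta>. well_assigned \<Sigma> \<I> \<beta> \<longrightarrow> sat \<I> \<beta> \<phi>)"
  by (induction xs) (simp_all add: sat_All_well_assigned del: sat.simps)

lemma free_vars_universal_closure [simp]: "free_vars (universal_closure \<phi>) = []"
proof -
  have "set (free_vars (foldr All xs \<phi>)) = set (free_vars \<phi>) - set xs" for xs
    by (induction xs) auto
  then have "set (free_vars (universal_closure \<phi>)) = {}"
    by (simp add: universal_closure_def)
  then show ?thesis by simp
qed

lemma is_formula_universal_closure:
  assumes "is_formula \<Sigma> \<phi>"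
  shows "is_formula \<Sigma> (universal_closure \<phi>)"
proof -
  have "snd ` set xs \<subseteq> sorts \<Sigma> \<Longrightarrow> is_formula \<Sigma> (foldr All xs \<phi>)" for xs
    using assms by (induction xs) auto
  moreover have "snd ` set (remdups (free_vars \<phi>)) \<subseteq> sorts \<Sigma>"
    using free_vars_sorts[OF assms] by auto
  ultimately show ?thesis by (simp add: universal_closure_def)
qed

section \<open>Herbrandisation\<close>

lemma free_vars_subst:
  "quantifier_free \<phi> \<Longrightarrow>
   set (free_vars (map_terms (subst_tm \<tau>) \<phi>)) = (\<Union>z\<in>set (free_vars \<phi>). set (vars_tm (\<tau> z)))"
  by (simp add: free_vars_quantifier_free vars_subst)

text \<open>The fresh term contains only variables from \<open>xs\<close>, so each universal step
  trades the free variable \<open>y\<close> for variables that are already accounted for. The set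
  \<open>S\<close> is left open so that it can later be the set of sorts.\<close>

lemma herbrandise_props:
  fixes M :: "('o, 'c, 'f) hfm"
  assumes "herbrandise i xs P M = (zs, N, ss)"
  shows "quantifier_free N \<longleftrightarrow> quantifier_free M"
    "set zs = set xs \<union> {x. (Exq, x) \<in> set P}"
    "set (free_vars M) \<subseteq> set xs \<union> snd ` set P \<Longrightarrow> quantifier_free M \<Longrightarrow> set (free_vars N) \<subseteq> set zs"
    "snd ` set P \<union> set xs \<subseteq> {x. snd x \<in> S} \<Longrightarrow> r \<in> set ss \<Longrightarrow> set (fst r) \<subseteq> S \<and> snd r \<in> S"
proof -
  have "(quantifier_free N \<longleftrightarrow> quantifier_free M) \<and> set zs = set xs \<union> {x. (Exq, x) \<in> set P} \<and>
    (set (free_vars M) \<subseteq> set xs \<union> snd ` set P \<longrightarrow> quantifier_free M \<longrightarrow> set (free_vars N) \<subseteq> set zs) \<and>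
    (snd ` set P \<union> set xs \<subseteq> {x. snd x \<in> S} \<longrightarrow> (\<forall>r\<in>set ss. set (fst r) \<subseteq> S \<and> snd r \<in> S))"
    using assms
  proof (induction i xs P M arbitrary: zs N ss rule: herbrandise.induct)
    case (2 i xs x P M)
    then have "herbrandise i (xs @ [x]) P M = (zs, N, ss)" by simp
    from 2(1)[OF this] show ?case by auto
  next
    case (3 i xs y P M)
    let ?t = "(if xs = [] then Const (Con (New i)) else App (Fun (New i)) (map Var xs)) :: ('o, 'c ext, 'f ext) tm"
    let ?M = "map_terms (subst_tm (Var(y := ?t))) M"
    obtain ss' where ss': "herbrandise (Suc i) xs P ?M = (zs, N, ss')" "ss = (map snd xs, snd y) # ss'"
      using 3(2) by (auto split: prod.splits)
    note IH = 3(1)[OF refl ss'(1)]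
    have "set (free_vars ?M) \<subseteq> set xs \<union> snd ` set P"
      if M: "set (free_vars M) \<subseteq> set xs \<union> snd ` set ((Allq, y) # P)" "quantifier_free M"
    proof
      fix x assume "x \<in> set (free_vars ?M)"
      then obtain z where z: "z \<in> set (free_vars M)" "x \<in> set (vars_tm ((Var(y := ?t)) z))"
        unfolding free_vars_subst[OF M(2)] by (rule UN_E)
      have t: "set (vars_tm ?t) \<subseteq> set xs" by auto
      show "x \<in> set xs \<union> snd ` set P"
      proof (cases "z = y")
        case True
        have "x \<in> set (vars_tm ?t)" using z(2) unfolding True fun_upd_same .
        with t show ?thesis by blast
      next
        case False
        then have "x = z" using z(2) by simp
        then show ?thesis using False z(1) M(1) by auto
      qed
    qed
    then show ?case using IH by (auto simp: ss'(2) simp del: fun_upd_apply)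
  qed simp
  then show "quantifier_free N \<longleftrightarrow> quantifier_free M"
    "set zs = set xs \<union> {x. (Exq, x) \<in> set P}"
    "set (free_vars M) \<subseteq> set xs \<union> snd ` set P \<Longrightarrow> quantifier_free M \<Longrightarrow> set (free_vars N) \<subseteq> set zs"
    "snd ` set P \<union> set xs \<subseteq> {x. snd x \<in> S} \<Longrightarrow> r \<in> set ss \<Longrightarrow> set (fst r) \<subseteq> S \<and> snd r \<in> S"
    by blast+
qed

text \<open>The offset \<open>i\<close> follows the counter of \<open>herbrandise\<close>: an
  induction on the prefix can drop the head of \<open>ss\<close> and raise \<open>i\<close> while
  the signature stays the same.\<close>

definition has_fresh ::
  "('o, 'c ext, 'f ext) signature \<Rightarrow> nat \<Rightarrow> ('o sort list \<times> 'o sort) list \<Rightarrow> bool" where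
  "has_fresh \<Sigma> i ss \<longleftrightarrow> (\<forall>j<length ss.
     if fst (ss ! j) = [] then New (i + j) \<in> con_syms \<Sigma> \<and> con_sort \<Sigma> (New (i + j)) = snd (ss ! j)
     else New (i + j) \<in> fun_syms \<Sigma> \<and> fun_sort \<Sigma> (New (i + j)) = ss ! j)"

lemma has_fresh_Cons:
  "has_fresh \<Sigma> i (s # ss) \<longleftrightarrow>
     (if fst s = [] then New i \<in> con_syms \<Sigma> \<and> con_sort \<Sigma> (New i) = snd s
      else New i \<in> fun_syms \<Sigma> \<and> fun_sort \<Sigma> (New i) = s) \<and> has_fresh \<Sigma> (Suc i) ss"
  by (simp add: has_fresh_def All_less_Suc2)

lemma has_sort_fresh_term:
  assumes "has_fresh \<Sigma> i ((map snd xs, a) # ss)" "snd ` set xs \<subseteq> sorts \<Sigma>"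
  shows "has_sort \<Sigma> (if xs = [] then Const (Con (New i)) else App (Fun (New i)) (map Var xs)) a"
proof (cases "xs = []")
  case True
  then have "Con (New i) \<in> all_consts \<Sigma>" "const_sort \<Sigma> (Con (New i)) = a"
    using assms(1) by (auto simp: has_fresh_Cons all_consts_def)
  then show ?thesis using has_sort.intros(2)[of "Con (New i)" \<Sigma>] True by simp
next
  case False
  then have f: "Fun (New i) \<in> all_funs \<Sigma>" "func_sort \<Sigma> (Fun (New i)) = (map snd xs, a)"
    using assms(1) by (auto simp: has_fresh_Cons all_funs_def)
  have "list_all2 (has_sort \<Sigma>) (map Var xs) (map snd xs)"
    using assms(2) by (auto simp: list_all2_conv_all_nth intro!: has_sort.intros(1))
  then show ?thesis using has_sort.intros(3)[OF f(1), of "map Var xs"] f(2) False by simp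
qed

lemma is_formula_herbrandise:
  fixes M :: "('o, 'c, 'f) hfm"
  assumes "herbrandise i xs P M = (zs, N, ss)" "has_fresh \<Sigma> i ss" "is_formula \<Sigma> M" "quantifier_free M"
    "snd ` (snd ` set P \<union> set xs) \<subseteq> sorts \<Sigma>"
  shows "is_formula \<Sigma> N"
  using assms
proof (induction i xs P M arbitrary: zs N ss rule: herbrandise.induct)
  case (2 i xs x P M)
  then have "herbrandise i (xs @ [x]) P M = (zs, N, ss)" by simp
  from 2(1)[OF this] 2(3-) show ?case by simp
next
  case (3 i xs y P M)
  let ?t = "(if xs = [] then Const (Con (New i)) else App (Fun (New i)) (map Var xs)) :: ('o, 'c ext, 'f ext) tm"
  let ?M = "map_terms (subst_tm (Var(y := ?t))) M"
  obtain ss' where ss': "herbrandise (Suc i) xs P ?M = (zs, N, ss')" "ss = (map snd xs, snd y) # ss'"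
    using 3(2) by (auto split: prod.splits)
  have t: "has_sort \<Sigma> ?t (snd y)"
    by (rule has_sort_fresh_term) (use 3(3,6) ss'(2) in auto)
  have "is_formula \<Sigma> ?M"
  proof (rule is_formula_map_terms[OF 3(5,4)])
    fix s a assume "has_sort \<Sigma> s a"
    then show "has_sort \<Sigma> (subst_tm (Var(y := ?t)) s) a"
      by (rule has_sort_subst) (use t has_sort.intros(1) in \<open>auto simp del: split_paired_All\<close>)
  qed
  moreover have "has_fresh \<Sigma> (Suc i) ss'" using 3(3) ss'(2) by (simp add: has_fresh_Cons)
  ultimately show ?case using 3(1)[OF refl ss'(1)] 3(5,6) by simp
qed simp

text \<open>A universally quantified variable may in particular take the value of the term that
  replaces it, whatever the fresh symbols mean. So a true prenex sentence makes its Herbrand matrix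
  satisfiable in every expansion.\<close>

lemma herbrandise_sat:
  fixes M :: "('o, 'c, 'f) hfm"
  assumes "herbrandise i xs P M = (zs, N, ss)" "has_fresh \<Sigma> i ss" "quantifier_free M"
    "snd ` (snd ` set P \<union> set xs) \<subseteq> sorts \<Sigma>" "distinct (map snd P)" "set xs \<inter> snd ` set P = {}"
    "is_interp \<Sigma> \<J>" "well_assigned \<Sigma> \<J> \<beta>" "sat_prefix \<J> P (\<lambda>\<beta>. sat \<J> \<beta> M) \<beta>"
  shows "\<exists>\<beta>. well_assigned \<Sigma> \<J> \<beta> \<and> sat \<J> \<beta> N"
  using assms
proof (induction i xs P M arbitrary: zs N ss \<beta> rule: herbrandise.induct)
  case (1 i xs M)
  then show ?case by auto
next
  case (2 i xs x P M)
  then have *: "herbrandise i (xs @ [x]) P M = (zs, N, ss)" by simp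
  obtain a where a: "a \<in> dom_set \<J> (snd x)" "sat_prefix \<J> P (\<lambda>\<beta>. sat \<J> \<beta> M) (\<beta>(x := a))"
    using 2(10) by auto
  show ?case
  proof (rule 2(1)[OF *])
    show "well_assigned \<Sigma> \<J> (\<beta>(x := a))" by (rule well_assigned_upd) (use 2(9) a in auto)
    show "sat_prefix \<J> P (\<lambda>\<beta>. sat \<J> \<beta> M) (\<beta>(x := a))" by (rule a(2))
  qed (use 2(3-8) in auto)
next
  case (3 i xs y P M)
  let ?t = "(if xs = [] then Const (Con (New i)) else App (Fun (New i)) (map Var xs)) :: ('o, 'c ext, 'f ext) tm"
  let ?M = "map_terms (subst_tm (Var(y := ?t))) M"
  obtain ss' where ss': "herbrandise (Suc i) xs P ?M = (zs, N, ss')" "ss = (map snd xs, snd y) # ss'"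
    using 3(2) by (auto split: prod.splits)
  have t: "has_sort \<Sigma> ?t (snd y)"
    by (rule has_sort_fresh_term) (use 3(3,5) ss'(2) in auto)
  have "set (vars_tm ?t) \<subseteq> set xs" by auto
  \<comment> \<open>The arguments of the fresh symbol are existential variables met earlier, so the
    quantifiers that remain cannot change its value.\<close>
  then have ind: "independent_of (snd ` set P) (\<lambda>\<beta>. eval \<J> \<beta> ?t)"
    by (intro independent_eval) (use 3(7) in auto)
  have "eval \<J> \<beta> ?t \<in> dom_set \<J> (snd y)"
    by (rule eval_in_dom[OF t 3(8,9)])
  then have "sat_prefix \<J> P (\<lambda>\<beta>. sat \<J> \<beta> M) (\<beta>(y := eval \<J> \<beta> ?t))"
    using 3(10) unfolding sat_prefix.simps by blast
  then have "sat_prefix \<J> P (\<lambda>\<beta>. sat \<J> (\<beta>(y := eval \<J> \<beta> ?t)) M) \<beta>"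
    using sat_prefix_upd[OF ind, of y \<J> "\<lambda>\<beta>. sat \<J> \<beta> M" \<beta>] 3(6) by simp
  moreover have "sat \<J> (\<beta>(y := eval \<J> \<beta> ?t)) M \<longleftrightarrow> sat \<J> \<beta> ?M" for \<beta>
  proof -
    have "(\<lambda>x. eval \<J> \<beta> ((Var(y := ?t)) x)) = \<beta>(y := eval \<J> \<beta> ?t)"
    proof
      show "eval \<J> \<beta> ((Var(y := ?t)) x) = (\<beta>(y := eval \<J> \<beta> ?t)) x" for x
        by (cases "x = y") simp_all
    qed
    then show ?thesis using sat_subst[OF 3(4), of \<J> \<beta> "Var(y := ?t)"] by metis
  qed
  ultimately have sat: "sat_prefix \<J> P (\<lambda>\<beta>. sat \<J> \<beta> ?M) \<beta>" by simp
  have "has_fresh \<Sigma> (Suc i) ss'" using 3(3) ss'(2) by (simp add: has_fresh_Cons)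
  then show ?case
    by (rule 3(1)[OF refl ss'(1) _ _ _ _ _ 3(8,9) sat]) (use 3(4-7) in auto)
qed

text \<open>Going from \<open>\<I>\<close> to \<open>\<J>\<close> reinterprets at most the fresh
  symbols that have not been introduced before stage \<open>i\<close>.\<close>

definition agree_below ::
  "nat \<Rightarrow> ('o, 'c ext, 'f ext, 'm) interp \<Rightarrow> ('o, 'c ext, 'f ext, 'm) interp \<Rightarrow> bool" where
  "agree_below i \<I> \<J> \<longleftrightarrow> dom_set \<I> = dom_set \<J> \<and>
     (\<forall>c. (\<forall>j\<ge>i. c \<noteq> Con (New j)) \<longrightarrow> con \<I> c = con \<J> c) \<and>
     (\<forall>f. (\<forall>j\<ge>i. f \<noteq> Fun (New j)) \<longrightarrow> fn \<I> f = fn \<J> f)"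

lemma agree_below_refl: "agree_below i \<I> \<I>"
  by (simp add: agree_below_def)

lemma agree_below_Suc_trans:
  "agree_below i \<I> \<J> \<Longrightarrow> agree_below (Suc i) \<J> \<K> \<Longrightarrow> agree_below i \<I> \<K>"
  unfolding agree_below_def using Suc_leD by metis

lemma agree_below_mono: "agree_below i \<I> \<J> \<Longrightarrow> j \<le> i \<Longrightarrow> agree_below j \<I> \<J>"
  unfolding agree_below_def by (meson le_trans)

lemma eval_below:
  assumes "agree_below i \<I> \<J>" "j < i"
  shows "eval \<I> \<beta> (if xs = [] then Const (Con (New j)) else App (Fun (New j)) (map Var xs)) =
    eval \<J> \<beta> (if xs = [] then Const (Con (New j)) else App (Fun (New j)) (map Var xs))"
  using assms by (auto simp: agree_below_def o_def)

text \<open>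
  That \<open>M\<close> contains no symbol \<open>New j\<close> with \<open>j \<ge> i\<close> is expressed through the interpretations.
\<close>

lemma herbrandise_unsat:
  fixes \<I> :: "('o, 'c ext, 'f ext, 'm) interp"
  assumes "herbrandise i xs P M = (zs, N, ss)" "has_fresh \<Sigma> i ss" "quantifier_free M"
    "set (free_vars M) \<subseteq> set xs \<union> snd ` set P"
    "snd ` (snd ` set P \<union> set xs) \<subseteq> sorts \<Sigma>" "distinct (map snd P)" "set xs \<inter> snd ` set P = {}"
    "\<And>(\<I> :: ('o, 'c ext, 'f ext, 'm) interp) \<J> \<beta>. agree_below i \<I> \<J> \<Longrightarrow> sat \<I> \<beta> M \<longleftrightarrow> sat \<J> \<beta> M"
    "is_interp \<Sigma> \<I>" "\<And>\<beta>. well_assigned \<Sigma> \<I> \<beta> \<Longrightarrow> \<not> sat_prefix \<I> P (\<lambda>\<beta>. sat \<I> \<beta> M) \<beta>"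
  shows "\<exists>\<J>. is_interp \<Sigma> \<J> \<and> agree_below i \<I> \<J> \<and> (\<forall>\<beta>. well_assigned \<Sigma> \<J> \<beta> \<longrightarrow> \<not> sat \<J> \<beta> N)"
  using assms
proof (induction i xs P M arbitrary: zs N ss \<I> rule: herbrandise.induct)
  case (1 i xs M)
  then show ?case by (auto intro!: exI[of _ \<I>] simp: agree_below_refl)
next
  case (2 i xs x P M)
  then have *: "herbrandise i (xs @ [x]) P M = (zs, N, ss)" by simp
  have "\<not> sat_prefix \<I> P (\<lambda>\<beta>. sat \<I> \<beta> M) \<beta>" if \<beta>: "well_assigned \<Sigma> \<I> \<beta>" for \<beta>
  proof -
    have "\<beta> x \<in> dom_set \<I> (snd x)" using \<beta> 2(6) by (simp add: well_assigned_def del: split_paired_All)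
    then show ?thesis using 2(11)[OF \<beta>] by fastforce
  qed
  then show ?case
    by (intro 2(1)[OF *] 2(3,4,9,10)) (use 2(5-8) in auto)
next
  case (3 i xs y P M)
  let ?t = "(if xs = [] then Const (Con (New i)) else App (Fun (New i)) (map Var xs)) :: ('o, 'c ext, 'f ext) tm"
  let ?M = "map_terms (subst_tm (Var(y := ?t))) M"
  obtain ss' where ss': "herbrandise (Suc i) xs P ?M = (zs, N, ss')" "ss = (map snd xs, snd y) # ss'"
    using 3(2) by (auto split: prod.splits)
  have fresh: "if xs = [] then New i \<in> con_syms \<Sigma> \<and> con_sort \<Sigma> (New i) = snd y
      else New i \<in> fun_syms \<Sigma> \<and> fun_sort \<Sigma> (New i) = (map snd xs, snd y)"
    "has_fresh \<Sigma> (Suc i) ss'"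
    using 3(3) unfolding ss'(2) has_fresh_Cons by auto
  have sat_M: "sat \<J> \<beta> ?M \<longleftrightarrow> sat \<J> (\<beta>(y := eval \<J> \<beta> ?t)) M" for \<J> :: "('o, 'c ext, 'f ext, 'm) interp" and \<beta>
  proof -
    have "(\<lambda>x. eval \<J> \<beta> ((Var(y := ?t)) x)) = \<beta>(y := eval \<J> \<beta> ?t)"
    proof
      show "eval \<J> \<beta> ((Var(y := ?t)) x) = (\<beta>(y := eval \<J> \<beta> ?t)) x" for x
        by (cases "x = y") simp_all
    qed
    then show ?thesis using sat_subst[OF 3(4), of \<J> \<beta> "Var(y := ?t)"] by metis
  qed
  obtain \<beta>0 where \<beta>0: "well_assigned \<Sigma> \<I> \<beta>0" using ex_well_assigned[OF 3(10)] by blast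
  \<comment> \<open>\<open>\<beta>s as\<close> gives the variables \<open>xs\<close> the values
    \<open>as\<close> and falls back on a fixed well-sorted assignment elsewhere. For such a tuple,
    \<open>g\<close> chooses a value of \<open>y\<close> at which the rest of the sentence fails: a
    Skolem function for the negated sentence.\<close>
  define \<beta>s where "\<beta>s = (\<lambda>as x. case map_of (zip xs as) x of None \<Rightarrow> \<beta>0 x | Some a \<Rightarrow> a)"
  define A where "A = sat_prefix \<I> P (\<lambda>\<beta>. sat \<I> \<beta> M)"
  define g where "g = (\<lambda>as. SOME a. a \<in> dom_set \<I> (snd y) \<and> \<not> A ((\<beta>s as)(y := a)))"
  have \<beta>s: "well_assigned \<Sigma> \<I> (\<beta>s as)"
    if "list_all2 (\<lambda>a s. a \<in> dom_set \<I> s) as (map snd xs)" for as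
  proof -
    have "\<beta>s as x \<in> dom_set \<I> (snd x)" if "snd x \<in> sorts \<Sigma>" for x
    proof (cases "map_of (zip xs as) x")
      case None
      then show ?thesis using \<beta>0 that by (simp add: \<beta>s_def well_assigned_def del: split_paired_All)
    next
      case (Some a)
      then have "(x, a) \<in> set (zip xs as)" by (rule map_of_SomeD)
      then obtain j where "j < length xs" "j < length as" "x = xs ! j" "a = as ! j"
        by (auto simp: in_set_zip)
      then show ?thesis using Some \<open>list_all2 _ _ _\<close>
        by (auto simp: \<beta>s_def list_all2_conv_all_nth)
    qed
    then show ?thesis by (simp add: well_assigned_def del: split_paired_All)
  qed
  have g: "g as \<in> dom_set \<I> (snd y) \<and> \<not> A ((\<beta>s as)(y := g as))"
    if "list_all2 (\<lambda>a s. a \<in> dom_set \<I> s) as (map snd xs)" for as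
  proof -
    have "\<exists>a. a \<in> dom_set \<I> (snd y) \<and> \<not> A ((\<beta>s as)(y := a))"
      using 3(11)[OF \<beta>s[OF that]] unfolding A_def by auto
    then show ?thesis unfolding g_def by (rule someI_ex)
  qed
  \<comment> \<open>A fresh constant is the Skolem function of no arguments, evaluated at the empty
    tuple.\<close>
  define \<J> where "\<J> = (if xs = [] then \<I>\<lparr>con := (con \<I>)(Con (New i) := g [])\<rparr>
    else \<I>\<lparr>fn := (fn \<I>)(Fun (New i) := g)\<rparr>)"
  have dom: "dom_set \<J> = dom_set \<I>" by (simp add: \<J>_def)
  have agree: "agree_below i \<I> \<J>" by (simp add: \<J>_def agree_below_def)
  have t: "eval \<J> \<beta> ?t = g (map \<beta> xs)" for \<beta> by (simp add: \<J>_def o_def)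
  have J: "is_interp \<Sigma> \<J>"
  proof (cases "xs = []")
    case True
    then show ?thesis using 3(10) fresh(1) g[of "[]"] by (auto simp: is_interp_def \<J>_def)
  next
    case False
    then show ?thesis using 3(10) fresh(1) g by (auto simp: is_interp_def \<J>_def)
  qed
  have wa: "well_assigned \<Sigma> \<J> = well_assigned \<Sigma> \<I>" by (intro ext) (simp add: well_assigned_def dom)
  have not_sat: "\<not> sat_prefix \<J> P (\<lambda>\<beta>. sat \<J> \<beta> ?M) \<beta>" if \<beta>: "well_assigned \<Sigma> \<J> \<beta>" for \<beta>
  proof -
    let ?as = "map \<beta> xs"
    have "\<beta> x \<in> dom_set \<I> (snd x)" if "x \<in> set xs" for x
      using \<beta> 3(6) that unfolding wa well_assigned_def by blast
    then have "list_all2 (\<lambda>a s. a \<in> dom_set \<I> s) ?as (map snd xs)"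
      by (simp add: list_all2_conv_all_nth)
    note g_as = g[OF this]
    have \<beta>s_as: "\<beta>s ?as x = \<beta> x" if "x \<in> set xs" for x
    proof -
      have "map_of (zip xs (map \<beta> xs)) x = Some (\<beta> x)"
        using that by (simp add: map_of_zip_map)
      then show ?thesis by (simp add: \<beta>s_def)
    qed
    \<comment> \<open>All other free variables of \<open>M\<close> are bound by \<open>P\<close>, so
      \<open>A\<close> depends on \<open>xs\<close> and \<open>y\<close> only. Hence the witness
      chosen for the tuple of values of \<open>xs\<close> works for every assignment with these
      values.\<close>
    have "independent_of (- (set xs \<union> {y})) A"
    proof -
      have "independent_of (- (set xs \<union> {y} \<union> snd ` set P)) (\<lambda>\<beta>. sat \<I> \<beta> M)"
        by (rule independent_sat) (use 3(5) in auto)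
      from independent_sat_prefix_bound[OF this, where P = P and \<I> = \<I>] show ?thesis
        unfolding A_def by (rule independent_mono) auto
    qed
    moreover have "(\<beta>(y := g ?as)) x = ((\<beta>s ?as)(y := g ?as)) x" if "x \<notin> - (set xs \<union> {y})" for x
      using that by (cases "x = y") (simp_all add: \<beta>s_as)
    ultimately have "A (\<beta>(y := g ?as)) \<longleftrightarrow> A ((\<beta>s ?as)(y := g ?as))"
      unfolding independent_of_def by blast
    with g_as have "\<not> A (\<beta>(y := g ?as))" by simp
    moreover have "set (vars_tm ?t) \<subseteq> set xs" by auto
    then have "independent_of (snd ` set P) (\<lambda>\<beta>. eval \<J> \<beta> ?t)"
      by (intro independent_eval) (use 3(8) in auto)
    from sat_prefix_upd[OF this, of y \<I> "\<lambda>\<beta>. sat \<I> \<beta> M" \<beta>]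
    have "sat_prefix \<I> P (\<lambda>\<beta>. sat \<I> (\<beta>(y := eval \<J> \<beta> ?t)) M) \<beta> \<longleftrightarrow> A (\<beta>(y := g ?as))"
      using 3(7) unfolding A_def t by simp
    ultimately have "\<not> sat_prefix \<I> P (\<lambda>\<beta>. sat \<I> (\<beta>(y := eval \<J> \<beta> ?t)) M) \<beta>" by simp
    then show ?thesis
      unfolding sat_prefix_dom[OF dom] sat_M 3(9)[OF agree, symmetric] .
  qed
  \<comment> \<open>Substitution adds just the symbol \<open>New i\<close> to the matrix, which is
    why the invariance holds from \<open>Suc i\<close> on.\<close>
  have M': "sat \<J>1 \<beta> ?M \<longleftrightarrow> sat \<J>2 \<beta> ?M" if "agree_below (Suc i) \<J>1 \<J>2"
    for \<J>1 \<J>2 :: "('o, 'c ext, 'f ext, 'm) interp" and \<beta>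
    unfolding sat_M eval_below[OF that lessI]
    by (rule 3(9)[OF agree_below_mono[OF that le_SucI[OF le_refl]]])
  have fv: "set (free_vars ?M) \<subseteq> set xs \<union> snd ` set P"
  proof
    fix x assume "x \<in> set (free_vars ?M)"
    then obtain z where z: "z \<in> set (free_vars M)" "x \<in> set (vars_tm ((Var(y := ?t)) z))"
      unfolding free_vars_subst[OF 3(4)] by (rule UN_E)
    have t: "set (vars_tm ?t) \<subseteq> set xs" by auto
    show "x \<in> set xs \<union> snd ` set P"
    proof (cases "z = y")
      case True
      have "x \<in> set (vars_tm ?t)" using z(2) unfolding True fun_upd_same .
      with t show ?thesis by blast
    next
      case False
      then have "x = z" using z(2) by simp
      then show ?thesis using False z(1) 3(5) by auto
    qed
  qed
  have "\<exists>\<K>. is_interp \<Sigma> \<K> \<and> agree_below (Suc i) \<J> \<K> \<and> (\<forall>\<beta>. well_assigned \<Sigma> \<K> \<beta> \<longrightarrow> \<not> sat \<K> \<beta> N)"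
    by (rule 3(1)[OF refl ss'(1) fresh(2) _ fv _ _ _ M' J not_sat]) (use 3(4,6,7,8) in auto)
  then show ?case using agree_below_Suc_trans[OF agree] by blast
qed

section \<open>The Herbrand normal form of a formula and its signature\<close>

lemma herbrand_data_cases:
  obtains P M k where "prenex 0 id (universal_closure \<phi>) = (P, M, k)"
    "herbrandise 0 [] P (map_fm id Old Old M) =
       (herbrand_vars \<phi>, herbrand_matrix \<phi>, snd (snd (herbrand_data \<phi>)))"
proof -
  obtain P M k where "prenex 0 id (universal_closure \<phi>) = (P, M, k)"
    by (cases "prenex 0 id (universal_closure \<phi>)") auto
  then show ?thesis
    by (intro that[of P M k]) (simp_all add: herbrand_vars_def herbrand_matrix_def herbrand_data_def)
qed

lemma herbrand_sig_simps [simp]: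
  "objs (herbrand_sig \<Sigma> \<phi>) = objs \<Sigma>" "sorts (herbrand_sig \<Sigma> \<phi>) = sorts \<Sigma>"
  "con_sort (herbrand_sig \<Sigma> \<phi>) (Old c) = con_sort \<Sigma> c"
  "fun_sort (herbrand_sig \<Sigma> \<phi>) (Old f) = fun_sort \<Sigma> f"
  "Old c \<in> con_syms (herbrand_sig \<Sigma> \<phi>) \<longleftrightarrow> c \<in> con_syms \<Sigma>"
  "Old f \<in> fun_syms (herbrand_sig \<Sigma> \<phi>) \<longleftrightarrow> f \<in> fun_syms \<Sigma>"
  by (auto simp: herbrand_sig_def sorts_def Let_def)

lemma has_fresh_herbrand_sig: "has_fresh (herbrand_sig \<Sigma> \<phi>) 0 (snd (snd (herbrand_data \<phi>)))"
  by (auto simp: has_fresh_def herbrand_sig_def Let_def)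

lemma map_all_consts_Old:
  "c \<in> all_consts \<Sigma> \<Longrightarrow> map_const_sym id Old c \<in> all_consts (herbrand_sig \<Sigma> \<phi>) \<and>
     const_sort (herbrand_sig \<Sigma> \<phi>) (map_const_sym id Old c) = const_sort \<Sigma> c"
  by (auto simp: all_consts_def)

lemma map_all_funs_Old:
  "f \<in> all_funs \<Sigma> \<Longrightarrow> map_fun_sym id Old f \<in> all_funs (herbrand_sig \<Sigma> \<phi>) \<and>
     func_sort (herbrand_sig \<Sigma> \<phi>) (map_fun_sym id Old f) = func_sort \<Sigma> f"
  by (auto simp: all_funs_def)

lemma has_sort_Old: "has_sort \<Sigma> t a \<Longrightarrow> has_sort (herbrand_sig \<Sigma> \<phi>) (map_tm id Old Old t) a"
proof (induction rule: has_sort.induct)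
  case (1 x)
  then show ?case using has_sort.intros(1)[of x "herbrand_sig \<Sigma> \<phi>"] unfolding map_tm_simps_id by simp
next
  case (2 c)
  then show ?case
    using has_sort.intros(2)[of "map_const_sym id Old c" "herbrand_sig \<Sigma> \<phi>"] map_all_consts_Old[of c \<Sigma> \<phi>]
    unfolding tm.map by simp
next
  case (3 f ts)
  then have "list_all2 (has_sort (herbrand_sig \<Sigma> \<phi>)) (map (map_tm id Old Old) ts) (fst (func_sort \<Sigma> f))"
    by (simp add: list_all2_conv_all_nth id_def)
  then show ?case
    using has_sort.intros(3)[of "map_fun_sym id Old f" "herbrand_sig \<Sigma> \<phi>" "map (map_tm id Old Old) ts"]
      map_all_funs_Old[OF 3(1), of \<phi>] unfolding tm.map by simp
qed

lemma is_formula_Old: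
  "quantifier_free \<psi> \<Longrightarrow> is_formula \<Sigma> \<psi> \<Longrightarrow> is_formula (herbrand_sig \<Sigma> \<phi>) (map_fm id Old Old \<psi>)"
  by (induction \<psi>) (auto dest: has_sort_Old)

lemma is_interp_reduct_Old:
  assumes "is_interp (herbrand_sig \<Sigma> \<phi>) \<J>"
  shows "is_interp \<Sigma> (reduct Old Old \<J>)"
  unfolding is_interp_def
proof (intro conjI ballI allI impI)
  fix f as assume "f \<in> all_funs \<Sigma>" "list_all2 (\<lambda>a s. a \<in> dom_set (reduct Old Old \<J>) s) as (fst (func_sort \<Sigma> f))"
  then show "fn (reduct Old Old \<J>) f as \<in> dom_set (reduct Old Old \<J>) (snd (func_sort \<Sigma> f))"
    using assms map_all_funs_Old[of f \<Sigma> \<phi>] unfolding is_interp_def reduct_def by fastforce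
next
  fix c assume "c \<in> all_consts \<Sigma>"
  then show "con (reduct Old Old \<J>) c \<in> dom_set (reduct Old Old \<J>) (const_sort \<Sigma> c)"
    using assms map_all_consts_Old[of c \<Sigma> \<phi>] unfolding is_interp_def reduct_def by fastforce
qed (use assms in \<open>simp add: is_interp_def\<close>)

context
  fixes \<Sigma> :: "('o, 'c, 'f) signature" and \<phi> :: "('o, 'c, 'f) fm"
  assumes wf: "wf_signature \<Sigma>" and fm: "is_formula \<Sigma> \<phi>"
begin

lemma herbrand_prefix_sorts:
  assumes "prenex 0 id (universal_closure \<phi>) = (P, M, k)"
  shows "is_formula \<Sigma> M" "snd ` snd ` set P \<subseteq> sorts \<Sigma>"
  using prenex_is_formula[OF assms is_formula_universal_closure[OF fm]] by (auto simp only: id_apply image_subset_iff)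

lemma quantifier_free_herbrand_matrix: "quantifier_free (herbrand_matrix \<phi>)"
proof (rule herbrand_data_cases[of \<phi>])
  fix P M k assume *: "prenex 0 id (universal_closure \<phi>) = (P, M, k)"
    "herbrandise 0 [] P (map_fm id Old Old M) =
       (herbrand_vars \<phi>, herbrand_matrix \<phi>, snd (snd (herbrand_data \<phi>)))"
  show ?thesis using herbrandise_props(1)[OF *(2)] prenex_props(4)[OF *(1)] by simp
qed

lemma free_vars_map_fm:
  "quantifier_free \<psi> \<Longrightarrow> free_vars (map_fm id g h \<psi>) = free_vars \<psi>"
  by (induction \<psi>) auto

lemma free_vars_herbrand_matrix: "set (free_vars (herbrand_matrix \<phi>)) \<subseteq> set (herbrand_vars \<phi>)"
proof (rule herbrand_data_cases[of \<phi>])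
  fix P M k assume *: "prenex 0 id (universal_closure \<phi>) = (P, M, k)"
    "herbrandise 0 [] P (map_fm id Old Old M) =
       (herbrand_vars \<phi>, herbrand_matrix \<phi>, snd (snd (herbrand_data \<phi>)))"
  show ?thesis
    using herbrandise_props(3)[OF *(2)] prenex_props(4,5)[OF *(1)] by (simp add: free_vars_map_fm)
qed

lemma herbrand_vars_sorts: "snd ` set (herbrand_vars \<phi>) \<subseteq> sorts \<Sigma>"
proof (rule herbrand_data_cases[of \<phi>])
  fix P M k assume *: "prenex 0 id (universal_closure \<phi>) = (P, M, k)"
    "herbrandise 0 [] P (map_fm id Old Old M) =
       (herbrand_vars \<phi>, herbrand_matrix \<phi>, snd (snd (herbrand_data \<phi>)))"
  show ?thesis
    using herbrandise_props(2)[OF *(2)] herbrand_prefix_sorts(2)[OF *(1)] by force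
qed

lemma is_formula_herbrand_matrix: "is_formula (herbrand_sig \<Sigma> \<phi>) (herbrand_matrix \<phi>)"
proof (rule herbrand_data_cases[of \<phi>])
  fix P M k assume *: "prenex 0 id (universal_closure \<phi>) = (P, M, k)"
    "herbrandise 0 [] P (map_fm id Old Old M) =
       (herbrand_vars \<phi>, herbrand_matrix \<phi>, snd (snd (herbrand_data \<phi>)))"
  show ?thesis
    by (rule is_formula_herbrandise[OF *(2) has_fresh_herbrand_sig])
      (use prenex_props(4)[OF *(1)] herbrand_prefix_sorts[OF *(1)] in \<open>auto intro: is_formula_Old\<close>)
qed

lemma fresh_sorts:
  assumes "r \<in> set (snd (snd (herbrand_data \<phi>)))"
  shows "set (fst r) \<subseteq> sorts \<Sigma> \<and> snd r \<in> sorts \<Sigma>"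
proof (rule herbrand_data_cases[of \<phi>])
  fix P M k assume *: "prenex 0 id (universal_closure \<phi>) = (P, M, k)"
    "herbrandise 0 [] P (map_fm id Old Old M) =
       (herbrand_vars \<phi>, herbrand_matrix \<phi>, snd (snd (herbrand_data \<phi>)))"
  show ?thesis
    by (rule herbrandise_props(4)[OF *(2) _ assms]) (use herbrand_prefix_sorts(2)[OF *(1)] in auto)
qed

lemma wf_herbrand_sig: "wf_signature (herbrand_sig \<Sigma> \<phi>)"
proof -
  have "snd (ss ! i) \<in> sorts \<Sigma> \<and> set (fst (ss ! i)) \<subseteq> sorts \<Sigma>"
    if "ss = snd (snd (herbrand_data \<phi>))" "i < length ss" for ss i
    using fresh_sorts[of "ss ! i"] that by auto
  then show ?thesis
    using wf unfolding wf_signature_def herbrand_sig_simps(2)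
    by (auto simp: herbrand_sig_def Let_def subset_iff)
qed

text \<open>If the reduct satisfied \<phi>, then by \<open>herbrandise_sat\<close> some well-sorted
  assignment would satisfy the Herbrand matrix in \<open>\<J>\<close>, regardless of how
  \<open>\<J>\<close> interprets the fresh symbols.\<close>

lemma herbrand_refuted_imp:
  assumes "is_interp (herbrand_sig \<Sigma> \<phi>) \<J>"
    and "\<And>\<beta>. well_assigned (herbrand_sig \<Sigma> \<phi>) \<J> \<beta> \<Longrightarrow> \<not> sat \<J> \<beta> (herbrand_matrix \<phi>)"
  shows "\<not> is_model \<Sigma> (reduct Old Old \<J>) \<phi>"
proof (rule herbrand_data_cases[of \<phi>])
  fix P M k assume *: "prenex 0 id (universal_closure \<phi>) = (P, M, k)"
    "herbrandise 0 [] P (map_fm id Old Old M) =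
       (herbrand_vars \<phi>, herbrand_matrix \<phi>, snd (snd (herbrand_data \<phi>)))"
  let ?\<I> = "reduct Old Old \<J>"
  obtain \<beta> where \<beta>: "well_assigned (herbrand_sig \<Sigma> \<phi>) \<J> \<beta>" using ex_well_assigned[OF assms(1)] by blast
  then have \<beta>': "well_assigned \<Sigma> ?\<I> \<beta>" by (simp add: well_assigned_def del: split_paired_All)
  have "\<not> sat_prefix \<J> P (\<lambda>\<beta>. sat \<J> \<beta> (map_fm id Old Old M)) \<beta>"
  proof
    assume sat: "sat_prefix \<J> P (\<lambda>\<beta>. sat \<J> \<beta> (map_fm id Old Old M)) \<beta>"
    have "\<exists>\<beta>. well_assigned (herbrand_sig \<Sigma> \<phi>) \<J> \<beta> \<and> sat \<J> \<beta> (herbrand_matrix \<phi>)"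
      by (rule herbrandise_sat[OF *(2) has_fresh_herbrand_sig _ _ _ _ assms(1) \<beta> sat])
        (use prenex_props(3,4)[OF *(1)] herbrand_prefix_sorts(2)[OF *(1)] in auto)
    with assms(2) show False by blast
  qed
  then have "\<not> sat_prefix ?\<I> P (\<lambda>\<beta>. sat ?\<I> \<beta> M) \<beta>"
    unfolding sat_map_fm using sat_prefix_dom[OF dom_reduct] by blast
  moreover have "sat_prefix ?\<I> P (\<lambda>\<beta>. sat ?\<I> \<beta> M) \<beta> \<longleftrightarrow> sat ?\<I> (\<beta> \<circ> id) (universal_closure \<phi>)"
    by (rule sat_prefix_prenex[OF *(1) is_formula_universal_closure[OF fm]])
      (use is_interp_reduct_Old[OF assms(1)] in \<open>auto simp: is_interp_def\<close>)
  ultimately have "\<not> sat ?\<I> \<beta> (universal_closure \<phi>)" by simp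
  then have "\<not> (\<forall>\<beta>. well_assigned \<Sigma> ?\<I> \<beta> \<longrightarrow> sat ?\<I> \<beta> (universal_closure \<phi>))" using \<beta>' by blast
  then have "\<not> (\<forall>\<beta>. well_assigned \<Sigma> ?\<I> \<beta> \<longrightarrow> sat ?\<I> \<beta> \<phi>)"
    unfolding universal_closure_def
    by (subst (asm) sat_foldr_All_well_assigned) (use free_vars_sorts[OF fm] in auto)
  then show ?thesis by (simp add: is_model_iff)
qed

text \<open>A countermodel of \<phi> satisfies the negated prenex sentence; interpreting the fresh
  symbols by Skolem functions of that negation refutes the Herbrand matrix under all well-sorted
  assignments at once.\<close>

lemma Skolem_expansion:
  assumes "is_interp \<Sigma> \<I>" "\<not> is_model \<Sigma> \<I> \<phi>"
  obtains \<J> where "is_interp (herbrand_sig \<Sigma> \<phi>) \<J>" "reduct Old Old \<J> = \<I>"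
    "\<And>\<beta>. well_assigned (herbrand_sig \<Sigma> \<phi>) \<J> \<beta> \<Longrightarrow> \<not> sat \<J> \<beta> (herbrand_matrix \<phi>)"
proof (rule herbrand_data_cases[of \<phi>])
  fix P M k assume *: "prenex 0 id (universal_closure \<phi>) = (P, M, k)"
    "herbrandise 0 [] P (map_fm id Old Old M) =
       (herbrand_vars \<phi>, herbrand_matrix \<phi>, snd (snd (herbrand_data \<phi>)))"
  let ?S = "herbrand_sig \<Sigma> \<phi>"
  define el where "el = (\<lambda>s. SOME a. a \<in> dom_set \<I> s)"
  have el: "el s \<in> dom_set \<I> s" if "s \<in> sorts \<Sigma>" for s
    using that assms(1) by (auto simp: el_def is_interp_def some_in_eq)
  \<comment> \<open>The fresh symbols provisionally denote arbitrary elements of the right sort;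
    \<open>herbrandise_unsat\<close> later replaces them by Skolem functions.\<close>
  define \<J>0 :: "('o, 'c ext, 'f ext, 'a) interp" where
    "\<J>0 = \<lparr> dom_set = dom_set \<I>,
      con = (\<lambda>c. case c of Zero u v \<Rightarrow> con \<I> (Zero u v) | Con (Old c) \<Rightarrow> con \<I> (Con c)
               | Con (New i) \<Rightarrow> el (con_sort ?S (New i))),
      fn = (\<lambda>f. case f of Uminus u v \<Rightarrow> fn \<I> (Uminus u v) | Plus u v \<Rightarrow> fn \<I> (Plus u v)
               | Times u v w \<Rightarrow> fn \<I> (Times u v w) | Fun (Old f) \<Rightarrow> fn \<I> (Fun f)
               | Fun (New i) \<Rightarrow> (\<lambda>as. el (snd (fun_sort ?S (New i))))) \<rparr>"
  have red: "reduct Old Old \<J> = \<I>" if "agree_below 0 \<J>0 \<J>" for \<J> :: "('o, 'c ext, 'f ext, 'a) interp"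
  proof -
    have c: "con \<J> c = con \<J>0 c" if "\<forall>j. c \<noteq> Con (New j)" for c
      using \<open>agree_below 0 \<J>0 \<J>\<close> that unfolding agree_below_def by (metis le0)
    have f: "fn \<J> f = fn \<J>0 f" if "\<forall>j. f \<noteq> Fun (New j)" for f
      using \<open>agree_below 0 \<J>0 \<J>\<close> that unfolding agree_below_def by (metis le0)
    have "con \<J> (map_const_sym id Old c) = con \<I> c" for c
      by (cases c) (simp_all add: c, simp_all add: \<J>0_def)
    moreover have "fn \<J> (map_fun_sym id Old f) = fn \<I> f" for f
      by (cases f) (simp_all add: f, simp_all add: \<J>0_def)
    moreover have "dom_set \<J> = dom_set \<I>"
      using that by (simp add: agree_below_def \<J>0_def)
    ultimately show ?thesis by (simp add: reduct_def o_def)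
  qed
  have wa: "well_assigned ?S \<J>0 = well_assigned \<Sigma> \<I>"
    by (intro ext) (simp add: well_assigned_def \<J>0_def)
  have "is_interp ?S \<J>0"
    unfolding is_interp_def
  proof (intro conjI ballI allI impI)
    fix s assume "s \<in> sorts ?S"
    then show "dom_set \<J>0 s \<noteq> {}" using assms(1) by (simp add: is_interp_def \<J>0_def)
  next
    fix c assume c: "c \<in> all_consts ?S"
    show "con \<J>0 c \<in> dom_set \<J>0 (const_sort ?S c)"
    proof (cases c)
      case (Zero u v)
      then have "Zero u v \<in> all_consts \<Sigma>" using c by (auto simp: all_consts_def)
      then show ?thesis using assms(1) Zero by (fastforce simp: is_interp_def \<J>0_def)
    next
      case (Con d)
      then have d: "d \<in> con_syms ?S" using c by (auto simp: all_consts_def)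
      show ?thesis
      proof (cases d)
        case (Old d')
        then have "Con d' \<in> all_consts \<Sigma>" using d by (auto simp: all_consts_def)
        then show ?thesis using assms(1) Con Old by (fastforce simp: is_interp_def \<J>0_def)
      next
        case (New i)
        then have "con_sort ?S (New i) \<in> sorts \<Sigma>"
          using d wf_herbrand_sig by (auto simp: wf_signature_def)
        then show ?thesis using el Con New by (simp add: \<J>0_def)
      qed
    qed
  next
    fix f as assume f: "f \<in> all_funs ?S" and as: "list_all2 (\<lambda>a s. a \<in> dom_set \<J>0 s) as (fst (func_sort ?S f))"
    have old: "fn \<I> g as \<in> dom_set \<I> (snd (func_sort \<Sigma> g))"
      if "g \<in> all_funs \<Sigma>" "func_sort ?S f = func_sort \<Sigma> g" for g
      using assms(1) as that unfolding is_interp_def by (auto simp: \<J>0_def)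
    show "fn \<J>0 f as \<in> dom_set \<J>0 (snd (func_sort ?S f))"
    proof (cases f)
      case (Fun d)
      then have d: "d \<in> fun_syms ?S" using f by (auto simp: all_funs_def)
      show ?thesis
      proof (cases d)
        case (Old d')
        then have "Fun d' \<in> all_funs \<Sigma>" using d by (auto simp: all_funs_def)
        then show ?thesis using old[of "Fun d'"] Fun Old by (simp add: \<J>0_def)
      next
        case (New i)
        then have "snd (fun_sort ?S (New i)) \<in> sorts \<Sigma>"
          using d wf_herbrand_sig by (auto simp: wf_signature_def)
        then show ?thesis using el Fun New by (simp add: \<J>0_def)
      qed
    next
      case (Uminus u v)
      then have "Uminus u v \<in> all_funs \<Sigma>" using f by (auto simp: all_funs_def)
      then show ?thesis using old[of "Uminus u v"] Uminus by (simp add: \<J>0_def)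
    next
      case (Plus u v)
      then have "Plus u v \<in> all_funs \<Sigma>" using f by (auto simp: all_funs_def)
      then show ?thesis using old[of "Plus u v"] Plus by (simp add: \<J>0_def)
    next
      case (Times u v w)
      then have "Times u v w \<in> all_funs \<Sigma>" using f by (auto simp: all_funs_def)
      then show ?thesis using old[of "Times u v w"] Times by (simp add: \<J>0_def)
    qed
  qed
  note J0 = this
  have not_sat: "\<not> sat_prefix \<J>0 P (\<lambda>\<beta>. sat \<J>0 \<beta> (map_fm id Old Old M)) \<beta>"
    if "well_assigned ?S \<J>0 \<beta>" for \<beta>
  proof -
    have "sat_prefix \<I> P (\<lambda>\<beta>. sat \<I> \<beta> M) \<beta> \<longleftrightarrow> sat \<I> (\<beta> \<circ> id) (universal_closure \<phi>)"
      by (rule sat_prefix_prenex[OF *(1) is_formula_universal_closure[OF fm]])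
        (use assms(1) in \<open>auto simp: is_interp_def\<close>)
    moreover have "\<not> sat \<I> \<beta> (universal_closure \<phi>)"
    proof
      assume sat: "sat \<I> \<beta> (universal_closure \<phi>)"
      \<comment> \<open>The closure has no free variables, so its truth under one assignment would
        give its truth under all of them.\<close>
      have "sat \<I> \<beta>' (universal_closure \<phi>)" for \<beta>'
      proof -
        have "sat \<I> \<beta>' (universal_closure \<phi>) \<longleftrightarrow> sat \<I> \<beta> (universal_closure \<phi>)"
          by (rule sat_cong) simp
        with sat show ?thesis by blast
      qed
      then have "\<forall>\<beta>. well_assigned \<Sigma> \<I> \<beta> \<longrightarrow> sat \<I> \<beta> (universal_closure \<phi>)" by blast
      then have "\<forall>\<beta>. well_assigned \<Sigma> \<I> \<beta> \<longrightarrow> sat \<I> \<beta> \<phi>"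
        unfolding universal_closure_def
        by (subst (asm) sat_foldr_All_well_assigned) (use free_vars_sorts[OF fm] in auto)
      then show False using assms by (simp add: is_model_iff)
    qed
    ultimately show ?thesis
      unfolding sat_map_fm red[OF agree_below_refl]
      using sat_prefix_dom[of \<J>0 \<I> P "\<lambda>\<beta>. sat \<I> \<beta> M" \<beta>] by (simp add: \<J>0_def)
  qed
  \<comment> \<open>The renamed matrix mentions old symbols only; this is the starting point of the
    invariance that \<open>herbrandise_unsat\<close> requires.\<close>
  have Old_sat: "sat \<J>1 \<beta> (map_fm id Old Old M) \<longleftrightarrow> sat \<J>2 \<beta> (map_fm id Old Old M)"
    if "agree_below 0 \<J>1 \<J>2" for \<J>1 \<J>2 :: "('o, 'c ext, 'f ext, 'a) interp" and \<beta>
  proof -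
    have "con \<J>1 (map_const_sym id Old c) = con \<J>2 (map_const_sym id Old c)" for c :: "('o, 'c) const_sym"
      using that by (cases c) (simp_all add: agree_below_def)
    moreover have "fn \<J>1 (map_fun_sym id Old f) = fn \<J>2 (map_fun_sym id Old f)" for f :: "('o, 'f) fun_sym"
      using that by (cases f) (simp_all add: agree_below_def)
    ultimately have "reduct Old Old \<J>1 = (reduct Old Old \<J>2 :: ('o, 'c, 'f, 'a) interp)"
      using that by (simp add: reduct_def o_def agree_below_def)
    then show ?thesis by (simp add: sat_map_fm)
  qed
  have "\<exists>\<J>. is_interp ?S \<J> \<and> agree_below 0 \<J>0 \<J> \<and>
      (\<forall>\<beta>. well_assigned ?S \<J> \<beta> \<longrightarrow> \<not> sat \<J> \<beta> (herbrand_matrix \<phi>))"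
  proof (rule herbrandise_unsat[OF *(2) has_fresh_herbrand_sig _ _ _ _ _ Old_sat J0 not_sat])
    show "quantifier_free (map_fm id Old Old M)" "distinct (map snd P)" "set [] \<inter> snd ` set P = {}"
      using prenex_props(3,4)[OF *(1)] by simp_all
    show "set (free_vars (map_fm id Old Old M)) \<subseteq> set [] \<union> snd ` set P"
      using prenex_props(4,5)[OF *(1)] by (simp add: free_vars_map_fm)
    show "snd ` (snd ` set P \<union> set []) \<subseteq> sorts ?S"
      using herbrand_prefix_sorts(2)[OF *(1)] by simp
  qed
  then show ?thesis using that red by blast
qed

end

section \<open>Ackermann reduction\<close>

lemma position_in: "x \<in> set xs \<Longrightarrow> position x xs < length xs \<and> xs ! position x xs = x"
  unfolding position_def by (induction xs) auto

lemma sat_conj_list: "\<phi>s \<noteq> [] \<Longrightarrow> sat \<I> \<beta> (conj_list \<phi>s) \<longleftrightarrow> (\<forall>\<phi>\<in>set \<phi>s. sat \<I> \<beta> \<phi>)"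
  by (induction \<phi>s rule: conj_list.induct) auto

lemma sat_imp_list: "sat \<I> \<beta> (imp_list \<phi>s \<psi>) \<longleftrightarrow> ((\<forall>\<phi>\<in>set \<phi>s. sat \<I> \<beta> \<phi>) \<longrightarrow> sat \<I> \<beta> \<psi>)"
  by (auto simp: imp_list_def sat_conj_list)

lemma terms_conj_list: "\<phi>s \<noteq> [] \<Longrightarrow> set (terms_fm (conj_list \<phi>s)) = (\<Union>\<phi>\<in>set \<phi>s. set (terms_fm \<phi>))"
  by (induction \<phi>s rule: conj_list.induct) auto

lemma terms_imp_list:
  "set (terms_fm (imp_list \<phi>s \<psi>)) = (\<Union>\<phi>\<in>set \<phi>s. set (terms_fm \<phi>)) \<union> set (terms_fm \<psi>)"
  by (auto simp: imp_list_def terms_conj_list)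

lemma quantifier_free_conj_list:
  "\<phi>s \<noteq> [] \<Longrightarrow> quantifier_free (conj_list \<phi>s) \<longleftrightarrow> (\<forall>\<phi>\<in>set \<phi>s. quantifier_free \<phi>)"
  by (induction \<phi>s rule: conj_list.induct) auto

lemma quantifier_free_imp_list:
  "quantifier_free (imp_list \<phi>s \<psi>) \<longleftrightarrow> (\<forall>\<phi>\<in>set \<phi>s. quantifier_free \<phi>) \<and> quantifier_free \<psi>"
  by (auto simp: imp_list_def quantifier_free_conj_list)

lemma is_formula_conj_list:
  "\<phi>s \<noteq> [] \<Longrightarrow> is_formula \<Sigma> (conj_list \<phi>s) \<longleftrightarrow> (\<forall>\<phi>\<in>set \<phi>s. is_formula \<Sigma> \<phi>)"
  by (induction \<phi>s rule: conj_list.induct) auto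

lemma is_formula_imp_list:
  "is_formula \<Sigma> (imp_list \<phi>s \<psi>) \<longleftrightarrow> (\<forall>\<phi>\<in>set \<phi>s. is_formula \<Sigma> \<phi>) \<and> is_formula \<Sigma> \<psi>"
  by (auto simp: imp_list_def is_formula_conj_list)

section \<open>Instances of a function symbol and their arguments\<close>

lemma instances_tm_App: "u \<in> set (instances_tm f t) \<Longrightarrow> u = App (Fun f) (args u)"
  by (induction t) (auto split: if_splits)

text \<open>A stand-in for the subterm relation that keeps only what the reduction needs: instances,
  function symbols, constants and variables.\<close>

definition tm_within :: "('o, 'c, 'f) tm \<Rightarrow> ('o, 'c, 'f) tm \<Rightarrow> bool" where
  "tm_within a t \<longleftrightarrow> (\<forall>f. set (instances_tm f a) \<subseteq> set (instances_tm f t)) \<and>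
     set (nonarith_funs_tm a) \<subseteq> set (nonarith_funs_tm t) \<and> set2_tm a \<subseteq> set2_tm t \<and>
     set (vars_tm a) \<subseteq> set (vars_tm t)"

lemma tm_within_refl: "tm_within t t"
  by (simp add: tm_within_def)

lemma tm_within_trans: "tm_within a b \<Longrightarrow> tm_within b c \<Longrightarrow> tm_within a c"
  unfolding tm_within_def by (meson subset_trans)

lemma args_instances_tm_within:
  "u \<in> set (instances_tm f t) \<Longrightarrow> a \<in> set (args u) \<Longrightarrow> tm_within a t"
proof (induction t)
  case (App g ts)
  have sub: "tm_within b (App g ts)" if "b \<in> set ts" for b
    using that by (auto simp: tm_within_def)
  show ?case
  proof (cases "u \<in> (\<Union>a\<in>set ts. set (instances_tm f a))")
    case True
    then obtain b where b: "b \<in> set ts" "u \<in> set (instances_tm f b)" by blast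
    from App.IH[OF this App.prems(2)] sub[OF b(1)] show ?thesis by (rule tm_within_trans)
  next
    case False
    with App.prems(1) have "u = App g ts" by (auto split: if_splits)
    with sub App.prems(2) show ?thesis by simp
  qed
qed auto

lemma instances_tm_has_sort:
  assumes "has_sort \<Sigma> t a" "u \<in> set (instances_tm f t)"
  shows "has_sort \<Sigma> u (snd (fun_sort \<Sigma> f)) \<and> list_all2 (has_sort \<Sigma>) (args u) (fst (fun_sort \<Sigma> f))"
  using assms
proof (induction arbitrary: u rule: has_sort.induct)
  case (3 g ts)
  show ?case
  proof (cases "u \<in> (\<Union>a\<in>set ts. set (instances_tm f a))")
    case True
    then obtain i where i: "i < length ts" "u \<in> set (instances_tm f (ts ! i))"
      by (metis UN_E in_set_conv_nth)
    with 3(2) show ?thesis by (auto simp: list_all2_conv_all_nth)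
  next
    case False
    with 3(3) have u: "u = App g ts" "g = Fun f" by (auto split: if_splits)
    have "list_all2 (has_sort \<Sigma>) ts (fst (func_sort \<Sigma> g))"
      using 3(2) by (auto simp: list_all2_conv_all_nth)
    with has_sort.intros(3)[OF 3(1) this] u show ?thesis by simp
  qed
qed auto

lemma instances_cases:
  assumes "u \<in> set (instances f \<psi>)"
  obtains t where "t \<in> set (terms_fm \<psi>)" "u \<in> set (instances_tm f t)"
  using assms unfolding instances_def by auto

lemma instances_tm_subset: "t \<in> set (terms_fm \<psi>) \<Longrightarrow> set (instances_tm f t) \<subseteq> set (instances f \<psi>)"
  by (auto simp: instances_def)

lemma instances_App: "u \<in> set (instances f \<psi>) \<Longrightarrow> u = App (Fun f) (args u)"
  by (erule instances_cases) (rule instances_tm_App)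

lemma args_instances_within:
  assumes "v \<in> set (instances f \<psi>)" "a \<in> set (args v)"
  shows "\<exists>t\<in>set (terms_fm \<psi>). tm_within a t"
proof -
  obtain t where t: "t \<in> set (terms_fm \<psi>)" "v \<in> set (instances_tm f t)"
    using assms(1) by (rule instances_cases)
  from t(1) args_instances_tm_within[OF t(2) assms(2)] show ?thesis ..
qed

text \<open>Instances nested inside an instance are listed too. Without this,
  \<open>position\<close> could be asked for a missing term and would return the length of the list,
  which belongs to no instance.\<close>

lemma instances_args_instances:
  assumes "v \<in> set (instances f \<psi>)" "a \<in> set (args v)"
  shows "set (instances_tm f a) \<subseteq> set (instances f \<psi>)"
proof -
  obtain t where "t \<in> set (terms_fm \<psi>)" "tm_within a t"
    using args_instances_within[OF assms] by blast
  then show ?thesis using instances_tm_subset[of t \<psi> f] unfolding tm_within_def by blast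
qed

text \<open>The consistency conditions contribute arguments of instances besides the flattened terms
  of \<psi>. All syntactic invariants of the reduction are derived from this description.\<close>

lemma terms_ack_remove:
  assumes "t \<in> set (terms_fm (ack_remove f \<psi>))"
  shows "(\<exists>u\<in>set (terms_fm \<psi>) \<union> (\<Union>v\<in>set (instances f \<psi>). set (args v)). t = ack_tm f (instances f \<psi>) u) \<or>
    (\<exists>i. t = Const (Con (Inst f i)))"
proof (cases "t \<in> set (terms_fm (ack_flat f \<psi>))")
  case True
  then show ?thesis by (auto simp: ack_flat_def)
next
  case False
  with assms obtain \<phi> where \<phi>: "\<phi> \<in> set (ack_fc f \<psi>)" "t \<in> set (terms_fm \<phi>)"
    by (auto simp: ack_remove_def terms_imp_list)
  let ?fs = "instances f \<psi>"
  obtain i j where ij: "j < length ?fs" "i < j" and \<phi>_def: "\<phi> = imp_list (map2 (\<lambda>s t. Eq (ack_tm f ?fs s) (ack_tm f ?fs t)) (args (?fs ! i)) (args (?fs ! j)))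
           (Eq (Const (Con (Inst f i))) (Const (Con (Inst f j))))"
    using \<phi>(1) by (auto simp: ack_fc_def Let_def)
  from \<phi>(2) consider "\<exists>i. t = Const (Con (Inst f i))"
    | s s' where "(s, s') \<in> set (zip (args (?fs ! i)) (args (?fs ! j)))" "t = ack_tm f ?fs s \<or> t = ack_tm f ?fs s'"
    unfolding \<phi>_def terms_imp_list by auto
  then show ?thesis
  proof cases
    case 2
    then have "s \<in> set (args (?fs ! i))" "s' \<in> set (args (?fs ! j))"
      by (auto dest: set_zip_leftD set_zip_rightD)
    moreover have "?fs ! i \<in> set ?fs" "?fs ! j \<in> set ?fs" using ij by auto
    ultimately show ?thesis using 2(2) by blast
  qed blast
qed

lemma ack_tm_props:
  "set (nonarith_funs_tm (ack_tm f fs t)) \<subseteq> set (nonarith_funs_tm t) - {f}"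
  "set2_tm (ack_tm f fs t) \<subseteq> set2_tm t \<union> range (Inst f)"
  "set (vars_tm (ack_tm f fs t)) \<subseteq> set (vars_tm t)"
proof (induction t)
  case (App g ts)
  { case 1
    have "(\<Union>a\<in>set ts. set (nonarith_funs_tm (ack_tm f fs a))) \<subseteq> (\<Union>a\<in>set ts. set (nonarith_funs_tm a)) - {f}"
      using App(1) by blast
    then show ?case by (cases g) auto }
  { case 2
    have "(\<Union>a\<in>set ts. set2_tm (ack_tm f fs a)) \<subseteq> (\<Union>a\<in>set ts. set2_tm a) \<union> range (Inst f)"
      using App(2) by blast
    then show ?case by auto }
  { case 3
    have "(\<Union>a\<in>set ts. set (vars_tm (ack_tm f fs a))) \<subseteq> (\<Union>a\<in>set ts. set (vars_tm a))"
      using App(3) by blast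
    then show ?case by auto }
qed auto

text \<open>Removing \<open>f\<close> eliminates \<open>f\<close>, brings in no other function
  symbol, and creates constants of the form \<open>Inst f i\<close> only. The constants needed for a
  different symbol therefore stay fresh.\<close>

lemma ack_remove_props:
  assumes "t \<in> set (terms_fm (ack_remove f \<psi>))"
  shows "set (nonarith_funs_tm t) \<subseteq> (\<Union>u\<in>set (terms_fm \<psi>). set (nonarith_funs_tm u)) - {f}"
    "set2_tm t \<subseteq> (\<Union>u\<in>set (terms_fm \<psi>). set2_tm u) \<union> range (Inst f)"
    "set (vars_tm t) \<subseteq> (\<Union>u\<in>set (terms_fm \<psi>). set (vars_tm u))"
proof -
  from terms_ack_remove[OF assms] consider i where "t = Const (Con (Inst f i))"
    | u w where "w \<in> set (terms_fm \<psi>)" "t = ack_tm f (instances f \<psi>) u"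
      "tm_within u w"
    using args_instances_within[of _ f \<psi>] tm_within_refl by blast
  then have "set (nonarith_funs_tm t) \<subseteq> (\<Union>u\<in>set (terms_fm \<psi>). set (nonarith_funs_tm u)) - {f} \<and>
    set2_tm t \<subseteq> (\<Union>u\<in>set (terms_fm \<psi>). set2_tm u) \<union> range (Inst f) \<and>
    set (vars_tm t) \<subseteq> (\<Union>u\<in>set (terms_fm \<psi>). set (vars_tm u))"
  proof cases
    case 2
    let ?a = "ack_tm f (instances f \<psi>) u"
    have "set (nonarith_funs_tm ?a) \<subseteq> set (nonarith_funs_tm w) - {f}"
      "set2_tm ?a \<subseteq> set2_tm w \<union> range (Inst f)" "set (vars_tm ?a) \<subseteq> set (vars_tm w)"
      using ack_tm_props[of f "instances f \<psi>" u] 2(3) by (auto simp only: tm_within_def subset_iff Un_iff Diff_iff)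
    with 2(1) show ?thesis unfolding 2(2) by (auto simp only: subset_iff Un_iff Diff_iff UN_iff)
  qed auto
  then show "set (nonarith_funs_tm t) \<subseteq> (\<Union>u\<in>set (terms_fm \<psi>). set (nonarith_funs_tm u)) - {f}"
    "set2_tm t \<subseteq> (\<Union>u\<in>set (terms_fm \<psi>). set2_tm u) \<union> range (Inst f)"
    "set (vars_tm t) \<subseteq> (\<Union>u\<in>set (terms_fm \<psi>). set (vars_tm u))" by auto
qed

lemma quantifier_free_ack_remove: "quantifier_free \<psi> \<Longrightarrow> quantifier_free (ack_remove f \<psi>)"
  by (auto simp: ack_remove_def quantifier_free_imp_list ack_fc_def ack_flat_def Let_def)

text \<open>It offers \<open>Inst f i\<close> for every index and keeps all function symbols, so a
  single signature independent of the formula serves every stage of the successive removals.\<close>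

definition ack_sig :: "('o, 'c, 'f) signature \<Rightarrow> ('o, ('c, 'f) ack_const, 'f) signature" where
  "ack_sig \<Sigma> = \<lparr> objs = objs \<Sigma>, con_syms = {c. case c of Keep c \<Rightarrow> c \<in> con_syms \<Sigma> | Inst f i \<Rightarrow> f \<in> fun_syms \<Sigma>},
     fun_syms = fun_syms \<Sigma>,
     con_sort = case_ack_const (con_sort \<Sigma>) (\<lambda>f i. snd (fun_sort \<Sigma> f)), fun_sort = fun_sort \<Sigma> \<rparr>"

lemma ack_sig_simps [simp]:
  "objs (ack_sig \<Sigma>) = objs \<Sigma>" "sorts (ack_sig \<Sigma>) = sorts \<Sigma>" "fun_syms (ack_sig \<Sigma>) = fun_syms \<Sigma>"
  "fun_sort (ack_sig \<Sigma>) = fun_sort \<Sigma>" "func_sort (ack_sig \<Sigma>) = func_sort \<Sigma>" "all_funs (ack_sig \<Sigma>) = all_funs \<Sigma>"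
  "Keep c \<in> con_syms (ack_sig \<Sigma>) \<longleftrightarrow> c \<in> con_syms \<Sigma>" "Inst f i \<in> con_syms (ack_sig \<Sigma>) \<longleftrightarrow> f \<in> fun_syms \<Sigma>"
  "con_sort (ack_sig \<Sigma>) (Keep c) = con_sort \<Sigma> c" "con_sort (ack_sig \<Sigma>) (Inst f i) = snd (fun_sort \<Sigma> f)"
proof -
  show "func_sort (ack_sig \<Sigma>) = func_sort \<Sigma>"
  proof
    show "func_sort (ack_sig \<Sigma>) f = func_sort \<Sigma> f" for f by (cases f) (simp_all add: ack_sig_def)
  qed
qed (auto simp: ack_sig_def sorts_def all_funs_def)

lemma has_sort_ack_tm:
  "has_sort (ack_sig \<Sigma>) t a \<Longrightarrow> has_sort (ack_sig \<Sigma>) (ack_tm f fs t) a"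
proof (induction rule: has_sort.induct)
  case (1 x)
  then show ?case by (simp add: has_sort.intros(1))
next
  case (2 c)
  then show ?case by (simp add: has_sort.intros(2))
next
  case (3 g ts)
  show ?case
  proof (cases "g = Fun f")
    case True
    then have "Con (Inst f i) \<in> all_consts (ack_sig \<Sigma>)" for i
      using 3(1) by (auto simp: all_consts_def all_funs_def)
    from has_sort.intros(2)[OF this] True show ?thesis by simp
  next
    case False
    have "list_all2 (has_sort (ack_sig \<Sigma>)) (map (ack_tm f fs) ts) (fst (func_sort (ack_sig \<Sigma>) g))"
      using 3(2) by (simp add: list_all2_conv_all_nth)
    from has_sort.intros(3)[OF 3(1) this] False show ?thesis by simp
  qed
qed

lemma instances_has_sort:
  assumes "is_formula \<Sigma> \<psi>" "quantifier_free \<psi>" "u \<in> set (instances f \<psi>)"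
  shows "has_sort \<Sigma> u (snd (fun_sort \<Sigma> f)) \<and> list_all2 (has_sort \<Sigma>) (args u) (fst (fun_sort \<Sigma> f))"
proof -
  obtain t where t: "t \<in> set (terms_fm \<psi>)" "u \<in> set (instances_tm f t)"
    using assms(3) by (rule instances_cases)
  obtain a where "has_sort \<Sigma> t a"
    using is_formula_quantifier_free_cases[OF assms(2,1) t(1)] by blast
  from instances_tm_has_sort[OF this t(2)] show ?thesis .
qed

lemma is_formula_ack_remove:
  assumes "is_formula (ack_sig \<Sigma>) \<psi>" "quantifier_free \<psi>"
  shows "is_formula (ack_sig \<Sigma>) (ack_remove f \<psi>)"
proof -
  let ?fs = "instances f \<psi>"
  note inst = instances_has_sort[OF assms, of _ f, simplified]
  have const: "has_sort (ack_sig \<Sigma>) (Const (Con (Inst f i))) (snd (fun_sort \<Sigma> f))" if "u \<in> set ?fs" for u i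
  proof -
    have "has_sort (ack_sig \<Sigma>) (App (Fun f) (args u)) (snd (fun_sort \<Sigma> f))"
      using inst[OF that] instances_App[OF that] by metis
    then have "Fun f \<in> all_funs \<Sigma>" by (auto elim: has_sort.cases)
    then have "Con (Inst f i) \<in> all_consts (ack_sig \<Sigma>)" by (auto simp: all_funs_def all_consts_def)
    from has_sort.intros(2)[OF this] show ?thesis by simp
  qed
  have "is_formula (ack_sig \<Sigma>) \<phi>" if fc: "\<phi> \<in> set (ack_fc f \<psi>)" for \<phi>
  proof -
    obtain i j where ij: "j < length ?fs" "i < j" and \<phi>_def: "\<phi> = imp_list (map2 (\<lambda>s t. Eq (ack_tm f ?fs s) (ack_tm f ?fs t)) (args (?fs ! i)) (args (?fs ! j)))
             (Eq (Const (Con (Inst f i))) (Const (Con (Inst f j))))"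
      using fc by (auto simp: ack_fc_def Let_def)
    then have mem: "?fs ! i \<in> set ?fs" "?fs ! j \<in> set ?fs" by auto
    have "is_formula (ack_sig \<Sigma>) (Eq (ack_tm f ?fs s) (ack_tm f ?fs t))"
      if "(s, t) \<in> set (zip (args (?fs ! i)) (args (?fs ! j)))" for s t
    proof -
      from that obtain k where "k < length (args (?fs ! i))" "k < length (args (?fs ! j))"
        "s = args (?fs ! i) ! k" "t = args (?fs ! j) ! k"
        by (auto simp: in_set_zip)
      then have "has_sort (ack_sig \<Sigma>) s (fst (fun_sort \<Sigma> f) ! k)" "has_sort (ack_sig \<Sigma>) t (fst (fun_sort \<Sigma> f) ! k)"
        using inst[OF mem(1)] inst[OF mem(2)] by (auto simp: list_all2_conv_all_nth)
      from this[THEN has_sort_ack_tm, of f ?fs] show ?thesis by auto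
    qed
    then show ?thesis
      unfolding \<phi>_def is_formula_imp_list using const[OF mem(1)] by auto
  qed
  moreover have "is_formula (ack_sig \<Sigma>) (ack_flat f \<psi>)"
    unfolding ack_flat_def by (rule is_formula_map_terms[OF assms(2,1)]) (rule has_sort_ack_tm)
  ultimately show ?thesis by (simp add: ack_remove_def is_formula_imp_list)
qed

lemma sat_ack_remove:
  "sat \<J> \<beta> (ack_remove f \<psi>) \<longleftrightarrow>
    ((\<forall>j<length (instances f \<psi>). \<forall>i<j.
       (\<forall>(s, t)\<in>set (zip (args (instances f \<psi> ! i)) (args (instances f \<psi> ! j))).
          eval \<J> \<beta> (ack_tm f (instances f \<psi>) s) = eval \<J> \<beta> (ack_tm f (instances f \<psi>) t)) \<longrightarrow>
       con \<J> (Con (Inst f i)) = con \<J> (Con (Inst f j))) \<longrightarrow> sat \<J> \<beta> (ack_flat f \<psi>))"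
proof -
  let ?fs = "instances f \<psi>"
  have "(\<forall>\<phi>\<in>set (ack_fc f \<psi>). sat \<J> \<beta> \<phi>) \<longleftrightarrow> (\<forall>j<length ?fs. \<forall>i<j.
    sat \<J> \<beta> (imp_list (map2 (\<lambda>s t. Eq (ack_tm f ?fs s) (ack_tm f ?fs t)) (args (?fs ! i)) (args (?fs ! j)))
             (Eq (Const (Con (Inst f i))) (Const (Con (Inst f j))))))"
    by (auto simp: ack_fc_def Let_def)
  also have "\<dots> \<longleftrightarrow> (\<forall>j<length ?fs. \<forall>i<j.
       (\<forall>(s, t)\<in>set (zip (args (?fs ! i)) (args (?fs ! j))).
          eval \<J> \<beta> (ack_tm f ?fs s) = eval \<J> \<beta> (ack_tm f ?fs t)) \<longrightarrow>
       con \<J> (Con (Inst f i)) = con \<J> (Con (Inst f j)))"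
    by (simp add: sat_imp_list case_prod_beta)
  finally show ?thesis unfolding ack_remove_def sat_imp_list by blast
qed

text \<open>The axioms speak only of domains and arithmetic symbols, so this relation preserves the
  property of being a preadditive semicategory. Skolemisation and Ackermann reduction change other
  symbols only.\<close>

definition same_arith :: "('o, 'c, 'f, 'm) interp \<Rightarrow> ('o, 'c2, 'f2, 'm) interp \<Rightarrow> bool" where
  "same_arith \<I> \<J> \<longleftrightarrow> dom_set \<I> = dom_set \<J> \<and> (\<forall>u v. con \<I> (Zero u v) = con \<J> (Zero u v)) \<and>
     (\<forall>u v. fn \<I> (Uminus u v) = fn \<J> (Uminus u v)) \<and> (\<forall>u v. fn \<I> (Plus u v) = fn \<J> (Plus u v)) \<and>
     (\<forall>u v w. fn \<I> (Times u v w) = fn \<J> (Times u v w))"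

lemma same_arith_refl: "same_arith \<I> \<I>"
  by (simp add: same_arith_def)

lemma same_arith_sym: "same_arith \<I> \<J> \<Longrightarrow> same_arith \<J> \<I>"
  by (simp add: same_arith_def)

lemma same_arith_trans: "same_arith \<I> \<J> \<Longrightarrow> same_arith \<J> \<K> \<Longrightarrow> same_arith \<I> \<K>"
  by (simp add: same_arith_def)

lemma same_arith_reduct: "same_arith (reduct g h \<J>) \<J>"
  by (simp add: same_arith_def reduct_def)

lemma same_arith_well_assigned:
  "same_arith \<I> \<J> \<Longrightarrow> sorts \<Sigma> = sorts \<Sigma>' \<Longrightarrow> well_assigned \<Sigma> \<I> \<beta> \<longleftrightarrow> well_assigned \<Sigma>' \<J> \<beta>"
  by (simp add: same_arith_def well_assigned_def)

text \<open>Let \<open>Inst f i\<close> denote the value of the \<open>i\<close>-th instance.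
  Flattening then preserves all values, and the consistency conditions hold because \<open>f\<close>
  denotes a function. Freshness ensures that the new meanings do not disturb \<psi> itself.\<close>

lemma ack_remove_unsat:
  assumes J: "is_interp (ack_sig \<Sigma>) \<J>" and wa: "well_assigned (ack_sig \<Sigma>) \<J> \<beta>"
    and \<psi>: "is_formula (ack_sig \<Sigma>) \<psi>" "quantifier_free \<psi>"
    and fresh: "\<And>t i. t \<in> set (terms_fm \<psi>) \<Longrightarrow> Inst f i \<notin> set2_tm t" and "\<not> sat \<J> \<beta> \<psi>"
  shows "\<exists>\<J>'. is_interp (ack_sig \<Sigma>) \<J>' \<and> same_arith \<J> \<J>' \<and> \<not> sat \<J>' \<beta> (ack_remove f \<psi>)"
proof -
  let ?fs = "instances f \<psi>"
  define \<J>' where "\<J>' = \<J>\<lparr>con := (\<lambda>c. case c of Con (Inst g i) \<Rightarrow>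
      if g = f \<and> i < length ?fs then eval \<J> \<beta> (?fs ! i) else con \<J> c | _ \<Rightarrow> con \<J> c)\<rparr>"
  have Inst: "con \<J>' (Con (Inst f i)) = eval \<J> \<beta> (?fs ! i)" if "i < length ?fs" for i
    using that by (simp add: \<J>'_def)
  have inst: "has_sort (ack_sig \<Sigma>) u (snd (fun_sort \<Sigma> f)) \<and>
      list_all2 (has_sort (ack_sig \<Sigma>)) (args u) (fst (fun_sort \<Sigma> f))" if "u \<in> set ?fs" for u
    using instances_has_sort[OF \<psi> that] by simp
  have "is_interp (ack_sig \<Sigma>) \<J>'"
    unfolding is_interp_def
  proof (intro conjI ballI allI impI)
    fix c assume c: "c \<in> all_consts (ack_sig \<Sigma>)"
    have old: "con \<J> c \<in> dom_set \<J> (const_sort (ack_sig \<Sigma>) c)"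
      using J c by (simp add: is_interp_def)
    show "con \<J>' c \<in> dom_set \<J>' (const_sort (ack_sig \<Sigma>) c)"
    proof (cases "\<exists>i < length ?fs. c = Con (Inst f i)")
      case True
      then obtain i where i: "i < length ?fs" "c = Con (Inst f i)" by blast
      have "eval \<J> \<beta> (?fs ! i) \<in> dom_set \<J> (snd (fun_sort \<Sigma> f))"
        using eval_in_dom[OF _ J wa] inst[of "?fs ! i"] i(1) by auto
      then show ?thesis using i by (simp add: \<J>'_def)
    next
      case False
      then have "con \<J>' c = con \<J> c"
        by (auto simp: \<J>'_def split: const_sym.split ack_const.split)
      with old show ?thesis by (simp add: \<J>'_def)
    qed
  qed (use J in \<open>auto simp: is_interp_def \<J>'_def\<close>)
  moreover have "same_arith \<J> \<J>'" by (simp add: same_arith_def \<J>'_def)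
  moreover have "\<not> sat \<J>' \<beta> (ack_remove f \<psi>)"
  proof -
    \<comment> \<open>Arguments of instances also need this equation, so it is proved for every term
      whose instances are listed and not just for the terms of \<psi>.\<close>
    have ev: "eval \<J>' \<beta> (ack_tm f ?fs t) = eval \<J> \<beta> t"
      if "set (instances_tm f t) \<subseteq> set ?fs" "\<And>i. Inst f i \<notin> set2_tm t" for t
      using that
    proof (induction t)
      case (Const c)
      from Const(2) have "c \<noteq> Con (Inst f i)" for i by fastforce
      then show ?case
        by (auto simp: \<J>'_def split: const_sym.split ack_const.split)
    next
      case (App g ts)
      show ?case
      proof (cases "g = Fun f")
        case True
        with App.prems(1) have "App g ts \<in> set ?fs" by auto
        from position_in[OF this] have pos: "position (App g ts) ?fs < length ?fs"
          "?fs ! position (App g ts) ?fs = App g ts" by auto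
        show ?thesis using Inst[OF pos(1)] pos(2) True by simp
      next
        case False
        have "eval \<J>' \<beta> (ack_tm f ?fs t) = eval \<J> \<beta> t" if "t \<in> set ts" for t
          by (rule App.IH[OF that]) (use App.prems that in auto)
        then have "map (eval \<J>' \<beta>) (map (ack_tm f ?fs) ts) = map (eval \<J> \<beta>) ts" by simp
        moreover have "fn \<J>' g = fn \<J> g" by (simp add: \<J>'_def)
        ultimately show ?thesis using False by (simp del: map_map map_eq_conv)
      qed
    qed simp
    have "\<not> sat \<J>' \<beta> (ack_flat f \<psi>)"
      unfolding ack_flat_def
      by (subst sat_map_terms[OF \<psi>(2), where \<J> = \<J> and \<beta>' = \<beta>])
        (use ev instances_tm_subset[of _ \<psi> f] fresh assms(6) in auto)
    moreover have "con \<J>' (Con (Inst f i)) = con \<J>' (Con (Inst f j))"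
      if ij: "j < length ?fs" "i < j" and eq: "\<forall>(s, t)\<in>set (zip (args (?fs ! i)) (args (?fs ! j))).
          eval \<J>' \<beta> (ack_tm f ?fs s) = eval \<J>' \<beta> (ack_tm f ?fs t)" for i j
    proof -
      have mem: "?fs ! i \<in> set ?fs" "?fs ! j \<in> set ?fs" using ij by auto
      have len: "length (args (?fs ! i)) = length (args (?fs ! j))"
        using inst[OF mem(1)] inst[OF mem(2)] by (metis list_all2_lengthD)
      have arg: "eval \<J>' \<beta> (ack_tm f ?fs a) = eval \<J> \<beta> a" if ua: "u \<in> set ?fs" "a \<in> set (args u)" for u a
      proof (rule ev)
        show "set (instances_tm f a) \<subseteq> set ?fs" by (rule instances_args_instances[OF ua])
        obtain t where "t \<in> set (terms_fm \<psi>)" "tm_within a t"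
          using args_instances_within[OF ua] by blast
        with fresh show "Inst f k \<notin> set2_tm a" for k unfolding tm_within_def by blast
      qed
      \<comment> \<open>The premise compares flattened arguments in \<open>\<J>'\<close>; their
        values are those of the original arguments in \<open>\<J>\<close>, where the function
        denoted by \<open>f\<close> can be applied to them.\<close>
      have "map (eval \<J> \<beta>) (args (?fs ! i)) = map (eval \<J> \<beta>) (args (?fs ! j))"
      proof (rule nth_equalityI)
        fix k assume "k < length (map (eval \<J> \<beta>) (args (?fs ! i)))"
        then have k: "k < length (args (?fs ! i))" "k < length (args (?fs ! j))" using len by auto
        then have "(args (?fs ! i) ! k, args (?fs ! j) ! k) \<in> set (zip (args (?fs ! i)) (args (?fs ! j)))"
          by (auto simp: set_zip)
        with eq have "eval \<J>' \<beta> (ack_tm f ?fs (args (?fs ! i) ! k)) = eval \<J>' \<beta> (ack_tm f ?fs (args (?fs ! j) ! k))"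
          by blast
        then have "eval \<J> \<beta> (args (?fs ! i) ! k) = eval \<J> \<beta> (args (?fs ! j) ! k)"
          using arg[OF mem(1), of "args (?fs ! i) ! k"] arg[OF mem(2), of "args (?fs ! j) ! k"] k by simp
        then show "map (eval \<J> \<beta>) (args (?fs ! i)) ! k = map (eval \<J> \<beta>) (args (?fs ! j)) ! k"
          using k by simp
      qed (simp add: len)
      then have "eval \<J> \<beta> (App (Fun f) (args (?fs ! i))) = eval \<J> \<beta> (App (Fun f) (args (?fs ! j)))"
        by (simp del: map_eq_conv)
      then have "eval \<J> \<beta> (?fs ! i) = eval \<J> \<beta> (?fs ! j)"
        using instances_App[OF mem(1)] instances_App[OF mem(2)] by metis
      then show ?thesis using Inst ij by simp
    qed
    ultimately show ?thesis unfolding sat_ack_remove by blast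
  qed
  ultimately show ?thesis by blast
qed

text \<open>A function for \<open>f\<close> is read off the constants: at the argument values of the
  \<open>i\<close>-th instance it takes the value of \<open>Inst f i\<close>. The consistency
  conditions, true since the implication fails, make this well defined.\<close>

lemma ack_remove_unsat_conv:
  assumes J: "is_interp (ack_sig \<Sigma>) \<J>" and \<psi>: "quantifier_free \<psi>"
    and unsat: "\<not> sat \<J> \<beta> (ack_remove f \<psi>)"
  shows "\<exists>\<J>'. is_interp (ack_sig \<Sigma>) \<J>' \<and> same_arith \<J> \<J>' \<and> \<not> sat \<J>' \<beta> \<psi>"
proof -
  let ?fs = "instances f \<psi>"
  let ?val = "\<lambda>i. map (\<lambda>a. eval \<J> \<beta> (ack_tm f ?fs a)) (args (?fs ! i))"
  \<comment> \<open>If no instance has the argument values \<open>as\<close>, the least index is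
    \<open>length ?fs\<close>, since the condition becomes vacuous there. Then \<open>g\<close>
    returns the constant with that index, which still has the right sort; so \<open>g\<close> is
    total.\<close>
  define g where "g as = con \<J> (Con (Inst f (LEAST i. i < length ?fs \<longrightarrow> as = ?val i)))" for as
  have fc: "con \<J> (Con (Inst f i)) = con \<J> (Con (Inst f j))"
    if "i < length ?fs" "j < length ?fs" "?val i = ?val j" for i j
  proof -
    \<comment> \<open>The conditions are generated for \<open>i < j\<close> only; the other order
      follows by symmetry.\<close>
    have *: "con \<J> (Con (Inst f i)) = con \<J> (Con (Inst f j))"
      if ij: "j < length ?fs" "i < j" and eq: "?val i = ?val j" for i j
    proof -
      have "eval \<J> \<beta> (ack_tm f ?fs s) = eval \<J> \<beta> (ack_tm f ?fs t)"
        if "(s, t) \<in> set (zip (args (?fs ! i)) (args (?fs ! j)))" for s t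
      proof -
        from that obtain k where k: "k < length (args (?fs ! i))" "k < length (args (?fs ! j))"
          "s = args (?fs ! i) ! k" "t = args (?fs ! j) ! k"
          by (auto simp: in_set_zip)
        from arg_cong[OF eq, of "\<lambda>xs. xs ! k"] k show ?thesis by simp
      qed
      then show ?thesis using unsat ij unfolding sat_ack_remove by blast
    qed
    show ?thesis
    proof (cases i j rule: linorder_cases)
      case less
      from *[OF that(2) this that(3)] show ?thesis .
    next
      case greater
      from *[OF that(1) this that(3)[symmetric]] show ?thesis by (rule sym)
    qed simp
  qed
  have g: "g (?val i) = con \<J> (Con (Inst f i))" if "i < length ?fs" for i
  proof -
    let ?l = "LEAST k. k < length ?fs \<longrightarrow> ?val i = ?val k"
    have "?l < length ?fs \<longrightarrow> ?val i = ?val ?l" by (rule LeastI[of _ i]) simp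
    moreover have "?l \<le> i" by (rule Least_le) simp
    from this that have l: "?l < length ?fs" by (rule order_le_less_trans)
    ultimately have "?val i = ?val ?l" by blast
    from fc[OF that l this] show ?thesis by (simp only: g_def)
  qed
  define \<J>' where "\<J>' = \<J>\<lparr>fn := (fn \<J>)(Fun f := g)\<rparr>"
  have "is_interp (ack_sig \<Sigma>) \<J>'"
    unfolding is_interp_def
  proof (intro conjI ballI allI impI)
    fix h as assume h: "h \<in> all_funs (ack_sig \<Sigma>)"
      "list_all2 (\<lambda>a s. a \<in> dom_set \<J>' s) as (fst (func_sort (ack_sig \<Sigma>) h))"
    show "fn \<J>' h as \<in> dom_set \<J>' (snd (func_sort (ack_sig \<Sigma>) h))"
    proof (cases "h = Fun f")
      case True
      then have "Con (Inst f i) \<in> all_consts (ack_sig \<Sigma>)" for i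
        using h(1) by (auto simp: all_funs_def all_consts_def)
      then have "con \<J> (Con (Inst f i)) \<in> dom_set \<J> (snd (fun_sort \<Sigma> f))" for i
        using J unfolding is_interp_def by fastforce
      then show ?thesis using True by (simp add: \<J>'_def g_def)
    next
      case False
      then show ?thesis using J h by (auto simp: is_interp_def \<J>'_def)
    qed
  qed (use J in \<open>auto simp: is_interp_def \<J>'_def\<close>)
  moreover have "same_arith \<J> \<J>'" by (simp add: same_arith_def \<J>'_def)
  moreover have "\<not> sat \<J>' \<beta> \<psi>"
  proof -
    have ev: "eval \<J> \<beta> (ack_tm f ?fs t) = eval \<J>' \<beta> t"
      if "set (instances_tm f t) \<subseteq> set ?fs" for t
      using that
    proof (induction t)
      case (App h ts)
      have IH: "eval \<J> \<beta> (ack_tm f ?fs t) = eval \<J>' \<beta> t" if "t \<in> set ts" for t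
        by (rule App.IH[OF that]) (use App.prems that in auto)
      then have IH': "map (\<lambda>a. eval \<J> \<beta> (ack_tm f ?fs a)) ts = map (eval \<J>' \<beta>) ts" by simp
      show ?case
      proof (cases "h = Fun f")
        case True
        with App.prems(1) have "App h ts \<in> set ?fs" by auto
        from position_in[OF this] have pos: "position (App h ts) ?fs < length ?fs"
          "?fs ! position (App h ts) ?fs = App h ts" by auto
        have "eval \<J>' \<beta> (App h ts) = g (?val (position (App h ts) ?fs))"
          unfolding pos(2) using True IH' by (simp add: \<J>'_def del: map_eq_conv)
        then show ?thesis using g[OF pos(1)] True by simp
      next
        case False
        moreover have "fn \<J>' h = fn \<J> h" using False by (simp add: \<J>'_def)
        ultimately show ?thesis using IH' by (simp add: o_def del: map_eq_conv)
      qed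
    qed (auto simp: \<J>'_def)
    have "sat \<J> \<beta> (ack_flat f \<psi>) \<longleftrightarrow> sat \<J>' \<beta> \<psi>"
      unfolding ack_flat_def
      by (rule sat_map_terms[OF \<psi>]) (use ev instances_tm_subset[of _ \<psi> f] in auto)
    then show ?thesis using unsat unfolding sat_ack_remove by blast
  qed
  ultimately show ?thesis by blast
qed

text \<open>Distinctness of \<open>fs\<close> maintains freshness through the induction: removing
  \<open>f\<close> introduces constants for \<open>f\<close> alone, and \<open>f\<close> does not
  come up again.\<close>

lemma fold_ack_remove_unsat:
  assumes "is_interp (ack_sig \<Sigma>) \<J>" "well_assigned (ack_sig \<Sigma>) \<J> \<beta>"
    "is_formula (ack_sig \<Sigma>) \<psi>" "quantifier_free \<psi>"
    "\<And>t f i. t \<in> set (terms_fm \<psi>) \<Longrightarrow> f \<in> set fs \<Longrightarrow> Inst f i \<notin> set2_tm t" "distinct fs" "\<not> sat \<J> \<beta> \<psi>"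
  shows "\<exists>\<J>'. is_interp (ack_sig \<Sigma>) \<J>' \<and> same_arith \<J> \<J>' \<and> \<not> sat \<J>' \<beta> (fold ack_remove fs \<psi>)"
  using assms
proof (induction fs arbitrary: \<J> \<psi>)
  case Nil
  then show ?case using same_arith_refl by auto
next
  case (Cons f fs)
  obtain \<J>1 where J1: "is_interp (ack_sig \<Sigma>) \<J>1" "same_arith \<J> \<J>1" "\<not> sat \<J>1 \<beta> (ack_remove f \<psi>)"
    using ack_remove_unsat[OF Cons.prems(1-4) Cons.prems(5) Cons.prems(7), of f] by auto
  have "\<exists>\<J>'. is_interp (ack_sig \<Sigma>) \<J>' \<and> same_arith \<J>1 \<J>' \<and> \<not> sat \<J>' \<beta> (fold ack_remove fs (ack_remove f \<psi>))"
  proof (rule Cons.IH[OF J1(1) _ _ _ _ _ J1(3)])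
    show "well_assigned (ack_sig \<Sigma>) \<J>1 \<beta>"
      using same_arith_well_assigned[OF J1(2) refl] Cons.prems(2) by blast
    show "is_formula (ack_sig \<Sigma>) (ack_remove f \<psi>)" by (rule is_formula_ack_remove[OF Cons.prems(3,4)])
    show "quantifier_free (ack_remove f \<psi>)" by (rule quantifier_free_ack_remove[OF Cons.prems(4)])
    show "distinct fs" using Cons.prems(6) by simp
    fix t h i assume t: "t \<in> set (terms_fm (ack_remove f \<psi>))" "h \<in> set fs"
    then have "h \<noteq> f" using Cons.prems(6) by auto
    moreover have "Inst h i \<notin> (\<Union>u\<in>set (terms_fm \<psi>). set2_tm u)" using Cons.prems(5) t(2) by simp
    ultimately show "Inst h i \<notin> set2_tm t" using ack_remove_props(2)[OF t(1)] by blast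
  qed
  then show ?case using same_arith_trans[OF J1(2)] by auto
qed

lemma fold_ack_remove_unsat_conv:
  assumes "is_interp (ack_sig \<Sigma>) \<J>" "quantifier_free \<psi>" "\<not> sat \<J> \<beta> (fold ack_remove fs \<psi>)"
  shows "\<exists>\<J>'. is_interp (ack_sig \<Sigma>) \<J>' \<and> same_arith \<J> \<J>' \<and> \<not> sat \<J>' \<beta> \<psi>"
  using assms
proof (induction fs arbitrary: \<J> \<psi>)
  case Nil
  then show ?case using same_arith_refl by auto
next
  case (Cons f fs)
  from Cons.prems(3) have unsat: "\<not> sat \<J> \<beta> (fold ack_remove fs (ack_remove f \<psi>))" by simp
  obtain \<J>1 where J1: "is_interp (ack_sig \<Sigma>) \<J>1" "same_arith \<J> \<J>1" "\<not> sat \<J>1 \<beta> (ack_remove f \<psi>)"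
    using Cons.IH[OF Cons.prems(1) quantifier_free_ack_remove[OF Cons.prems(2)] unsat] by blast
  from ack_remove_unsat_conv[OF J1(1) Cons.prems(2) J1(3)] show ?case
    using same_arith_trans[OF J1(2)] by blast
qed

lemma fold_ack_remove_props:
  assumes "is_formula (ack_sig \<Sigma>) \<psi>" "quantifier_free \<psi>"
  shows "is_formula (ack_sig \<Sigma>) (fold ack_remove fs \<psi>) \<and> quantifier_free (fold ack_remove fs \<psi>) \<and>
    (\<forall>t\<in>set (terms_fm (fold ack_remove fs \<psi>)).
      set (nonarith_funs_tm t) \<subseteq> (\<Union>u\<in>set (terms_fm \<psi>). set (nonarith_funs_tm u)) - set fs \<and>
      set (vars_tm t) \<subseteq> (\<Union>u\<in>set (terms_fm \<psi>). set (vars_tm u)))"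
  using assms
proof (induction fs arbitrary: \<psi>)
  case (Cons f fs)
  note IH = Cons.IH[OF is_formula_ack_remove[OF Cons.prems] quantifier_free_ack_remove[OF Cons.prems(2)], of f]
  have "(\<Union>u\<in>set (terms_fm (ack_remove f \<psi>)). set (nonarith_funs_tm u)) \<subseteq>
      (\<Union>u\<in>set (terms_fm \<psi>). set (nonarith_funs_tm u)) - {f}"
    using ack_remove_props(1)[of _ f \<psi>] by blast
  moreover have "(\<Union>u\<in>set (terms_fm (ack_remove f \<psi>)). set (vars_tm u)) \<subseteq> (\<Union>u\<in>set (terms_fm \<psi>). set (vars_tm u))"
    using ack_remove_props(3)[of _ f \<psi>] by blast
  ultimately show ?case using IH by (simp, blast)
qed auto

section \<open>The complete Ackermann reduction\<close>

lemma map_const_Keep: "c \<in> all_consts \<Sigma> \<Longrightarrow>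
   map_const_sym id Keep c \<in> all_consts (ack_sig \<Sigma>) \<and>
   const_sort (ack_sig \<Sigma>) (map_const_sym id Keep c) = const_sort \<Sigma> c"
  by (auto simp: all_consts_def)

lemma map_fun_sym_id: "map_fun_sym id id = id"
  by (rule ext) (simp add: fun_sym.map_id)

lemma has_sort_Keep: "has_sort \<Sigma> t a \<Longrightarrow> has_sort (ack_sig \<Sigma>) (map_tm id Keep id t) a"
proof (induction rule: has_sort.induct)
  case (1 x)
  then show ?case using has_sort.intros(1)[of x "ack_sig \<Sigma>"] unfolding map_tm_simps_id by simp
next
  case (2 c)
  then show ?case
    using has_sort.intros(2)[of "map_const_sym id Keep c" "ack_sig \<Sigma>"] map_const_Keep[of c \<Sigma>]
    unfolding tm.map by simp
next
  case (3 f ts)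
  then have "list_all2 (has_sort (ack_sig \<Sigma>)) (map (map_tm id Keep id) ts) (fst (func_sort \<Sigma> f))"
    by (simp add: list_all2_conv_all_nth id_def)
  then show ?case
    using has_sort.intros(3)[of f "ack_sig \<Sigma>" "map (map_tm id Keep id) ts"] 3(1)
    unfolding tm.map map_fun_sym_id by simp
qed

lemma is_formula_Keep:
  "quantifier_free \<psi> \<Longrightarrow> is_formula \<Sigma> \<psi> \<Longrightarrow> is_formula (ack_sig \<Sigma>) (map_fm id Keep id \<psi>)"
  by (induction \<psi>) (auto dest: has_sort_Keep)

lemma nonarith_funs_Keep: "set (nonarith_funs_tm (map_tm id Keep id t)) = set (nonarith_funs_tm t)"
proof (induction t)
  case (App f ts)
  then show ?case unfolding tm.map map_fun_sym_id by (simp add: id_def)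
qed auto

lemma set_nonarith_funs: "set (nonarith_funs \<psi>) = (\<Union>u\<in>set (terms_fm \<psi>). set (nonarith_funs_tm u))"
  by (simp add: nonarith_funs_def)

lemma is_interp_reduct_Keep:
  assumes "is_interp (ack_sig \<Sigma>) \<J>"
  shows "is_interp \<Sigma> (reduct Keep id \<J>)"
  unfolding is_interp_def
proof (intro conjI ballI allI impI)
  fix f as assume "f \<in> all_funs \<Sigma>" "list_all2 (\<lambda>a s. a \<in> dom_set (reduct Keep id \<J>) s) as (fst (func_sort \<Sigma> f))"
  then show "fn (reduct Keep id \<J>) f as \<in> dom_set (reduct Keep id \<J>) (snd (func_sort \<Sigma> f))"
    using assms unfolding is_interp_def reduct_def map_fun_sym_id by simp
next
  fix c assume "c \<in> all_consts \<Sigma>"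
  then show "con (reduct Keep id \<J>) c \<in> dom_set (reduct Keep id \<J>) (const_sort \<Sigma> c)"
    using assms map_const_Keep[of c \<Sigma>] unfolding is_interp_def reduct_def by fastforce
qed (use assms in \<open>simp add: is_interp_def\<close>)

lemma ackermann_unsat:
  assumes wf: "wf_signature \<Sigma>" and I: "is_interp \<Sigma> \<I>" and wa: "well_assigned \<Sigma> \<I> \<beta>"
    and \<psi>: "is_formula \<Sigma> \<psi>" "quantifier_free \<psi>" and unsat: "\<not> sat \<I> \<beta> \<psi>"
  obtains \<J> where "is_interp (ack_sig \<Sigma>) \<J>" "same_arith \<I> \<J>" "\<not> sat \<J> \<beta> (ackermann \<psi>)"
proof -
  \<comment> \<open>The constants \<open>Inst f i\<close> start as arbitrary elements of the result
    sort of \<open>f\<close>; the removal of \<open>f\<close> then gives the instances their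
    intended values.\<close>
  define \<J> :: "('a, ('b, 'c) ack_const, 'c, 'd) interp" where
    "\<J> = \<lparr> dom_set = dom_set \<I>,
      con = (\<lambda>c. case c of Zero u v \<Rightarrow> con \<I> (Zero u v) | Con (Keep c) \<Rightarrow> con \<I> (Con c)
        | Con (Inst f i) \<Rightarrow> SOME a. a \<in> dom_set \<I> (snd (fun_sort \<Sigma> f))), fn = fn \<I> \<rparr>"
  have red: "reduct Keep id \<J> = \<I>"
  proof -
    have "con \<J> (map_const_sym id Keep c) = con \<I> c" for c
      by (cases c) (simp_all add: \<J>_def)
    then show ?thesis by (simp add: reduct_def o_def \<J>_def map_fun_sym_id)
  qed
  have "is_interp (ack_sig \<Sigma>) \<J>"
    unfolding is_interp_def
  proof (intro conjI ballI allI impI)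
    fix c assume c: "c \<in> all_consts (ack_sig \<Sigma>)"
    show "con \<J> c \<in> dom_set \<J> (const_sort (ack_sig \<Sigma>) c)"
    proof (cases c)
      case (Zero u v)
      then have "Zero u v \<in> all_consts \<Sigma>" using c by (auto simp: all_consts_def)
      then show ?thesis using I Zero by (fastforce simp: is_interp_def \<J>_def)
    next
      case (Con d)
      then have d: "d \<in> con_syms (ack_sig \<Sigma>)" using c by (auto simp: all_consts_def)
      show ?thesis
      proof (cases d)
        case (Keep d')
        then have "Con d' \<in> all_consts \<Sigma>" using d by (auto simp: all_consts_def)
        then show ?thesis using I Con Keep by (fastforce simp: is_interp_def \<J>_def)
      next
        case (Inst f i)
        then have "snd (fun_sort \<Sigma> f) \<in> sorts \<Sigma>" using d wf by (auto simp: wf_signature_def)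
        then show ?thesis using I Con Inst by (auto simp: is_interp_def \<J>_def some_in_eq)
      qed
    qed
  qed (use I in \<open>auto simp: is_interp_def \<J>_def\<close>)
  moreover have "same_arith \<I> \<J>" by (simp add: same_arith_def \<J>_def)
  moreover have "well_assigned (ack_sig \<Sigma>) \<J> \<beta>"
    using wa by (simp add: well_assigned_def \<J>_def)
  moreover have "\<not> sat \<J> \<beta> (map_fm id Keep id \<psi>)"
    using unsat by (simp add: sat_map_fm red)
  moreover have "Inst f i \<notin> set2_tm t" if "t \<in> set (terms_fm (map_fm id Keep id \<psi>))" for t f i
    using that by (auto simp: tm.set_map)
  moreover have "distinct (nonarith_funs \<psi>)" by (simp add: nonarith_funs_def)
  ultimately have "\<exists>\<J>'. is_interp (ack_sig \<Sigma>) \<J>' \<and> same_arith \<J> \<J>' \<and>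
      \<not> sat \<J>' \<beta> (fold ack_remove (nonarith_funs \<psi>) (map_fm id Keep id \<psi>))"
    by (intro fold_ack_remove_unsat is_formula_Keep \<psi>) (simp_all add: \<psi>)
  then show thesis
    using that same_arith_trans[OF \<open>same_arith \<I> \<J>\<close>] unfolding ackermann_def by blast
qed

lemma ackermann_unsat_conv:
  assumes "is_interp (ack_sig \<Sigma>) \<J>" "quantifier_free \<psi>" "\<not> sat \<J> \<beta> (ackermann \<psi>)"
  obtains \<I> where "is_interp \<Sigma> \<I>" "same_arith \<I> \<J>" "\<not> sat \<I> \<beta> \<psi>"
proof -
  obtain \<J>' where J': "is_interp (ack_sig \<Sigma>) \<J>'" "same_arith \<J> \<J>'" "\<not> sat \<J>' \<beta> (map_fm id Keep id \<psi>)"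
    using fold_ack_remove_unsat_conv[OF assms(1) _ assms(3)[unfolded ackermann_def]] assms(2) by auto
  show thesis
  proof (rule that)
    show "is_interp \<Sigma> (reduct Keep id \<J>')" by (rule is_interp_reduct_Keep[OF J'(1)])
    show "same_arith (reduct Keep id \<J>') \<J>"
      using same_arith_trans[OF same_arith_reduct same_arith_sym[OF J'(2)]] .
    show "\<not> sat (reduct Keep id \<J>') \<beta> \<psi>" using J'(3) by (simp add: sat_map_fm)
  qed
qed

lemma ackermann_props:
  assumes "is_formula \<Sigma> \<psi>" "quantifier_free \<psi>"
  shows "is_formula (ack_sig \<Sigma>) (ackermann \<psi>)" "quantifier_free (ackermann \<psi>)"
    "\<And>t. t \<in> set (terms_fm (ackermann \<psi>)) \<Longrightarrow> nonarith_funs_tm t = []"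
    "\<And>t. t \<in> set (terms_fm (ackermann \<psi>)) \<Longrightarrow>
       set (vars_tm t) \<subseteq> (\<Union>u\<in>set (terms_fm \<psi>). set (vars_tm u))"
proof -
  note p = fold_ack_remove_props[OF is_formula_Keep[OF assms(2,1)], of "nonarith_funs \<psi>"]
  show "is_formula (ack_sig \<Sigma>) (ackermann \<psi>)" "quantifier_free (ackermann \<psi>)"
    using p assms by (simp_all add: ackermann_def)
  show "nonarith_funs_tm t = []" if "t \<in> set (terms_fm (ackermann \<psi>))" for t
  proof -
    have "set (nonarith_funs_tm t) \<subseteq> (\<Union>u\<in>set (terms_fm \<psi>). set (nonarith_funs_tm u)) - set (nonarith_funs \<psi>)"
      using p that assms(2) by (auto simp: ackermann_def nonarith_funs_Keep)
    then show ?thesis by (simp add: set_nonarith_funs)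
  qed
  show "set (vars_tm t) \<subseteq> (\<Union>u\<in>set (terms_fm \<psi>). set (vars_tm u))"
    if "t \<in> set (terms_fm (ackermann \<psi>))" for t
    using p that assms(2) by (simp add: ackermann_def)
qed

section \<open>The axioms as laws of an interpretation\<close>

definition preadditive_laws :: "('o, 'c, 'f, 'm) interp \<Rightarrow> 'o \<Rightarrow> 'o \<Rightarrow> 'o \<Rightarrow> 'o \<Rightarrow> bool" where
  "preadditive_laws \<I> u u' v v' \<longleftrightarrow>
     (\<forall>x\<in>dom_set \<I> (v', v). \<forall>y\<in>dom_set \<I> (u', v'). \<forall>z\<in>dom_set \<I> (u, u').
        fn \<I> (Times u v v') [x, fn \<I> (Times u v' u') [y, z]] =
        fn \<I> (Times u v u') [fn \<I> (Times u' v v') [x, y], z]) \<and>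
     (\<forall>x\<in>dom_set \<I> (u, v). \<forall>y\<in>dom_set \<I> (u, v). \<forall>z\<in>dom_set \<I> (u, v).
        fn \<I> (Plus u v) [x, fn \<I> (Plus u v) [y, z]] = fn \<I> (Plus u v) [fn \<I> (Plus u v) [x, y], z]) \<and>
     (\<forall>x\<in>dom_set \<I> (u, v). fn \<I> (Plus u v) [x, con \<I> (Zero u v)] = x) \<and>
     (\<forall>x\<in>dom_set \<I> (u, v). fn \<I> (Plus u v) [x, fn \<I> (Uminus u v) [x]] = con \<I> (Zero u v)) \<and>
     (\<forall>x\<in>dom_set \<I> (u, v). \<forall>y\<in>dom_set \<I> (u, v).
        fn \<I> (Plus u v) [x, y] = fn \<I> (Plus u v) [y, x]) \<and>
     (\<forall>x\<in>dom_set \<I> (v', v). \<forall>y\<in>dom_set \<I> (u, v'). \<forall>z\<in>dom_set \<I> (u, v').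
        fn \<I> (Times u v v') [x, fn \<I> (Plus u v') [y, z]] =
        fn \<I> (Plus u v) [fn \<I> (Times u v v') [x, y], fn \<I> (Times u v v') [x, z]]) \<and>
     (\<forall>x\<in>dom_set \<I> (v', v). \<forall>y\<in>dom_set \<I> (v', v). \<forall>z\<in>dom_set \<I> (u, v').
        fn \<I> (Times u v v') [fn \<I> (Plus v' v) [x, y], z] =
        fn \<I> (Plus u v) [fn \<I> (Times u v v') [x, z], fn \<I> (Times u v v') [y, z]])"

definition preadditive :: "('o, 'c, 'f) signature \<Rightarrow> ('o, 'c, 'f, 'm) interp \<Rightarrow> bool" where
  "preadditive \<Sigma> \<I> \<longleftrightarrow> (\<forall>u\<in>objs \<Sigma>. \<forall>u'\<in>objs \<Sigma>. \<forall>v\<in>objs \<Sigma>. \<forall>v'\<in>objs \<Sigma>.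
     preadditive_laws \<I> u u' v v')"

text \<open>The axioms are closed, so a single assignment decides them, and the bounded quantifiers
  can be read off.\<close>

lemma models_axioms_iff:
  assumes "is_interp \<Sigma> \<I>"
  shows "(\<forall>\<alpha>\<in>axioms \<Sigma>. is_model \<Sigma> \<I> \<alpha>) \<longleftrightarrow> preadditive \<Sigma> \<I>"
proof -
  obtain \<beta>0 where \<beta>0: "well_assigned \<Sigma> \<I> \<beta>0" using ex_well_assigned[OF assms] by blast
  have closed: "is_model \<Sigma> \<I> \<alpha> \<longleftrightarrow> sat \<I> \<beta>0 \<alpha>" if "free_vars \<alpha> = []" for \<alpha>
  proof -
    have "sat \<I> \<beta> \<alpha> \<longleftrightarrow> sat \<I> \<beta>0 \<alpha>" for \<beta>
      by (rule sat_cong) (simp add: that)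
    then show ?thesis using assms \<beta>0 by (auto simp: is_model_iff)
  qed
  have "(\<forall>\<alpha>\<in>axioms \<Sigma>. is_model \<Sigma> \<I> \<alpha>) \<longleftrightarrow> (\<forall>\<alpha>\<in>axioms \<Sigma>. sat \<I> \<beta>0 \<alpha>)"
  proof (rule ball_cong[OF refl])
    fix \<alpha> assume "\<alpha> \<in> axioms \<Sigma>"
    then have "free_vars \<alpha> = []"
      by (auto simp: axioms_def ax_mult_assoc_def ax_add_assoc_def ax_add_zero_def ax_add_minus_def
          ax_add_comm_def ax_distrib_left_def ax_distrib_right_def Let_def)
    then show "is_model \<Sigma> \<I> \<alpha> \<longleftrightarrow> sat \<I> \<beta>0 \<alpha>" by (rule closed)
  qed
  also have "\<dots> \<longleftrightarrow> preadditive \<Sigma> \<I>"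
    unfolding preadditive_def preadditive_laws_def axioms_def
    by (simp add: ax_mult_assoc_def ax_add_assoc_def ax_add_zero_def ax_add_minus_def
          ax_add_comm_def ax_distrib_left_def ax_distrib_right_def Let_def ball_UN ball_conj_distrib)
  finally show ?thesis .
qed

lemma preadditive_cong:
  "same_arith \<I> \<J> \<Longrightarrow> objs \<Sigma> = objs \<Sigma>' \<Longrightarrow> preadditive \<Sigma> \<I> \<longleftrightarrow> preadditive \<Sigma>' \<J>"
  by (simp add: preadditive_def preadditive_laws_def same_arith_def)

section \<open>Clausal normal form\<close>

fun atoms :: "('o, 'c, 'f) fm \<Rightarrow> (('o, 'c, 'f) tm \<times> ('o, 'c, 'f) tm) set" where
  "atoms (Eq s t) = {(s, t)}"
| "atoms (Neg \<phi>) = atoms \<phi>"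
| "atoms (Or \<phi> \<psi>) = atoms \<phi> \<union> atoms \<psi>"
| "atoms (And \<phi> \<psi>) = atoms \<phi> \<union> atoms \<psi>"
| "atoms (Imp \<phi> \<psi>) = atoms \<phi> \<union> atoms \<psi>"
| "atoms (Ex x \<phi>) = atoms \<phi>"
| "atoms (All x \<phi>) = atoms \<phi>"

lemma atoms_has_sort:
  "quantifier_free \<phi> \<Longrightarrow> is_formula \<Sigma> \<phi> \<Longrightarrow> (s, t) \<in> atoms \<phi> \<Longrightarrow> \<exists>a. has_sort \<Sigma> s a \<and> has_sort \<Sigma> t a"
  by (induction \<phi>) auto

lemma atoms_terms: "(s, t) \<in> atoms \<phi> \<Longrightarrow> s \<in> set (terms_fm \<phi>) \<and> t \<in> set (terms_fm \<phi>)"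
  by (induction \<phi>) auto

fun negation_normal :: "('o, 'c, 'f) fm \<Rightarrow> bool" where
  "negation_normal (Eq s t) \<longleftrightarrow> True"
| "negation_normal (Neg \<phi>) \<longleftrightarrow> (\<exists>s t. \<phi> = Eq s t)"
| "negation_normal (Or \<phi> \<psi>) \<longleftrightarrow> negation_normal \<phi> \<and> negation_normal \<psi>"
| "negation_normal (And \<phi> \<psi>) \<longleftrightarrow> negation_normal \<phi> \<and> negation_normal \<psi>"
| "negation_normal (Imp \<phi> \<psi>) \<longleftrightarrow> False"
| "negation_normal (Ex x \<phi>) \<longleftrightarrow> False"
| "negation_normal (All x \<phi>) \<longleftrightarrow> False"

fun imp_free :: "('o, 'c, 'f) fm \<Rightarrow> bool" where
  "imp_free (Eq s t) \<longleftrightarrow> True"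
| "imp_free (Neg \<phi>) \<longleftrightarrow> imp_free \<phi>"
| "imp_free (Or \<phi> \<psi>) \<longleftrightarrow> imp_free \<phi> \<and> imp_free \<psi>"
| "imp_free (And \<phi> \<psi>) \<longleftrightarrow> imp_free \<phi> \<and> imp_free \<psi>"
| "imp_free (Imp \<phi> \<psi>) \<longleftrightarrow> False"
| "imp_free (Ex x \<phi>) \<longleftrightarrow> False"
| "imp_free (All x \<phi>) \<longleftrightarrow> False"

lemma elim_imp_props:
  "quantifier_free \<phi> \<Longrightarrow> (sat \<I> \<beta> (elim_imp \<phi>) \<longleftrightarrow> sat \<I> \<beta> \<phi>) \<and> atoms (elim_imp \<phi>) = atoms \<phi> \<and> imp_free (elim_imp \<phi>)"
  by (induction \<phi>) auto

lemma push_neg_props: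
  "imp_free \<phi> \<Longrightarrow> (sat \<I> \<beta> (push_neg \<phi>) \<longleftrightarrow> sat \<I> \<beta> \<phi>) \<and> atoms (push_neg \<phi>) = atoms \<phi> \<and> negation_normal (push_neg \<phi>)"
  by (induction \<phi> rule: push_neg.induct) simp_all

lemma sat_distribute:
  "sat \<I> \<beta> \<phi> \<longleftrightarrow> (\<forall>C\<in>set (distribute \<phi>). \<exists>L\<in>set C. sat \<I> \<beta> L)"
proof (induction \<phi>)
  case (Or \<phi> \<psi>)
  have "(\<forall>C\<in>set (distribute (Or \<phi> \<psi>)). \<exists>L\<in>set C. sat \<I> \<beta> L) \<longleftrightarrow>
      (\<forall>C\<in>set (distribute \<phi>). \<forall>D\<in>set (distribute \<psi>). (\<exists>L\<in>set C. sat \<I> \<beta> L) \<or> (\<exists>L\<in>set D. sat \<I> \<beta> L))"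
    by (simp add: bex_Un)
  also have "\<dots> \<longleftrightarrow> (\<forall>C\<in>set (distribute \<phi>). \<exists>L\<in>set C. sat \<I> \<beta> L) \<or>
      (\<forall>D\<in>set (distribute \<psi>). \<exists>L\<in>set D. sat \<I> \<beta> L)"
    by blast
  finally show ?case by (simp only: sat.simps Or[symmetric])
qed (simp_all add: ball_Un)

lemma distribute_literals:
  "negation_normal \<phi> \<Longrightarrow> C \<in> set (distribute \<phi>) \<Longrightarrow> L \<in> set C \<Longrightarrow>
   \<exists>s t. (s, t) \<in> atoms \<phi> \<and> (L = Eq s t \<or> L = Neg (Eq s t))"
proof (induction \<phi> arbitrary: C)
  case (Or \<phi> \<psi>)
  from Or.prems(2) obtain D E where "C = D @ E" "D \<in> set (distribute \<phi>)" "E \<in> set (distribute \<psi>)" by auto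
  with Or.prems Or.IH(1)[of D] Or.IH(2)[of E] show ?case by auto
next
  case (And \<phi> \<psi>)
  then consider "C \<in> set (distribute \<phi>)" | "C \<in> set (distribute \<psi>)" by auto
  then show ?case
  proof cases
    case 1
    from And.IH(1)[OF _ 1 And.prems(3)] And.prems(1) show ?thesis by auto
  next
    case 2
    from And.IH(2)[OF _ 2 And.prems(3)] And.prems(1) show ?thesis by auto
  qed
qed auto

text \<open>Ties the generators and candidates of a clause to the equations of the original formula,
  from which they inherit common sorts and groundness.\<close>

lemma cnf_literals:
  assumes "quantifier_free \<phi>" "C \<in> set (cnf \<phi>)" "L \<in> set C"
  obtains s t where "(s, t) \<in> atoms \<phi>" "L = Eq s t \<or> L = Neg (Eq s t)"
proof -
  note e = elim_imp_props[OF assms(1)]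
  note p = push_neg_props[of "elim_imp \<phi>"]
  have "\<exists>s t. (s, t) \<in> atoms (push_neg (elim_imp \<phi>)) \<and> (L = Eq s t \<or> L = Neg (Eq s t))"
    by (rule distribute_literals[OF _ assms(2)[unfolded cnf_def] assms(3)]) (use e p in blast)
  then show thesis using that e p by blast
qed

lemma sat_cnf:
  assumes "quantifier_free \<phi>"
  shows "sat \<I> \<beta> \<phi> \<longleftrightarrow> (\<forall>C\<in>set (cnf \<phi>). \<exists>L\<in>set C. sat \<I> \<beta> L)"
  using elim_imp_props[OF assms, of \<I> \<beta>] push_neg_props[of "elim_imp \<phi>" \<I> \<beta>]
    sat_distribute[of \<I> \<beta> "push_neg (elim_imp \<phi>)"] unfolding cnf_def by blast

lemma set_generators: "set (generators C) = {to_alg s - to_alg t | s t. Neg (Eq s t) \<in> set C}"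
  unfolding generators_def by (auto split: fm.splits)

lemma set_candidates: "set (candidates C) = {to_alg p - to_alg q | p q. Eq p q \<in> set C}"
  unfolding candidates_def by (auto split: fm.splits)

section \<open>Soundness of idealisation\<close>

text \<open>A formal identity and a formal zero make composition a total, associative operation.\<close>

datatype ('o, 'm) elt = Null | Unit | El 'o 'o 'm

context
  fixes \<Sigma> :: "('o, 'x, 'f) signature" and \<I> :: "('o, 'x, 'f, 'm) interp"
  assumes interp: "is_interp \<Sigma> \<I>" and preadd: "preadditive \<Sigma> \<I>"
begin

private abbreviation "D \<equiv> dom_set \<I>"
private abbreviation "add u v x y \<equiv> fn \<I> (Plus u v) [x, y]"
private abbreviation "neg u v x \<equiv> fn \<I> (Uminus u v) [x]"
private abbreviation "mul u v w x y \<equiv> fn \<I> (Times u v w) [x, y]"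
private abbreviation "null u v \<equiv> con \<I> (Zero u v)"

section \<open>Hom-sets as abelian groups\<close>

lemma add_closed: "u \<in> objs \<Sigma> \<Longrightarrow> v \<in> objs \<Sigma> \<Longrightarrow> x \<in> D (u, v) \<Longrightarrow> y \<in> D (u, v) \<Longrightarrow> add u v x y \<in> D (u, v)"
  using interp unfolding is_interp_def
  by (elim conjE ballE[of _ _ "Plus u v"] allE[of _ "[x, y]"]) (auto simp: all_funs_def)

lemma neg_closed: "u \<in> objs \<Sigma> \<Longrightarrow> v \<in> objs \<Sigma> \<Longrightarrow> x \<in> D (u, v) \<Longrightarrow> neg u v x \<in> D (u, v)"
  using interp unfolding is_interp_def
  by (elim conjE ballE[of _ _ "Uminus u v"] allE[of _ "[x]"]) (auto simp: all_funs_def)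

lemma mul_closed:
  "u \<in> objs \<Sigma> \<Longrightarrow> v \<in> objs \<Sigma> \<Longrightarrow> w \<in> objs \<Sigma> \<Longrightarrow> x \<in> D (w, v) \<Longrightarrow> y \<in> D (u, w) \<Longrightarrow> mul u v w x y \<in> D (u, v)"
  using interp unfolding is_interp_def
  by (elim conjE ballE[of _ _ "Times u v w"] allE[of _ "[x, y]"]) (auto simp: all_funs_def)

lemma null_closed: "u \<in> objs \<Sigma> \<Longrightarrow> v \<in> objs \<Sigma> \<Longrightarrow> null u v \<in> D (u, v)"
  using interp unfolding is_interp_def
  by (elim conjE ballE[of _ _ "Zero u v"]) (auto simp: all_consts_def)

lemmas closed = add_closed neg_closed mul_closed null_closed

lemma mul_assoc:
  "u \<in> objs \<Sigma> \<Longrightarrow> u' \<in> objs \<Sigma> \<Longrightarrow> v \<in> objs \<Sigma> \<Longrightarrow> v' \<in> objs \<Sigma> \<Longrightarrow>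
   x \<in> D (v', v) \<Longrightarrow> y \<in> D (u', v') \<Longrightarrow> z \<in> D (u, u') \<Longrightarrow>
   mul u v v' x (mul u v' u' y z) = mul u v u' (mul u' v v' x y) z"
  using preadd unfolding preadditive_def preadditive_laws_def by blast

lemma mul_add:
  "u \<in> objs \<Sigma> \<Longrightarrow> v \<in> objs \<Sigma> \<Longrightarrow> v' \<in> objs \<Sigma> \<Longrightarrow>
   x \<in> D (v', v) \<Longrightarrow> y \<in> D (u, v') \<Longrightarrow> z \<in> D (u, v') \<Longrightarrow>
   mul u v v' x (add u v' y z) = add u v (mul u v v' x y) (mul u v v' x z)"
  using preadd unfolding preadditive_def preadditive_laws_def by blast

lemma add_mul:
  "u \<in> objs \<Sigma> \<Longrightarrow> v \<in> objs \<Sigma> \<Longrightarrow> v' \<in> objs \<Sigma> \<Longrightarrow>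
   x \<in> D (v', v) \<Longrightarrow> y \<in> D (v', v) \<Longrightarrow> z \<in> D (u, v') \<Longrightarrow>
   mul u v v' (add v' v x y) z = add u v (mul u v v' x z) (mul u v v' y z)"
  using preadd unfolding preadditive_def preadditive_laws_def by blast

lemma add_assoc':
  "u \<in> objs \<Sigma> \<Longrightarrow> v \<in> objs \<Sigma> \<Longrightarrow> x \<in> D (u, v) \<Longrightarrow> y \<in> D (u, v) \<Longrightarrow> z \<in> D (u, v) \<Longrightarrow>
   add u v x (add u v y z) = add u v (add u v x y) z"
  using preadd unfolding preadditive_def preadditive_laws_def by blast

lemma add_commute':
  "u \<in> objs \<Sigma> \<Longrightarrow> v \<in> objs \<Sigma> \<Longrightarrow> x \<in> D (u, v) \<Longrightarrow> y \<in> D (u, v) \<Longrightarrow> add u v x y = add u v y x"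
  using preadd unfolding preadditive_def preadditive_laws_def by blast

lemma add_null: "u \<in> objs \<Sigma> \<Longrightarrow> v \<in> objs \<Sigma> \<Longrightarrow> x \<in> D (u, v) \<Longrightarrow> add u v x (null u v) = x"
  using preadd unfolding preadditive_def preadditive_laws_def by blast

lemma add_neg: "u \<in> objs \<Sigma> \<Longrightarrow> v \<in> objs \<Sigma> \<Longrightarrow> x \<in> D (u, v) \<Longrightarrow> add u v x (neg u v x) = null u v"
  using preadd unfolding preadditive_def preadditive_laws_def by blast

text \<open>A hom-set as a group in multiplicative notation, which makes the universal property of
  free abelian groups applicable.\<close>

definition hom_group :: "'o sort \<Rightarrow> 'm monoid" where
  "hom_group \<sigma> = \<lparr> carrier = D \<sigma>, mult = add (fst \<sigma>) (snd \<sigma>), one = null (fst \<sigma>) (snd \<sigma>) \<rparr>"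

lemma hom_group_simps [simp]:
  "carrier (hom_group \<sigma>) = D \<sigma>" "monoid.mult (hom_group (u, v)) = add u v" "one (hom_group (u, v)) = null u v"
  by (simp_all add: hom_group_def)

lemma comm_group_hom_group:
  assumes "u \<in> objs \<Sigma>" "v \<in> objs \<Sigma>"
  shows "comm_group (hom_group (u, v))"
proof (rule comm_groupI)
  fix x assume x: "x \<in> carrier (hom_group (u, v))"
  then show "\<one>\<^bsub>hom_group (u, v)\<^esub> \<otimes>\<^bsub>hom_group (u, v)\<^esub> x = x"
    using assms add_null add_commute' null_closed by simp
  show "\<exists>y\<in>carrier (hom_group (u, v)). y \<otimes>\<^bsub>hom_group (u, v)\<^esub> x = \<one>\<^bsub>hom_group (u, v)\<^esub>"
    using assms x add_neg add_commute' neg_closed by (intro bexI[of _ "neg u v x"]) simp_all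
  fix y assume y: "y \<in> carrier (hom_group (u, v))"
  show "x \<otimes>\<^bsub>hom_group (u, v)\<^esub> y \<in> carrier (hom_group (u, v))"
    using assms x y add_closed by simp
  show "x \<otimes>\<^bsub>hom_group (u, v)\<^esub> y = y \<otimes>\<^bsub>hom_group (u, v)\<^esub> x"
    using assms x y add_commute' by simp
  fix z assume z: "z \<in> carrier (hom_group (u, v))"
  show "x \<otimes>\<^bsub>hom_group (u, v)\<^esub> y \<otimes>\<^bsub>hom_group (u, v)\<^esub> z = x \<otimes>\<^bsub>hom_group (u, v)\<^esub> (y \<otimes>\<^bsub>hom_group (u, v)\<^esub> z)"
    using assms x y z add_assoc' by simp
qed (use assms null_closed in simp_all)

lemma inv_hom_group:
  assumes "u \<in> objs \<Sigma>" "v \<in> objs \<Sigma>" "x \<in> D (u, v)"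
  shows "inv\<^bsub>hom_group (u, v)\<^esub> x = neg u v x"
proof -
  interpret G: comm_group "hom_group (u, v)" by (rule comm_group_hom_group[OF assms(1,2)])
  show ?thesis using G.inv_unique'[of x "neg u v x"] assms closed add_neg add_commute' by simp
qed

text \<open>Additively, the free algebra is the free abelian group on words: both consist of the
  finitely supported integer functions on words.\<close>

definition additive :: "'o sort \<Rightarrow> ('x free_alg \<Rightarrow> 'm) \<Rightarrow> bool" where
  "additive \<sigma> h \<longleftrightarrow> h \<in> hom (free_Abelian_group UNIV) (hom_group \<sigma>)"

lemma additiveI:
  "(\<And>p. h p \<in> D (u, v)) \<Longrightarrow> (\<And>p q. h (p + q) = add u v (h p) (h q)) \<Longrightarrow> additive (u, v) h"
  by (simp add: additive_def hom_def)

lemma additive_closed: "additive \<sigma> h \<Longrightarrow> h p \<in> D \<sigma>"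
  by (auto simp: additive_def hom_def)

lemma additive_add: "additive (u, v) h \<Longrightarrow> h (p + q) = add u v (h p) (h q)"
  by (simp add: additive_def hom_def)

lemma additive_group_hom:
  assumes "u \<in> objs \<Sigma>" "v \<in> objs \<Sigma>" "additive (u, v) h"
  shows "group_hom (free_Abelian_group UNIV) (hom_group (u, v)) h"
proof -
  interpret G: comm_group "hom_group (u, v)" by (rule comm_group_hom_group[OF assms(1,2)])
  show ?thesis
    using assms(3) by (simp add: group_hom_def group_hom_axioms_def additive_def G.is_group)
qed

lemma additive_zero: "u \<in> objs \<Sigma> \<Longrightarrow> v \<in> objs \<Sigma> \<Longrightarrow> additive (u, v) h \<Longrightarrow> h 0 = null u v"
  using group_hom.hom_one[OF additive_group_hom] by simp

lemma additive_uminus: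
  "u \<in> objs \<Sigma> \<Longrightarrow> v \<in> objs \<Sigma> \<Longrightarrow> additive (u, v) h \<Longrightarrow> h (- p) = neg u v (h p)"
  using group_hom.hom_inv[OF additive_group_hom, of u v h p] inv_hom_group[of u v "h p"]
    additive_closed[of "(u, v)" h p] by simp

text \<open>The words generate the free algebra as an abelian group, so additive maps that agree on
  words are equal. Most identities between values of polynomials are reduced to words in this
  way.\<close>

lemma additive_eqI:
  assumes "u \<in> objs \<Sigma>" "v \<in> objs \<Sigma>" "additive (u, v) h" "additive (u, v) h'"
    "\<And>w. h (Poly_Mapping.single w 1) = h' (Poly_Mapping.single w 1)"
  shows "h p = h' p"
proof (rule frag_induction[of p UNIV "\<lambda>p. h p = h' p"])
  show "h 0 = h' 0" using assms by (simp add: additive_zero)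
  show "h (frag_of x) = h' (frag_of x)" for x by (simp add: assms(5))
  show "h (a - b) = h' (a - b)" if "h a = h' a" "h b = h' b" for a b
    unfolding diff_conv_add_uminus additive_add[OF assms(3)] additive_add[OF assms(4)]
      additive_uminus[OF assms(1,2,3)] additive_uminus[OF assms(1,2,4)] that ..
qed simp

section \<open>Words as composable elements\<close>

fun comp :: "('o, 'm) elt \<Rightarrow> ('o, 'm) elt \<Rightarrow> ('o, 'm) elt" where
  "comp Unit e = e"
| "comp e Unit = e"
| "comp (El w v x) (El u w' y) = (if w = w' then El u v (mul u v w x y) else Null)"
| "comp _ _ = Null"

fun sorted_elt :: "('o, 'm) elt \<Rightarrow> bool" where
  "sorted_elt (El u v x) \<longleftrightarrow> u \<in> objs \<Sigma> \<and> v \<in> objs \<Sigma> \<and> x \<in> D (u, v)"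
| "sorted_elt _ \<longleftrightarrow> True"

lemma comp_Unit [simp]: "comp e Unit = e"
  by (cases e) auto

lemma comp_Null [simp]: "comp e Null = Null" "comp Null e = Null"
  by (cases e; simp)+

lemma sorted_comp: "sorted_elt d \<Longrightarrow> sorted_elt e \<Longrightarrow> sorted_elt (comp d e)"
  by (cases "(d, e)" rule: comp.cases) (auto intro: mul_closed)

text \<open>Where all objects match this is the associativity axiom. Otherwise a mismatch yields
  \<open>Null\<close> in whichever order the products are formed, since composition keeps the outer
  objects.\<close>

lemma comp_assoc:
  "sorted_elt d \<Longrightarrow> sorted_elt e \<Longrightarrow> sorted_elt f \<Longrightarrow> comp (comp d e) f = comp d (comp e f)"
  by (cases d; cases e; cases f) (auto simp: mul_assoc)

text \<open>A constant outside the signature has no guaranteed value; sending it to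
  \<open>Null\<close> makes the map total on indeterminates, with sorted values throughout.\<close>

definition letter :: "'x \<Rightarrow> ('o, 'm) elt" where
  "letter c = (if c \<in> con_syms \<Sigma> \<and> con_sort \<Sigma> c \<in> sorts \<Sigma>
     then El (fst (con_sort \<Sigma> c)) (snd (con_sort \<Sigma> c)) (con \<I> (Con c)) else Null)"

definition word :: "'x mon \<Rightarrow> ('o, 'm) elt" where
  "word w = foldr (\<lambda>c e. comp (letter c) e) (letters w) Unit"

lemma sorted_letter: "sorted_elt (letter c)"
proof -
  have "con \<I> (Con c) \<in> D (con_sort \<Sigma> c)" if "c \<in> con_syms \<Sigma>"
    using interp that unfolding is_interp_def
    by (elim conjE ballE[of _ _ "Con c"]) (auto simp: all_consts_def)
  then show ?thesis by (auto simp: letter_def sorts_def)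
qed

lemma sorted_word: "sorted_elt (word w)"
proof -
  have "sorted_elt (foldr (\<lambda>c e. comp (letter c) e) cs Unit)" for cs
    by (induction cs) (auto intro: sorted_comp sorted_letter)
  then show ?thesis by (simp add: word_def)
qed

text \<open>Thus \<open>word\<close> is a homomorphism from the free monoid; the formal identity is
  needed as the image of the empty word.\<close>

lemma word_add: "word (w + w') = comp (word w) (word w')"
proof -
  have "foldr (\<lambda>c e. comp (letter c) e) (cs @ letters w') Unit =
      comp (foldr (\<lambda>c e. comp (letter c) e) cs Unit) (word w')" for cs
  proof (induction cs)
    case Nil
    then show ?case by (simp add: word_def)
  next
    case (Cons c cs)
    have "sorted_elt (foldr (\<lambda>c e. comp (letter c) e) cs Unit)"
      using sorted_word[of "Mon cs"] by (simp add: word_def)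
    then show ?case using Cons by (simp add: comp_assoc sorted_letter sorted_word)
  qed
  then show ?thesis by (simp add: word_def plus_mon_def)
qed

text \<open>\<open>Unit\<close> is not an element of any hom-set, so its entries are set to zero.
  The empty word can still have nonzero entries once it is surrounded by other elements.\<close>

fun entry :: "'o sort \<Rightarrow> ('o, 'm) elt \<Rightarrow> 'm" where
  "entry \<sigma> (El u v x) = (if \<sigma> = (u, v) then x else null (fst \<sigma>) (snd \<sigma>))"
| "entry \<sigma> _ = null (fst \<sigma>) (snd \<sigma>)"

lemma entry_closed: "\<sigma> \<in> sorts \<Sigma> \<Longrightarrow> sorted_elt e \<Longrightarrow> entry \<sigma> e \<in> D \<sigma>"
  by (cases e) (auto simp: sorts_def null_closed)

text \<open>The linear extension of the map that sends a word \<open>w\<close> to the \<open>\<sigma>\<close>-entry of \<open>d w e\<close>.\<close>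

definition sandwich :: "'o sort \<Rightarrow> ('o, 'm) elt \<Rightarrow> ('o, 'm) elt \<Rightarrow> 'x free_alg \<Rightarrow> 'm" where
  "sandwich \<sigma> d e = (SOME h. additive \<sigma> h \<and>
     (\<forall>w. h (Poly_Mapping.single w 1) = entry \<sigma> (comp d (comp (word w) e))))"

text \<open>A map with both properties exists by the universal property of the free abelian group on
  words, the prescribed values being elements of the hom-set.\<close>

lemma sandwich:
  assumes "u \<in> objs \<Sigma>" "v \<in> objs \<Sigma>" "sorted_elt d" "sorted_elt e"
  shows "additive (u, v) (sandwich (u, v) d e)"
    "sandwich (u, v) d e (Poly_Mapping.single w 1) = entry (u, v) (comp d (comp (word w) e))"
proof -
  interpret G: comm_group "hom_group (u, v)" by (rule comm_group_hom_group[OF assms(1,2)])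
  let ?f = "\<lambda>w. entry (u, v) (comp d (comp (word w) e))"
  have "range ?f \<subseteq> carrier (hom_group (u, v))"
    using assms by (auto intro!: entry_closed sorted_comp sorted_word simp: sorts_def)
  then obtain h where "h \<in> hom (free_Abelian_group UNIV) (hom_group (u, v))" "\<And>w. w \<in> UNIV \<Longrightarrow> h (frag_of w) = ?f w"
    by (rule G.free_Abelian_group_universal) blast
  then have "\<exists>h. additive (u, v) h \<and> (\<forall>w. h (Poly_Mapping.single w 1) = ?f w)"
    by (auto simp: additive_def)
  then have "additive (u, v) (sandwich (u, v) d e) \<and>
      (\<forall>w. sandwich (u, v) d e (Poly_Mapping.single w 1) = ?f w)"
    unfolding sandwich_def by (rule someI_ex)
  then show "additive (u, v) (sandwich (u, v) d e)"
    "sandwich (u, v) d e (Poly_Mapping.single w 1) = entry (u, v) (comp d (comp (word w) e))" by blast+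
qed

lemma additive_comp_left: "additive \<sigma> h \<Longrightarrow> additive \<sigma> (\<lambda>p. h (r * p))"
  by (simp add: additive_def hom_def distrib_left Pi_def)

lemma additive_comp_right: "additive \<sigma> h \<Longrightarrow> additive \<sigma> (\<lambda>p. h (p * r))"
  by (simp add: additive_def hom_def distrib_right Pi_def)

text \<open>This is an ideal because words can be absorbed by the surrounding elements.\<close>

definition vanishing :: "'x free_alg set" where
  "vanishing = {p. \<forall>u\<in>objs \<Sigma>. \<forall>v\<in>objs \<Sigma>. \<forall>d e. sorted_elt d \<longrightarrow> sorted_elt e \<longrightarrow>
     sandwich (u, v) d e p = null u v}"

context
  fixes u v :: 'o and d e :: "('o, 'm) elt"
  assumes uv: "u \<in> objs \<Sigma>" "v \<in> objs \<Sigma>" and de: "sorted_elt d" "sorted_elt e"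
begin

text \<open>Both sides are additive in \<open>p\<close>, and on a word they agree because the three
  elements may be bracketed either way.\<close>

lemma sandwich_word_left:
  "sandwich (u, v) d e (Poly_Mapping.single w 1 * p) = sandwich (u, v) (comp d (word w)) e p"
proof (rule additive_eqI[OF uv])
  show "additive (u, v) (\<lambda>p. sandwich (u, v) d e (Poly_Mapping.single w 1 * p))"
    by (rule additive_comp_left) (rule sandwich(1)[OF uv de])
  show "additive (u, v) (sandwich (u, v) (comp d (word w)) e)"
    by (rule sandwich(1)) (use uv de sorted_comp sorted_word in auto)
  show "sandwich (u, v) d e (Poly_Mapping.single w 1 * Poly_Mapping.single w' 1) =
      sandwich (u, v) (comp d (word w)) e (Poly_Mapping.single w' 1)" for w'
    using uv de by (simp add: mult_single sandwich(2) sorted_comp sorted_word word_add comp_assoc)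
qed

lemma sandwich_word_right:
  "sandwich (u, v) d e (p * Poly_Mapping.single w 1) = sandwich (u, v) d (comp (word w) e) p"
proof (rule additive_eqI[OF uv])
  show "additive (u, v) (\<lambda>p. sandwich (u, v) d e (p * Poly_Mapping.single w 1))"
    by (rule additive_comp_right) (rule sandwich(1)[OF uv de])
  show "additive (u, v) (sandwich (u, v) d (comp (word w) e))"
    by (rule sandwich(1)) (use uv de sorted_comp sorted_word in auto)
  show "sandwich (u, v) d e (Poly_Mapping.single w' 1 * Poly_Mapping.single w 1) =
      sandwich (u, v) d (comp (word w) e) (Poly_Mapping.single w' 1)" for w'
    using uv de by (simp add: mult_single sandwich(2) sorted_comp sorted_word word_add comp_assoc)
qed

lemma sandwich_diff: "sandwich (u, v) d e (p - q) =
    add u v (sandwich (u, v) d e p) (neg u v (sandwich (u, v) d e q))"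
  unfolding diff_conv_add_uminus
  by (simp only: additive_add[OF sandwich(1)[OF uv de]] additive_uminus[OF uv sandwich(1)[OF uv de]])

lemma sandwich_vanishing: "p \<in> vanishing \<Longrightarrow> sandwich (u, v) d e p = null u v"
  using uv de by (simp add: vanishing_def)

lemma additive_null: "additive (u, v) (\<lambda>p. null u v)"
  by (rule additiveI) (simp_all add: null_closed add_null uv)

text \<open>For fixed \<open>p\<close> the value is additive in \<open>r\<close>, so
  \<open>r\<close> may be taken to be a word. The word is then absorbed into \<open>d\<close> or
  \<open>e\<close>, and \<open>p\<close> vanishes between the enlarged surroundings too, as all
  sorted ones are allowed.\<close>

lemma sandwich_mult_vanishing:
  assumes "p \<in> vanishing"
  shows "sandwich (u, v) d e (r * p) = null u v" "sandwich (u, v) d e (p * r) = null u v"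
proof -
  have vanish: "sandwich (u, v) d' e' p = null u v" if "sorted_elt d'" "sorted_elt e'" for d' e'
    using assms that uv by (simp add: vanishing_def)
  show "sandwich (u, v) d e (r * p) = null u v"
  proof (rule additive_eqI[OF uv _ additive_null, where h = "\<lambda>r. sandwich (u, v) d e (r * p)"])
    show "additive (u, v) (\<lambda>r. sandwich (u, v) d e (r * p))"
      by (rule additive_comp_right) (rule sandwich(1)[OF uv de])
  qed (simp add: sandwich_word_left vanish de sorted_comp sorted_word)
  show "sandwich (u, v) d e (p * r) = null u v"
  proof (rule additive_eqI[OF uv _ additive_null, where h = "\<lambda>r. sandwich (u, v) d e (p * r)"])
    show "additive (u, v) (\<lambda>r. sandwich (u, v) d e (p * r))"
      by (rule additive_comp_left) (rule sandwich(1)[OF uv de])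
  qed (simp add: sandwich_word_right vanish de sorted_comp sorted_word)
qed

end

lemma two_sided_ideal_vanishing: "two_sided_ideal vanishing"
  unfolding two_sided_ideal_def
proof (intro conjI ballI allI)
  show "0 \<in> vanishing"
    by (auto simp: vanishing_def intro!: additive_zero sandwich(1))
  show "p - q \<in> vanishing" if "p \<in> vanishing" "q \<in> vanishing" for p q
  proof -
    have "sandwich (u, v) d e (p - q) = null u v"
      if "u \<in> objs \<Sigma>" "v \<in> objs \<Sigma>" "sorted_elt d" "sorted_elt e" for u v d e
      using that \<open>p \<in> vanishing\<close> \<open>q \<in> vanishing\<close>
      by (simp add: sandwich_diff sandwich_vanishing add_neg null_closed)
    then show ?thesis by (simp add: vanishing_def)
  qed
  show "r * p \<in> vanishing" "p * r \<in> vanishing" if "p \<in> vanishing" for p r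
    using sandwich_mult_vanishing[OF _ _ _ _ that] by (simp_all add: vanishing_def)
qed

text \<open>The polynomial has to behave like the element \<open>x\<close> in every surrounding, not
  just in isolation. A statement for \<open>d = e = Unit\<close> alone would not carry over to
  products, where each factor surrounds the other.\<close>

definition represents :: "'x free_alg \<Rightarrow> 'o \<Rightarrow> 'o \<Rightarrow> 'm \<Rightarrow> bool" where
  "represents p u v x \<longleftrightarrow> (\<forall>a\<in>objs \<Sigma>. \<forall>b\<in>objs \<Sigma>. \<forall>d e. sorted_elt d \<longrightarrow> sorted_elt e \<longrightarrow>
     sandwich (a, b) d e p = entry (a, b) (comp d (comp (El u v x) e)))"

text \<open>Distributivity on both sides; where the sorts do not match, all three entries are
  zero.\<close>

lemma entry_add:
  assumes "u \<in> objs \<Sigma>" "v \<in> objs \<Sigma>" "a \<in> objs \<Sigma>" "b \<in> objs \<Sigma>" "sorted_elt d" "sorted_elt e"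
    "x \<in> D (u, v)" "y \<in> D (u, v)"
  shows "entry (a, b) (comp d (comp (El u v (add u v x y)) e)) =
    add a b (entry (a, b) (comp d (comp (El u v x) e))) (entry (a, b) (comp d (comp (El u v y) e)))"
  using assms by (cases d; cases e) (auto simp: add_null null_closed closed mul_add add_mul)

text \<open>The axioms do not say how composition treats zero and negatives. Surrounding an element
  by \<open>d\<close> and \<open>e\<close> is additive, hence a group homomorphism, and thus
  preserves both.\<close>

lemma additive_on_null_neg:
  assumes "u \<in> objs \<Sigma>" "v \<in> objs \<Sigma>" "a \<in> objs \<Sigma>" "b \<in> objs \<Sigma>"
    "\<And>x. x \<in> D (u, v) \<Longrightarrow> h x \<in> D (a, b)"
    "\<And>x y. x \<in> D (u, v) \<Longrightarrow> y \<in> D (u, v) \<Longrightarrow> h (add u v x y) = add a b (h x) (h y)"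
  shows "h (null u v) = null a b" "x \<in> D (u, v) \<Longrightarrow> h (neg u v x) = neg a b (h x)"
proof -
  interpret G: comm_group "hom_group (u, v)" by (rule comm_group_hom_group[OF assms(1,2)])
  interpret H: comm_group "hom_group (a, b)" by (rule comm_group_hom_group[OF assms(3,4)])
  interpret group_hom "hom_group (u, v)" "hom_group (a, b)" h
    by unfold_locales (use assms(5,6) in \<open>auto simp: hom_def\<close>)
  show "h (null u v) = null a b" using hom_one by simp
  show "x \<in> D (u, v) \<Longrightarrow> h (neg u v x) = neg a b (h x)"
    using hom_inv[of x] assms by (simp add: inv_hom_group)
qed

lemma entry_closed_El:
  assumes "u \<in> objs \<Sigma>" "v \<in> objs \<Sigma>" "a \<in> objs \<Sigma>" "b \<in> objs \<Sigma>" "sorted_elt d" "sorted_elt e" "x \<in> D (u, v)"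
  shows "entry (a, b) (comp d (comp (El u v x) e)) \<in> D (a, b)"
  using assms by (intro entry_closed sorted_comp) (auto simp: sorts_def)

lemma represents_to_alg:
  assumes "wf_signature \<Sigma>" "has_sort \<Sigma> t a" "nonarith_funs_tm t = []" "vars_tm t = []"
  shows "represents (to_alg t) (fst a) (snd a) (eval \<I> \<beta> t)"
  using assms(2-4)
proof (induction rule: has_sort.induct)
  case (1 x)
  then show ?case by simp
next
  case (2 c)
  show ?case
  proof (cases c)
    case (Zero u v)
    then have uv: "u \<in> objs \<Sigma>" "v \<in> objs \<Sigma>" using 2(1) by (auto simp: all_consts_def)
    have "entry (a, b) (comp d (comp (El u v (null u v)) e)) = null a b"
      if "a \<in> objs \<Sigma>" "b \<in> objs \<Sigma>" "sorted_elt d" "sorted_elt e" for a b d e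
      using additive_on_null_neg(1)[OF uv that(1,2), of "\<lambda>x. entry (a, b) (comp d (comp (El u v x) e))"]
        entry_closed_El[OF uv that] entry_add[OF uv that] by simp
    then show ?thesis
      using Zero additive_zero[OF _ _ sandwich(1)] by (simp add: represents_def)
  next
    case (Con d)
    then have d: "d \<in> con_syms \<Sigma>" "con_sort \<Sigma> d \<in> sorts \<Sigma>"
      using 2(1) assms(1) by (auto simp: all_consts_def wf_signature_def)
    then have "word (Mon [d]) = El (fst (con_sort \<Sigma> d)) (snd (con_sort \<Sigma> d)) (con \<I> (Con d))"
      by (simp add: word_def letter_def)
    then show ?thesis using Con sandwich(2) by (simp add: represents_def indet_def)
  qed
next
  case (3 f ts)
  have arg: "represents (to_alg (ts ! i)) (fst (fst (func_sort \<Sigma> f) ! i)) (snd (fst (func_sort \<Sigma> f) ! i)) (eval \<I> \<beta> (ts ! i)) \<and>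
      (\<exists>\<beta>'. well_assigned \<Sigma> \<I> \<beta>' \<and> eval \<I> \<beta> (ts ! i) = eval \<I> \<beta>' (ts ! i)) \<and>
      eval \<I> \<beta> (ts ! i) \<in> D (fst (func_sort \<Sigma> f) ! i)" if "i < length ts" for i
  proof -
    have nv: "nonarith_funs_tm (ts ! i) = []" "vars_tm (ts ! i) = []"
      using 3(3,4) that by auto
    \<comment> \<open>The given \<beta> need not respect the sorts. The arguments are ground, so a
      well-sorted assignment gives the same values and shows that they lie in their domains.\<close>
    obtain \<beta>' where \<beta>': "well_assigned \<Sigma> \<I> \<beta>'" using ex_well_assigned[OF interp] by blast
    have eq: "eval \<I> \<beta> (ts ! i) = eval \<I> \<beta>' (ts ! i)" by (rule eval_cong) (simp add: nv)
    have "has_sort \<Sigma> (ts ! i) (fst (func_sort \<Sigma> f) ! i)"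
      using 3(2) that by (auto simp: list_all2_conv_all_nth)
    from eval_in_dom[OF this interp \<beta>'] \<beta>' eq 3(2) nv that show ?thesis
      by (auto simp: list_all2_conv_all_nth)
  qed
  have len: "length ts = length (fst (func_sort \<Sigma> f))" using 3(2) by (rule list_all2_lengthD)
  show ?case
  proof (cases f)
    case (Fun g)
    then show ?thesis using 3(3) by simp
  next
    case (Uminus u v)
    then obtain s where ts: "ts = [s]" using len by (auto simp: length_Suc_conv)
    have uv: "u \<in> objs \<Sigma>" "v \<in> objs \<Sigma>" using 3(1) Uminus by (auto simp: all_funs_def)
    have s: "represents (to_alg s) u v (eval \<I> \<beta> s)" "eval \<I> \<beta> s \<in> D (u, v)"
      using arg[of 0] Uminus ts by auto
    have "entry (a, b) (comp d (comp (El u v (neg u v (eval \<I> \<beta> s))) e)) =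
        neg a b (entry (a, b) (comp d (comp (El u v (eval \<I> \<beta> s)) e)))"
      if "a \<in> objs \<Sigma>" "b \<in> objs \<Sigma>" "sorted_elt d" "sorted_elt e" for a b d e
      using additive_on_null_neg(2)[OF uv that(1,2), of "\<lambda>x. entry (a, b) (comp d (comp (El u v x) e))"]
        entry_closed_El[OF uv that] entry_add[OF uv that] s(2) by simp
    then show ?thesis
      using s(1) Uminus ts additive_uminus[OF _ _ sandwich(1)] by (simp add: represents_def)
  next
    case (Plus u v)
    then obtain s t where ts: "ts = [s, t]" using len by (auto simp: length_Suc_conv)
    have uv: "u \<in> objs \<Sigma>" "v \<in> objs \<Sigma>" using 3(1) Plus by (auto simp: all_funs_def)
    have st: "represents (to_alg s) u v (eval \<I> \<beta> s)" "eval \<I> \<beta> s \<in> D (u, v)"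
      "represents (to_alg t) u v (eval \<I> \<beta> t)" "eval \<I> \<beta> t \<in> D (u, v)"
      using arg[of 0] arg[of 1] Plus ts by auto
    then show ?thesis
      using uv Plus ts additive_add[OF sandwich(1)] entry_add by (simp add: represents_def)
  next
    case (Times u v w)
    then obtain s t where ts: "ts = [s, t]" using len by (auto simp: length_Suc_conv)
    have uvw: "u \<in> objs \<Sigma>" "v \<in> objs \<Sigma>" "w \<in> objs \<Sigma>" using 3(1) Times by (auto simp: all_funs_def)
    let ?s = "El w v (eval \<I> \<beta> s)" and ?t = "El u w (eval \<I> \<beta> t)"
    have st: "represents (to_alg s) w v (eval \<I> \<beta> s)" "eval \<I> \<beta> s \<in> D (w, v)"
      "represents (to_alg t) u w (eval \<I> \<beta> t)" "eval \<I> \<beta> t \<in> D (u, w)"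
      using arg[of 0] arg[of 1] Times ts by auto
    then have sorted: "sorted_elt ?s" "sorted_elt ?t" using uvw by auto
    have "sandwich (a, b) d e (to_alg s * to_alg t) = entry (a, b) (comp d (comp (comp ?s ?t) e))"
      if "a \<in> objs \<Sigma>" "b \<in> objs \<Sigma>" "sorted_elt d" "sorted_elt e" for a b d e
    proof -
      \<comment> \<open>The right factor is absorbed into \<open>e\<close>: on a word in place of
        \<open>p\<close>, the word moves to the left surroundings and the hypothesis on
        \<open>t\<close> applies there. The left factor then stands alone between \<open>d\<close>
        and the enlarged \<open>e\<close>.\<close>
      have "sandwich (a, b) d e (p * to_alg t) = sandwich (a, b) d (comp ?t e) p" for p
      proof (rule additive_eqI[OF that(1,2)])
        show "additive (a, b) (\<lambda>p. sandwich (a, b) d e (p * to_alg t))"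
          by (rule additive_comp_right) (rule sandwich(1)[OF that])
        show "additive (a, b) (sandwich (a, b) d (comp ?t e))"
          by (rule sandwich(1)) (use that sorted sorted_comp in auto)
        show "sandwich (a, b) d e (Poly_Mapping.single w' 1 * to_alg t) =
            sandwich (a, b) d (comp ?t e) (Poly_Mapping.single w' 1)" for w'
          using that sorted st(3)
          by (simp add: sandwich_word_left sandwich(2) represents_def sorted_comp sorted_word comp_assoc
              del: comp.simps)
      qed
      then show ?thesis
        using that sorted st(1) by (simp add: represents_def sorted_comp comp_assoc del: comp.simps)
    qed
    then show ?thesis using Times ts by (simp add: represents_def)
  qed
qed

text \<open>Equal values have equal entries in all surroundings, and conversely the entry at the
  common sort of the terms, in empty surroundings, recovers the value.\<close>

lemma eval_eq_iff_vanishing: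
  assumes "wf_signature \<Sigma>" "has_sort \<Sigma> s a" "has_sort \<Sigma> t a" "nonarith_funs_tm s = []" "vars_tm s = []"
    "nonarith_funs_tm t = []" "vars_tm t = []"
  shows "eval \<I> \<beta> s = eval \<I> \<beta> t \<longleftrightarrow> to_alg s - to_alg t \<in> vanishing"
proof -
  obtain u v where a: "a = (u, v)" by fastforce
  have uv: "u \<in> objs \<Sigma>" "v \<in> objs \<Sigma>" using has_sort_sorts[OF assms(1,2)] by (auto simp: a sorts_def)
  have s: "represents (to_alg s) u v (eval \<I> \<beta> s)" and t: "represents (to_alg t) u v (eval \<I> \<beta> t)"
    using represents_to_alg[OF assms(1,2,4,5), of \<beta>] represents_to_alg[OF assms(1,3,6,7), of \<beta>] by (simp_all add: a)
  have diff: "sandwich (a, b) d e (to_alg s - to_alg t) = null a b \<longleftrightarrow>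
      sandwich (a, b) d e (to_alg s) = sandwich (a, b) d e (to_alg t)"
    if "a \<in> objs \<Sigma>" "b \<in> objs \<Sigma>" "sorted_elt d" "sorted_elt e" for a b d e
  proof -
    interpret G: comm_group "hom_group (a, b)" by (rule comm_group_hom_group[OF that(1,2)])
    let ?p = "sandwich (a, b) d e (to_alg s)" and ?q = "sandwich (a, b) d e (to_alg t)"
    have pq: "?p \<in> D (a, b)" "?q \<in> D (a, b)" using additive_closed[OF sandwich(1)[OF that]] by auto
    have "add a b ?p (neg a b ?q) = null a b \<longleftrightarrow> ?p = ?q"
    proof
      assume "add a b ?p (neg a b ?q) = null a b"
      then have "?p \<otimes>\<^bsub>hom_group (a, b)\<^esub> inv\<^bsub>hom_group (a, b)\<^esub> ?q = \<one>\<^bsub>hom_group (a, b)\<^esub>"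
        using pq that by (simp add: inv_hom_group)
      then have "?p = \<one>\<^bsub>hom_group (a, b)\<^esub> \<otimes>\<^bsub>hom_group (a, b)\<^esub> ?q"
        using G.inv_solve_right'[of "\<one>\<^bsub>hom_group (a, b)\<^esub>" ?p ?q] pq null_closed[OF that(1,2)] by simp
      then show "?p = ?q" using pq G.l_one[of ?q] by simp
    next
      assume "?p = ?q"
      then show "add a b ?p (neg a b ?q) = null a b" using add_neg[OF that(1,2) pq(2)] by simp
    qed
    then show ?thesis using sandwich_diff[OF that] by simp
  qed
  show ?thesis
  proof
    assume "eval \<I> \<beta> s = eval \<I> \<beta> t"
    then show "to_alg s - to_alg t \<in> vanishing"
      using s t diff by (simp add: vanishing_def represents_def)
  next
    assume "to_alg s - to_alg t \<in> vanishing"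
    \<comment> \<open>Between two formal identities, at sort \<open>(u, v)\<close>, the entry of a
      represented element is the element itself.\<close>
    then have "sandwich (u, v) Unit Unit (to_alg s) = sandwich (u, v) Unit Unit (to_alg t)"
      using uv diff by (simp add: vanishing_def)
    then show "eval \<I> \<beta> s = eval \<I> \<beta> t"
      using s t uv by (simp add: represents_def)
  qed
qed

text \<open>In a clause without a true literal every generator would lie in the ideal
  \<open>vanishing\<close>, and so would some candidate. That candidate's equation would be true
  after all.\<close>

lemma idealisation_sound:
  assumes "wf_signature \<Sigma>" "is_formula \<Sigma> \<psi>" "quantifier_free \<psi>"
    "\<And>t. t \<in> set (terms_fm \<psi>) \<Longrightarrow> nonarith_funs_tm t = [] \<and> vars_tm t = []" "idealisation \<psi>"
  shows "sat \<I> \<beta> \<psi>"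
  unfolding sat_cnf[OF assms(3)]
proof
  fix C assume C: "C \<in> set (cnf \<psi>)"
  have atom: "eval \<I> \<beta> s = eval \<I> \<beta> t \<longleftrightarrow> to_alg s - to_alg t \<in> vanishing" if st: "(s, t) \<in> atoms \<psi>" for s t
  proof -
    obtain a where "has_sort \<Sigma> s a" "has_sort \<Sigma> t a" using atoms_has_sort[OF assms(3,2) st] by blast
    moreover have "s \<in> set (terms_fm \<psi>)" "t \<in> set (terms_fm \<psi>)" using atoms_terms[OF st] by auto
    ultimately show ?thesis by (intro eval_eq_iff_vanishing[OF assms(1)]) (simp_all add: assms(4))
  qed
  show "\<exists>L\<in>set C. sat \<I> \<beta> L"
  proof (rule ccontr)
    assume false: "\<not> (\<exists>L\<in>set C. sat \<I> \<beta> L)"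
    have "set (generators C) \<subseteq> vanishing"
    proof
      fix g assume "g \<in> set (generators C)"
      then obtain s t where st: "Neg (Eq s t) \<in> set C" "g = to_alg s - to_alg t" by (auto simp: set_generators)
      have "(s, t) \<in> atoms \<psi>" by (rule cnf_literals[OF assms(3) C st(1)]) auto
      moreover have "eval \<I> \<beta> s = eval \<I> \<beta> t" using false st(1) by auto
      ultimately show "g \<in> vanishing" using atom st(2) by blast
    qed
    then have hull: "two_sided_ideal hull set (generators C) \<subseteq> vanishing"
      using two_sided_ideal_vanishing by (rule hull_minimal)
    obtain p where p: "p \<in> set (candidates C)" "p \<in> two_sided_ideal hull set (generators C)"
      using assms(5) C by (auto simp: idealisation_def)
    obtain s t where st: "Eq s t \<in> set C" "p = to_alg s - to_alg t" using p(1) by (auto simp: set_candidates)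
    have "(s, t) \<in> atoms \<psi>" by (rule cnf_literals[OF assms(3) C st(1)]) auto
    moreover have "p \<in> vanishing" using hull p(2) by blast
    ultimately have "eval \<I> \<beta> s = eval \<I> \<beta> t" using atom st(2) by blast
    then show False using false st(1) by auto
  qed
qed

end

section \<open>Completeness of idealisation\<close>

lemma two_sided_ideal_hull: "two_sided_ideal (two_sided_ideal hull S)"
  by (rule hull_in) (auto simp: two_sided_ideal_def)

context
  fixes J :: "'a::ring_1 set"
  assumes ideal: "two_sided_ideal J"
begin

lemma ideal_zero: "0 \<in> J" and ideal_diff: "a \<in> J \<Longrightarrow> b \<in> J \<Longrightarrow> a - b \<in> J"
  and ideal_mult: "a \<in> J \<Longrightarrow> r * a \<in> J" "a \<in> J \<Longrightarrow> a * r \<in> J"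
  using ideal by (auto simp: two_sided_ideal_def)

lemma ideal_uminus: "a \<in> J \<Longrightarrow> - a \<in> J"
  using ideal_diff[OF ideal_zero, of a] by simp

lemma ideal_add: "a \<in> J \<Longrightarrow> b \<in> J \<Longrightarrow> a + b \<in> J"
  using ideal_diff[OF _ ideal_uminus, of a b] by simp

text \<open>The quotient is realised inside the algebra itself, because the ideal varies and a type
  cannot depend on it. The choice is constant on a coset, since congruent \<open>p\<close> satisfy
  the same conditions on \<open>q\<close>.\<close>

definition representative :: "'a \<Rightarrow> 'a" where
  "representative p = (SOME q. p - q \<in> J)"

lemma representative: "p - representative p \<in> J"
  unfolding representative_def by (rule someI[of _ p]) (simp add: ideal_zero)

lemma representative_eq_iff: "representative p = representative q \<longleftrightarrow> p - q \<in> J"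
proof
  assume "representative p = representative q"
  then have "(p - representative p) - (q - representative q) \<in> J"
    by (intro ideal_diff representative)
  then show "p - q \<in> J" using \<open>representative p = representative q\<close> by simp
next
  assume pq: "p - q \<in> J"
  have "p - r \<in> J \<longleftrightarrow> q - r \<in> J" for r
  proof
    show "q - r \<in> J" if "p - r \<in> J" using ideal_diff[OF that pq] by simp
    show "p - r \<in> J" if "q - r \<in> J" using ideal_add[OF pq that] by simp
  qed
  then show "representative p = representative q" by (simp add: representative_def)
qed

lemma representative_add:
  "representative (representative p + q) = representative (p + q)"
  "representative (p + representative q) = representative (p + q)"
  using ideal_uminus[OF representative[of p]] ideal_uminus[OF representative[of q]]
  by (simp_all add: representative_eq_iff)

lemma representative_idem: "representative (representative p) = representative p"
  using representative_add(1)[of p 0] by simp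

lemma representative_mult:
  "representative (representative p * q) = representative (p * q)"
  "representative (p * representative q) = representative (p * q)"
  using ideal_uminus[OF ideal_mult(2)[OF representative[of p], of q]]
    ideal_uminus[OF ideal_mult(1)[OF representative[of q], of p]]
  by (simp_all add: representative_eq_iff algebra_simps)

lemma representative_uminus: "representative (- representative p) = representative (- p)"
  using representative[of p] by (simp add: representative_eq_iff)

end

text \<open>The quotient of the free algebra, seen as a semicategory with the same elements in every sort.\<close>

definition quotient_interp :: "'x free_alg set \<Rightarrow> ('o, 'x, 'f, 'x free_alg) interp" where
  "quotient_interp J = \<lparr> dom_set = (\<lambda>_. range (representative J)),
     con = (\<lambda>c. case c of Zero u v \<Rightarrow> representative J 0 | Con c \<Rightarrow> representative J (indet c)),
     fn = (\<lambda>f as. case f of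
         Uminus u v \<Rightarrow> representative J (- (as ! 0))
       | Plus u v \<Rightarrow> representative J (as ! 0 + as ! 1)
       | Times u v w \<Rightarrow> representative J (as ! 0 * as ! 1)
       | Fun f \<Rightarrow> representative J 0) \<rparr>"

lemma is_interp_quotient: "is_interp \<Sigma> (quotient_interp J)"
  by (auto simp: is_interp_def quotient_interp_def split: const_sym.splits fun_sym.splits)

lemma preadditive_quotient:
  assumes "two_sided_ideal J"
  shows "preadditive \<Sigma> (quotient_interp J)"
  unfolding preadditive_def preadditive_laws_def quotient_interp_def
  by (auto simp: representative_add[OF assms] representative_mult[OF assms] representative_uminus[OF assms]
      representative_idem[OF assms]       algebra_simps)

text \<open>The operations commute with passing to representatives, so a ground arithmetic term may
  be computed in the algebra and reduced only at the end.\<close>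

lemma eval_quotient:
  assumes "two_sided_ideal J" "has_sort \<Sigma> t a" "nonarith_funs_tm t = []" "vars_tm t = []"
  shows "eval (quotient_interp J) \<beta> t = representative J (to_alg t)"
  using assms(2-4)
proof (induction rule: has_sort.induct)
  case (2 c)
  then show ?case by (cases c) (simp_all add: quotient_interp_def)
next
  case (3 f ts)
  have arg: "eval (quotient_interp J) \<beta> (ts ! i) = representative J (to_alg (ts ! i))" if "i < length ts" for i
  proof -
    have "nonarith_funs_tm (ts ! i) = []" "vars_tm (ts ! i) = []"
      using 3(3,4) that by auto
    then show ?thesis using 3(2) that by (auto simp: list_all2_conv_all_nth)
  qed
  have len: "length ts = length (fst (func_sort \<Sigma> f))" using 3(2) by (rule list_all2_lengthD)
  show ?case
  proof (cases f)
    case (Fun g)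
    then show ?thesis using 3(3) by simp
  next
    case (Uminus u v)
    then obtain s where "ts = [s]" using len by (auto simp: length_Suc_conv)
    then show ?thesis
      using arg[of 0] Uminus by (simp add: quotient_interp_def representative_uminus[OF assms(1)])
  next
    case (Plus u v)
    then obtain s t where "ts = [s, t]" using len by (auto simp: length_Suc_conv)
    then show ?thesis
      using arg[of 0] arg[of 1] Plus by (simp add: quotient_interp_def representative_add[OF assms(1)])
  next
    case (Times u v w)
    then obtain s t where "ts = [s, t]" using len by (auto simp: length_Suc_conv)
    then show ?thesis
      using arg[of 0] arg[of 1] Times by (simp add: quotient_interp_def representative_mult[OF assms(1)])
  qed
qed simp

text \<open>In the quotient an equation holds iff the difference of its sides lies in
  \<open>J\<close>. The negative literals fail as \<open>J\<close> contains the generators, and the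
  positive ones as it contains no candidate.\<close>

lemma idealisation_complete:
  fixes \<psi> :: "('o, 'x, 'f) fm"
  assumes "is_formula \<Sigma> \<psi>" "quantifier_free \<psi>"
    "\<And>t. t \<in> set (terms_fm \<psi>) \<Longrightarrow> nonarith_funs_tm t = [] \<and> vars_tm t = []" "\<not> idealisation \<psi>"
  obtains \<I> :: "('o, 'x, 'f, 'x free_alg) interp" where
    "is_interp \<Sigma> \<I>" "preadditive \<Sigma> \<I>" "\<And>\<beta>. \<not> sat \<I> \<beta> \<psi>"
proof -
  obtain C where C: "C \<in> set (cnf \<psi>)"
    "\<And>p. p \<in> set (candidates C) \<Longrightarrow> p \<notin> two_sided_ideal hull set (generators C)"
    using assms(4) by (auto simp: idealisation_def)
  define J where "J = two_sided_ideal hull set (generators C)"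
  have J: "two_sided_ideal J" unfolding J_def by (rule two_sided_ideal_hull)
  let ?I = "quotient_interp J :: ('o, 'x, 'f, 'x free_alg) interp"
  have atom: "eval ?I \<beta> s = eval ?I \<beta> t \<longleftrightarrow> to_alg s - to_alg t \<in> J" if st: "(s, t) \<in> atoms \<psi>" for s t \<beta>
  proof -
    obtain a where a: "has_sort \<Sigma> s a" "has_sort \<Sigma> t a" using atoms_has_sort[OF assms(2,1) st] by blast
    have st': "s \<in> set (terms_fm \<psi>)" "t \<in> set (terms_fm \<psi>)" using atoms_terms[OF st] by auto
    have "eval ?I \<beta> s = representative J (to_alg s)" "eval ?I \<beta> t = representative J (to_alg t)"
      using assms(3)[OF st'(1)] assms(3)[OF st'(2)] by (auto intro: eval_quotient[OF J a(1)] eval_quotient[OF J a(2)])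
    then show ?thesis by (simp add: representative_eq_iff[OF J])
  qed
  have "\<not> sat ?I \<beta> \<psi>" for \<beta>
  proof
    assume "sat ?I \<beta> \<psi>"
    then obtain L where L: "L \<in> set C" "sat ?I \<beta> L" using C(1) unfolding sat_cnf[OF assms(2)] by blast
    obtain s t where st: "(s, t) \<in> atoms \<psi>" "L = Eq s t \<or> L = Neg (Eq s t)"
      by (rule cnf_literals[OF assms(2) C(1) L(1)])
    from st(2) show False
    proof
      assume L': "L = Eq s t"
      with L have "to_alg s - to_alg t \<in> J" using atom[OF st(1)] by simp
      moreover have "to_alg s - to_alg t \<in> set (candidates C)" using L(1) L' by (auto simp: set_candidates)
      ultimately show False using C(2) by (simp add: J_def)
    next
      assume L': "L = Neg (Eq s t)"
      with L have "to_alg s - to_alg t \<notin> J" using atom[OF st(1)] by simp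
      moreover have "to_alg s - to_alg t \<in> set (generators C)" using L(1) L' by (auto simp: set_generators)
      ultimately show False unfolding J_def by (simp add: hull_inc)
    qed
  qed
  then show thesis using that is_interp_quotient preadditive_quotient[OF J] by blast
qed

section \<open>Compactness\<close>

text \<open>Any sequence has a subsequence on which \<open>A k\<close> has a constant truth value,
  by the pigeonhole principle for infinite sets; a diagonal sequence handles all \<open>k\<close>
  together.\<close>

lemma diagonal_decide:
  fixes A :: "nat \<Rightarrow> nat \<Rightarrow> bool"
  shows "\<exists>r. strict_mono (r :: nat \<Rightarrow> nat) \<and>
    (\<forall>k. (\<forall>\<^sub>F n in sequentially. A k (r n)) \<or> (\<forall>\<^sub>F n in sequentially. \<not> A k (r n)))"
proof -
  \<comment> \<open>Constancy is inherited by subsequences, as the diagonal construction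
    demands.\<close>
  define P where "P k s \<longleftrightarrow> (\<forall>n. A k (s n)) \<or> (\<forall>n. \<not> A k (s n))" for k and s :: "nat \<Rightarrow> nat"
  interpret subseqs P
  proof
    fix k and s :: "nat \<Rightarrow> nat"
    have "{n. A k (s n)} \<union> {n. \<not> A k (s n)} = UNIV" by auto
    then have "infinite {n. A k (s n)} \<or> infinite {n. \<not> A k (s n)}"
      using infinite_UNIV_nat by (metis finite_Un)
    then obtain S where S: "infinite S" "S = {n. A k (s n)} \<or> S = {n. \<not> A k (s n)}" by blast
    obtain r :: "nat \<Rightarrow> nat" where "strict_mono r" "\<forall>n. r n \<in> S" using infinite_enumerate[OF S(1)] by blast
    with S(2) show "\<exists>r'. strict_mono r' \<and> P k (s \<circ> r')"
      by (intro exI[of _ r]) (auto simp: P_def)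
  qed
  have "(\<forall>\<^sub>F n in sequentially. A k (diagseq n)) \<or> (\<forall>\<^sub>F n in sequentially. \<not> A k (diagseq n))" for k
  proof -
    \<comment> \<open>The diagonal sequence is known to satisfy condition \<open>k\<close> only from
      index \<open>Suc k\<close> on, whence the shift and the eventual statement.\<close>
    have P: "P k (diagseq \<circ> ((+) (Suc k)))"
      by (rule diagseq_holds) (auto simp: P_def)
    have ev: "\<forall>\<^sub>F n in sequentially. Q (diagseq n)" if "\<forall>n. Q (diagseq (Suc k + n))" for Q
    proof (rule eventually_sequentiallyI)
      show "Q (diagseq n)" if "Suc k \<le> n" for n
        using \<open>\<forall>n. Q (diagseq (Suc k + n))\<close>[rule_format, of "n - Suc k"] that by simp
    qed
    show ?thesis using P ev[of "A k"] ev[of "\<lambda>n. \<not> A k n"] unfolding P_def o_def by blast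
  qed
  then show ?thesis using subseq_diagseq by blast
qed

instance const_sym :: (countable, countable) countable
  by countable_datatype

instance fun_sym :: (countable, countable) countable
  by countable_datatype

instance tm :: (countable, countable, countable) countable
  by countable_datatype

section \<open>Ground terms and the limit of a sequence of interpretations\<close>

definition ground_terms :: "('o, 'c, 'f) signature \<Rightarrow> 'o sort \<Rightarrow> ('o, 'c, 'f) tm set" where
  "ground_terms \<Sigma> a = {t. has_sort \<Sigma> t a \<and> vars_tm t = []}"

definition countable_signature :: "('o, 'c, 'f) signature \<Rightarrow> bool" where
  "countable_signature \<Sigma> \<longleftrightarrow> countable (objs \<Sigma>) \<and> countable (con_syms \<Sigma>) \<and> countable (fun_syms \<Sigma>)"

lemma has_sort_symbols:
  "has_sort \<Sigma> t a \<Longrightarrow> set1_tm t \<subseteq> objs \<Sigma> \<and> set2_tm t \<subseteq> con_syms \<Sigma> \<and> set3_tm t \<subseteq> fun_syms \<Sigma>"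
proof (induction rule: has_sort.induct)
  case (1 x)
  then show ?case by (cases x) (auto simp: sorts_def)
next
  case (2 c)
  then show ?case by (auto simp: all_consts_def)
next
  case (3 f ts)
  have "set1_tm t \<subseteq> objs \<Sigma> \<and> set2_tm t \<subseteq> con_syms \<Sigma> \<and> set3_tm t \<subseteq> fun_syms \<Sigma>" if "t \<in> set ts" for t
    using 3(2) that by (auto simp: list_all2_conv_all_nth in_set_conv_nth)
  then show ?case using 3(1) by (auto simp: all_funs_def)
qed

text \<open>Numbering the symbols is injective on the terms over the signature and maps them into
  terms over natural numbers, a countable type.\<close>

lemma countable_ground_terms:
  assumes "countable_signature \<Sigma>"
  shows "countable (\<Union>a. ground_terms \<Sigma> a)"
proof (rule countableI)
  let ?m = "map_tm (to_nat_on (objs \<Sigma>)) (to_nat_on (con_syms \<Sigma>)) (to_nat_on (fun_syms \<Sigma>))"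
  show "inj_on (to_nat \<circ> ?m) (\<Union>a. ground_terms \<Sigma> a)"
  proof (rule inj_onI)
    fix s t assume s: "s \<in> (\<Union>a. ground_terms \<Sigma> a)" and t: "t \<in> (\<Union>a. ground_terms \<Sigma> a)"
      and eq: "(to_nat \<circ> ?m) s = (to_nat \<circ> ?m) t"
    from s t have sym: "set1_tm s \<subseteq> objs \<Sigma>" "set2_tm s \<subseteq> con_syms \<Sigma>" "set3_tm s \<subseteq> fun_syms \<Sigma>"
      "set1_tm t \<subseteq> objs \<Sigma>" "set2_tm t \<subseteq> con_syms \<Sigma>" "set3_tm t \<subseteq> fun_syms \<Sigma>"
      using has_sort_symbols by (fastforce simp: ground_terms_def)+
    from eq have "?m s = ?m t" by simp
    then show "s = t"
      by (rule tm.inj_map_strong[rotated 3])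
        (use sym assms in \<open>auto simp: countable_signature_def subset_iff\<close>)
  qed
qed

definition ground_subst :: "('o, 'c, 'f) signature \<Rightarrow> ('o var \<Rightarrow> ('o, 'c, 'f) tm) \<Rightarrow> bool" where
  "ground_subst \<Sigma> \<tau> \<longleftrightarrow> (\<forall>x. snd x \<in> sorts \<Sigma> \<longrightarrow> \<tau> x \<in> ground_terms \<Sigma> (snd x))"

lemma ground_terms_subst:
  assumes "ground_subst \<Sigma> \<tau>" "has_sort \<Sigma> t a"
  shows "subst_tm \<tau> t \<in> ground_terms \<Sigma> a"
proof -
  have \<tau>: "has_sort \<Sigma> (\<tau> x) (snd x)" "vars_tm (\<tau> x) = []" if "snd x \<in> sorts \<Sigma>" for x
    using assms(1) that unfolding ground_subst_def ground_terms_def by blast+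
  have "has_sort \<Sigma> (subst_tm \<tau> t) a"
    by (rule has_sort_subst[OF assms(2)]) (rule \<tau>(1))
  moreover have "set (vars_tm (subst_tm \<tau> t)) = {}"
    unfolding vars_subst using \<tau>(2) has_sort_vars[OF assms(2)] by auto
  ultimately show ?thesis by (simp add: ground_terms_def)
qed

text \<open>A countable limit of the \<open>\<I> n\<close>: ground terms are identified when their
  values agree eventually along a subsequence that decides all ground equations. A quantifier-free
  formula whose ground instances hold eventually is then true in the limit, and countability lets
  the limit live in any infinite type.\<close>

lemma term_model:
  fixes \<I> :: "nat \<Rightarrow> ('o, 'c, 'f, 'd) interp" and \<beta>0 :: "'o var \<Rightarrow> 'd"
  assumes wf: "wf_signature \<Sigma>" and cnt: "countable_signature \<Sigma>" and inf: "infinite (UNIV :: 'm set)"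
  obtains \<J> :: "('o, 'c, 'f, 'm) interp" where "is_interp \<Sigma> \<J>"
    "\<And>\<phi> \<beta>. quantifier_free \<phi> \<Longrightarrow> is_formula \<Sigma> \<phi> \<Longrightarrow>
       (\<And>\<tau>. ground_subst \<Sigma> \<tau> \<Longrightarrow>
         \<forall>\<^sub>F n in sequentially. sat (\<I> n) \<beta>0 (map_terms (subst_tm \<tau>) \<phi>)) \<Longrightarrow>
       well_assigned \<Sigma> \<J> \<beta> \<Longrightarrow> sat \<J> \<beta> \<phi>"
proof -
  define T where "T = (\<Union>a. ground_terms \<Sigma> a)"
  have T: "countable T" unfolding T_def by (rule countable_ground_terms[OF cnt])
  \<comment> \<open>The enumeration runs over all pairs of ground terms, so that deciding every
    \<open>A k\<close> decides every ground equation.\<close>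
  define A where "A = (\<lambda>k n. case from_nat_into (T \<times> T) k of (s, t) \<Rightarrow> eval (\<I> n) \<beta>0 s = eval (\<I> n) \<beta>0 t)"
  obtain r :: "nat \<Rightarrow> nat" where r: "strict_mono r"
    "\<And>k. (\<forall>\<^sub>F n in sequentially. A k (r n)) \<or> (\<forall>\<^sub>F n in sequentially. \<not> A k (r n))"
    using diagonal_decide[of A] by blast
  define E where "E s t \<longleftrightarrow> (\<forall>\<^sub>F n in sequentially. eval (\<I> (r n)) \<beta>0 s = eval (\<I> (r n)) \<beta>0 t)" for s t
  have E_refl: "E t t" for t by (simp add: E_def)
  have E_sym: "E s t \<Longrightarrow> E t s" for s t by (simp add: E_def eq_commute)
  have E_trans: "E s t \<Longrightarrow> E t t' \<Longrightarrow> E s t'" for s t t'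
    unfolding E_def by (erule (1) eventually_elim2) simp
  \<comment> \<open>There are finitely many arguments, so the equations between them hold together
    from some index on.\<close>
  have E_App: "E (App f ss) (App f ts)" if "length ss = length ts" "\<And>i. i < length ts \<Longrightarrow> E (ss ! i) (ts ! i)" for f ss ts
  proof -
    have "\<forall>\<^sub>F n in sequentially. \<forall>i\<in>{..<length ts}. eval (\<I> (r n)) \<beta>0 (ss ! i) = eval (\<I> (r n)) \<beta>0 (ts ! i)"
      by (rule eventually_ball_finite) (use that in \<open>auto simp: E_def\<close>)
    then show ?thesis
      unfolding E_def
    proof (rule eventually_mono)
      fix n assume "\<forall>i\<in>{..<length ts}. eval (\<I> (r n)) \<beta>0 (ss ! i) = eval (\<I> (r n)) \<beta>0 (ts ! i)"
      then have "map (eval (\<I> (r n)) \<beta>0) ss = map (eval (\<I> (r n)) \<beta>0) ts"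
        using that(1) by (auto intro: nth_equalityI)
      then show "eval (\<I> (r n)) \<beta>0 (App f ss) = eval (\<I> (r n)) \<beta>0 (App f ts)"
        by (simp del: map_eq_conv)
    qed
  qed
  \<comment> \<open>The choice of the subsequence enters here: an equation that does not hold
    eventually must fail eventually.\<close>
  have not_E: "\<forall>\<^sub>F n in sequentially. eval (\<I> (r n)) \<beta>0 s \<noteq> eval (\<I> (r n)) \<beta>0 t"
    if st: "s \<in> T" "t \<in> T" "\<not> E s t" for s t
  proof -
    have "countable (T \<times> T)" using T by auto
    then obtain k where "from_nat_into (T \<times> T) k = (s, t)"
      using from_nat_into_surj[of "T \<times> T" "(s, t)"] st(1,2) by auto
    then show ?thesis using r(2)[of k] st(3) by (simp add: A_def E_def)
  qed
  obtain e :: "nat \<Rightarrow> 'm" where e: "inj e" using infinite_countable_subset[OF inf] by blast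
  \<comment> \<open>The code in \<open>'m\<close> of the class of \<open>t\<close>: a chosen member
    of the class is numbered, and the number is injected by \<open>e\<close>.\<close>
  define \<rho> where "\<rho> t = e (to_nat_on T (SOME s. s \<in> T \<and> E s t))" for t
  have \<rho>_cong: "\<rho> s = \<rho> t" if "E s t" for s t
  proof -
    have "(\<lambda>s'. s' \<in> T \<and> E s' s) = (\<lambda>s'. s' \<in> T \<and> E s' t)"
      using that E_sym E_trans by blast
    then show ?thesis by (simp add: \<rho>_def)
  qed
  have \<rho>_inj: "E s t" if "s \<in> T" "t \<in> T" "\<rho> s = \<rho> t" for s t
  proof -
    define c where "c t = (SOME s. s \<in> T \<and> E s t)" for t
    have c: "c t \<in> T \<and> E (c t) t" if "t \<in> T" for t
      unfolding c_def by (rule someI[of _ t]) (use that E_refl in auto)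
    have "to_nat_on T (c s) = to_nat_on T (c t)"
      using that(3) e by (simp add: \<rho>_def c_def inj_eq)
    then have "c s = c t" using c that T by simp
    then show ?thesis using c[OF that(1)] c[OF that(2)] E_sym E_trans by metis
  qed
  \<comment> \<open>Decoding: function symbols act on chosen terms with the given codes, and
    \<open>E_App\<close> makes the result independent of the choice.\<close>
  define \<delta> where "\<delta> a = (SOME t. t \<in> T \<and> \<rho> t = a)" for a
  have \<delta>: "E (\<delta> (\<rho> t)) t" if "t \<in> T" for t
  proof -
    have "\<delta> (\<rho> t) \<in> T \<and> \<rho> (\<delta> (\<rho> t)) = \<rho> t"
      unfolding \<delta>_def by (rule someI[of _ t]) (use that in auto)
    with that show ?thesis using \<rho>_inj by blast
  qed
  define \<J> :: "('o, 'c, 'f, 'm) interp" where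
    "\<J> = \<lparr> dom_set = (\<lambda>a. \<rho> ` ground_terms \<Sigma> a), con = (\<lambda>c. \<rho> (Const c)),
       fn = (\<lambda>f as. \<rho> (App f (map \<delta> as))) \<rparr>"
  have fn_J: "fn \<J> f (map \<rho> ts) = \<rho> (App f ts)" if "set ts \<subseteq> T" for f ts
  proof -
    have "E (App f (map \<delta> (map \<rho> ts))) (App f ts)"
    proof (rule E_App)
      show "E (map \<delta> (map \<rho> ts) ! i) (ts ! i)" if "i < length ts" for i
        using \<delta>[OF subsetD[OF \<open>set ts \<subseteq> T\<close> nth_mem[OF that]]] that by simp
    qed simp
    then show ?thesis using \<rho>_cong by (simp add: \<J>_def)
  qed
  have interp: "is_interp \<Sigma> \<J>"
    unfolding is_interp_def
  proof (intro conjI ballI allI impI)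
    fix a assume "a \<in> sorts \<Sigma>"
    \<comment> \<open>The zero constants provide a ground term of every sort, so no domain is
      empty.\<close>
    then have "Zero (fst a) (snd a) \<in> all_consts \<Sigma>" by (auto simp: sorts_def all_consts_def)
    from has_sort.intros(2)[OF this] have "Const (Zero (fst a) (snd a)) \<in> ground_terms \<Sigma> a"
      by (simp add: ground_terms_def)
    then show "dom_set \<J> a \<noteq> {}" by (auto simp: \<J>_def)
  next
    fix c assume "c \<in> all_consts \<Sigma>"
    from has_sort.intros(2)[OF this] show "con \<J> c \<in> dom_set \<J> (const_sort \<Sigma> c)"
      by (auto simp: \<J>_def ground_terms_def)
  next
    fix f as assume f: "f \<in> all_funs \<Sigma>" and as: "list_all2 (\<lambda>a s. a \<in> dom_set \<J> s) as (fst (func_sort \<Sigma> f))"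
    have "\<exists>t. t \<in> ground_terms \<Sigma> (fst (func_sort \<Sigma> f) ! i) \<and> as ! i = \<rho> t" if "i < length as" for i
      using as that by (auto simp: list_all2_conv_all_nth \<J>_def)
    then obtain g where g: "\<And>i. i < length as \<Longrightarrow> g i \<in> ground_terms \<Sigma> (fst (func_sort \<Sigma> f) ! i) \<and> as ! i = \<rho> (g i)"
      by metis
    define ts where "ts = map g [0..<length as]"
    have as_eq: "as = map \<rho> ts" by (rule nth_equalityI) (simp_all add: ts_def g)
    have "list_all2 (has_sort \<Sigma>) ts (fst (func_sort \<Sigma> f))"
      using g list_all2_lengthD[OF as] by (auto simp: list_all2_conv_all_nth ts_def ground_terms_def)
    from has_sort.intros(3)[OF f this] have "App f ts \<in> ground_terms \<Sigma> (snd (func_sort \<Sigma> f))"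
      using g by (auto simp: ground_terms_def ts_def)
    moreover have "set ts \<subseteq> T"
    proof
      fix t assume "t \<in> set ts"
      then obtain i where "i < length as" "t = g i" by (auto simp: ts_def)
      with g show "t \<in> T" unfolding T_def by blast
    qed
    ultimately show "fn \<J> f as \<in> dom_set \<J> (snd (func_sort \<Sigma> f))"
      unfolding as_eq fn_J[OF \<open>set ts \<subseteq> T\<close>] by (simp add: \<J>_def)
  qed
  have eval_J: "eval \<J> (\<rho> \<circ> \<tau>) t = \<rho> (subst_tm \<tau> t)" if \<tau>: "ground_subst \<Sigma> \<tau>" and t: "has_sort \<Sigma> t a" for \<tau> t a
    using t
  proof (induction rule: has_sort.induct)
    case (2 c)
    then show ?case by (simp add: \<J>_def)
  next
    case (3 f ts)
    have sub: "eval \<J> (\<rho> \<circ> \<tau>) s = \<rho> (subst_tm \<tau> s) \<and> subst_tm \<tau> s \<in> T" if "s \<in> set ts" for s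
    proof -
      obtain i where "i < length ts" "s = ts ! i" using \<open>s \<in> set ts\<close> by (metis in_set_conv_nth)
      with 3(2) have s: "has_sort \<Sigma> s (fst (func_sort \<Sigma> f) ! i)" "eval \<J> (\<rho> \<circ> \<tau>) s = \<rho> (subst_tm \<tau> s)"
        unfolding list_all2_conv_all_nth by blast+
      from ground_terms_subst[OF \<tau> s(1)] have "subst_tm \<tau> s \<in> T" unfolding T_def by blast
      with s(2) show ?thesis ..
    qed
    then have "map (eval \<J> (\<rho> \<circ> \<tau>)) ts = map \<rho> (map (subst_tm \<tau>) ts)" by simp
    moreover have "set (map (subst_tm \<tau>) ts) \<subseteq> T" using sub by auto
    ultimately show ?case using fn_J unfolding eval.simps(3) subst_tm.simps(3) by metis
  qed simp
  \<comment> \<open>Truth and falsity in the limit are treated together, because negation exchanges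
    the two implications.\<close>
  have sat_J: "(sat \<J> b \<phi> \<longrightarrow> (\<forall>\<^sub>F n in sequentially. sat (\<I> (r n)) \<beta>0 (map_terms (subst_tm \<tau>) \<phi>))) \<and>
      (\<not> sat \<J> b \<phi> \<longrightarrow> (\<forall>\<^sub>F n in sequentially. \<not> sat (\<I> (r n)) \<beta>0 (map_terms (subst_tm \<tau>) \<phi>)))"
    if \<tau>: "ground_subst \<Sigma> \<tau>" and b: "b = \<rho> \<circ> \<tau>" and "quantifier_free \<phi>" "is_formula \<Sigma> \<phi>" for \<tau> \<phi> b
    using that(3,4)
  proof (induction \<phi>)
    case (Eq s t)
    then obtain a where a: "has_sort \<Sigma> s a" "has_sort \<Sigma> t a" by auto
    then have T: "subst_tm \<tau> s \<in> T" "subst_tm \<tau> t \<in> T"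
      unfolding T_def using ground_terms_subst[OF \<tau>] by blast+
    have "sat \<J> b (Eq s t) \<longleftrightarrow> E (subst_tm \<tau> s) (subst_tm \<tau> t)"
      unfolding sat.simps b eval_J[OF \<tau> a(1)] eval_J[OF \<tau> a(2)] using \<rho>_inj[OF T] \<rho>_cong by blast
    then show ?case
      using not_E[OF T] unfolding map_terms.simps sat.simps(1) E_def by blast
  next
    case (Neg \<phi>)
    then show ?case by auto
  next
    case (Or \<phi> \<psi>)
    then show ?case by (auto elim: eventually_mono eventually_elim2)
  next
    case (And \<phi> \<psi>)
    then show ?case by (auto elim: eventually_mono eventually_elim2)
  next
    case (Imp \<phi> \<psi>)
    then show ?case by (auto elim: eventually_mono eventually_elim2)
  qed auto
  have "sat \<J> \<beta> \<phi>" if qf: "quantifier_free \<phi>" and fm: "is_formula \<Sigma> \<phi>" and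
    ev: "\<And>\<tau>. ground_subst \<Sigma> \<tau> \<Longrightarrow> \<forall>\<^sub>F n in sequentially. sat (\<I> n) \<beta>0 (map_terms (subst_tm \<tau>) \<phi>)"
    and \<beta>: "well_assigned \<Sigma> \<J> \<beta>" for \<phi> \<beta>
  proof -
    \<comment> \<open>Every element of a domain is the code of a ground term, so on the relevant
      variables a well-sorted assignment comes from a ground substitution.\<close>
    have "\<exists>t. snd x \<in> sorts \<Sigma> \<longrightarrow> t \<in> ground_terms \<Sigma> (snd x) \<and> \<beta> x = \<rho> t" for x
    proof (cases "snd x \<in> sorts \<Sigma>")
      case True
      then have "\<beta> x \<in> \<rho> ` ground_terms \<Sigma> (snd x)"
        using \<beta> unfolding well_assigned_def \<J>_def by simp
      then show ?thesis by blast
    qed simp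
    then obtain \<tau> where \<tau>: "\<And>x. snd x \<in> sorts \<Sigma> \<Longrightarrow> \<tau> x \<in> ground_terms \<Sigma> (snd x) \<and> \<beta> x = \<rho> (\<tau> x)"
      by metis
    then have gs: "ground_subst \<Sigma> \<tau>" unfolding ground_subst_def by blast
    have "\<forall>\<^sub>F n in sequentially. sat (\<I> (r n)) \<beta>0 (map_terms (subst_tm \<tau>) \<phi>)"
      by (rule eventually_subseq[OF r(1) ev[OF gs]])
    then have "sat \<J> (\<rho> \<circ> \<tau>) \<phi>"
      \<comment> \<open>Were the formula false in the limit, its instance would eventually be both
        true and false.\<close>
      using sat_J[OF gs refl qf fm] eventually_happens'[OF sequentially_bot eventually_conj] by blast
    moreover have "sat \<J> \<beta> \<phi> \<longleftrightarrow> sat \<J> (\<rho> \<circ> \<tau>) \<phi>"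
      by (rule sat_cong) (use \<tau> free_vars_sorts[OF fm] in \<open>simp add: split_paired_all\<close>)
    ultimately show ?thesis by simp
  qed
  with interp show thesis by (rule that)
qed

section \<open>Restriction to a countable signature\<close>

definition sub_signature :: "('o, 'c, 'f) signature \<Rightarrow> ('o, 'c, 'f) signature \<Rightarrow> bool" where
  "sub_signature \<Sigma>' \<Sigma> \<longleftrightarrow> objs \<Sigma>' \<subseteq> objs \<Sigma> \<and> con_syms \<Sigma>' \<subseteq> con_syms \<Sigma> \<and> fun_syms \<Sigma>' \<subseteq> fun_syms \<Sigma> \<and>
     con_sort \<Sigma>' = con_sort \<Sigma> \<and> fun_sort \<Sigma>' = fun_sort \<Sigma>"

lemma sub_signature_consts: "sub_signature \<Sigma>' \<Sigma> \<Longrightarrow> c \<in> all_consts \<Sigma>' \<Longrightarrow> c \<in> all_consts \<Sigma> \<and> const_sort \<Sigma>' c = const_sort \<Sigma> c"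
  by (cases c) (auto simp: sub_signature_def all_consts_def)

lemma sub_signature_funs: "sub_signature \<Sigma>' \<Sigma> \<Longrightarrow> f \<in> all_funs \<Sigma>' \<Longrightarrow> f \<in> all_funs \<Sigma> \<and> func_sort \<Sigma>' f = func_sort \<Sigma> f"
  by (cases f) (auto simp: sub_signature_def all_funs_def)

lemma sub_signature_sorts: "sub_signature \<Sigma>' \<Sigma> \<Longrightarrow> sorts \<Sigma>' \<subseteq> sorts \<Sigma>"
  by (auto simp: sub_signature_def sorts_def)

lemma sub_signature_has_sort:
  assumes "sub_signature \<Sigma>' \<Sigma>" "has_sort \<Sigma>' t a"
  shows "has_sort \<Sigma> t a"
  using assms(2)
proof (induction rule: has_sort.induct)
  case (1 x)
  then show ?case using sub_signature_sorts[OF assms(1)] by (auto intro: has_sort.intros(1))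
next
  case (2 c)
  then show ?case using sub_signature_consts[OF assms(1) 2] has_sort.intros(2)[of c \<Sigma>] by simp
next
  case (3 f ts)
  have "list_all2 (has_sort \<Sigma>) ts (fst (func_sort \<Sigma> f))"
    using 3(2) sub_signature_funs[OF assms(1) 3(1)] by (auto simp: list_all2_conv_all_nth)
  then show ?case using sub_signature_funs[OF assms(1) 3(1)] has_sort.intros(3)[of f \<Sigma> ts] by simp
qed

lemma sub_signature_is_interp:
  assumes "sub_signature \<Sigma>' \<Sigma>" "is_interp \<Sigma> \<I>"
  shows "is_interp \<Sigma>' \<I>"
  unfolding is_interp_def
proof (intro conjI ballI allI impI)
  fix s assume "s \<in> sorts \<Sigma>'"
  then show "dom_set \<I> s \<noteq> {}" using assms sub_signature_sorts by (auto simp: is_interp_def)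
next
  fix c assume "c \<in> all_consts \<Sigma>'"
  then show "con \<I> c \<in> dom_set \<I> (const_sort \<Sigma>' c)"
    using assms(2) sub_signature_consts[OF assms(1)] by (simp add: is_interp_def)
next
  fix f as assume "f \<in> all_funs \<Sigma>'" "list_all2 (\<lambda>a s. a \<in> dom_set \<I> s) as (fst (func_sort \<Sigma>' f))"
  then show "fn \<I> f as \<in> dom_set \<I> (snd (func_sort \<Sigma>' f))"
    using assms(2) sub_signature_funs[OF assms(1)] by (simp add: is_interp_def)
qed

lemma sub_signature_preadditive: "sub_signature \<Sigma>' \<Sigma> \<Longrightarrow> preadditive \<Sigma> \<I> \<Longrightarrow> preadditive \<Sigma>' \<I>"
  unfolding preadditive_def sub_signature_def by (blast dest: subsetD)

lemma sub_signature_herbrand_sig: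
  "sub_signature \<Sigma>' \<Sigma> \<Longrightarrow> sub_signature (herbrand_sig \<Sigma>' \<phi>) (herbrand_sig \<Sigma> \<phi>)"
  by (auto simp: sub_signature_def herbrand_sig_def Let_def)

lemma restrict_has_sort:
  assumes "has_sort \<Sigma> t a" "set1_tm t \<subseteq> objs \<Sigma>'" "set2_tm t \<subseteq> con_syms \<Sigma>'" "set3_tm t \<subseteq> fun_syms \<Sigma>'"
    "con_sort \<Sigma>' = con_sort \<Sigma>" "fun_sort \<Sigma>' = fun_sort \<Sigma>"
  shows "has_sort \<Sigma>' t a"
  using assms(1-4)
proof (induction rule: has_sort.induct)
  case (1 x)
  then show ?case using has_sort.intros(1)[of x \<Sigma>'] by (cases x) (auto simp: sorts_def)
next
  case (2 c)
  have "const_sort \<Sigma>' c = const_sort \<Sigma> c" by (cases c) (simp_all add: assms(5))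
  moreover have "c \<in> all_consts \<Sigma>'" using 2 by (cases c) (auto simp: all_consts_def)
  ultimately show ?case using has_sort.intros(2)[of c \<Sigma>'] by simp
next
  case (3 f ts)
  have sort: "func_sort \<Sigma>' f = func_sort \<Sigma> f" by (cases f) (simp_all add: assms(6))
  have "has_sort \<Sigma>' (ts ! i) (fst (func_sort \<Sigma> f) ! i)" if i: "i < length ts" for i
  proof -
    have "ts ! i \<in> set ts" using i by simp
    then have "set1_tm (ts ! i) \<subseteq> objs \<Sigma>'" "set2_tm (ts ! i) \<subseteq> con_syms \<Sigma>'" "set3_tm (ts ! i) \<subseteq> fun_syms \<Sigma>'"
      using 3(3-5) by auto
    then show ?thesis using 3(2) i by (simp add: list_all2_conv_all_nth)
  qed
  then have "list_all2 (has_sort \<Sigma>') ts (fst (func_sort \<Sigma>' f))"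
    using 3(2) by (simp add: sort list_all2_conv_all_nth)
  moreover have "f \<in> all_funs \<Sigma>'" using 3(1,3,5) by (cases f) (auto simp: all_funs_def)
  ultimately show ?case using has_sort.intros(3)[of f \<Sigma>'] sort by simp
qed

lemma restrict_is_formula:
  assumes "is_formula \<Sigma> \<phi>" "set1_fm \<phi> \<subseteq> objs \<Sigma>'" "set2_fm \<phi> \<subseteq> con_syms \<Sigma>'" "set3_fm \<phi> \<subseteq> fun_syms \<Sigma>'"
    "con_sort \<Sigma>' = con_sort \<Sigma>" "fun_sort \<Sigma>' = fun_sort \<Sigma>"
  shows "is_formula \<Sigma>' \<phi>"
  using assms(1-4)
proof (induction \<phi>)
  case (Eq s t)
  then obtain a where "has_sort \<Sigma> s a" "has_sort \<Sigma> t a" by auto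
  then have "has_sort \<Sigma>' s a" "has_sort \<Sigma>' t a"
    using Eq.prems(2-4) by (auto intro!: restrict_has_sort[OF _ _ _ _ assms(5,6)])
  then show ?case by auto
next
  case (Ex x \<phi>)
  then show ?case by (cases x) (auto simp: sorts_def)
next
  case (All x \<phi>)
  then show ?case by (cases x) (auto simp: sorts_def)
qed auto

lemma is_formula_symbols:
  "is_formula \<Sigma> \<phi> \<Longrightarrow> set1_fm \<phi> \<subseteq> objs \<Sigma> \<and> set2_fm \<phi> \<subseteq> con_syms \<Sigma> \<and> set3_fm \<phi> \<subseteq> fun_syms \<Sigma>"
proof (induction \<phi>)
  case (Eq s t)
  then show ?case using has_sort_symbols by fastforce
next
  case (Ex x \<phi>)
  then show ?case by (cases x) (auto simp: sorts_def)
next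
  case (All x \<phi>)
  then show ?case by (cases x) (auto simp: sorts_def)
qed auto

lemma finite_symbols_tm: "finite (set1_tm t) \<and> finite (set2_tm t) \<and> finite (set3_tm t)"
proof (induction t)
  case (Var x)
  then show ?case by (cases x) auto
next
  case (Const c)
  then show ?case by (cases c) auto
next
  case (App f ts)
  then show ?case by (cases f) auto
qed

lemma finite_symbols_fm: "finite (set1_fm \<phi>) \<and> finite (set2_fm \<phi>) \<and> finite (set3_fm \<phi>)"
proof (induction \<phi>)
  case (Ex x \<phi>)
  then show ?case by (cases x) auto
next
  case (All x \<phi>)
  then show ?case by (cases x) auto
qed (auto simp: finite_symbols_tm)

text \<open>A formula has finitely many symbols, and adding the objects in the sorts of these
  symbols makes the subsignature well-formed while keeping it finite apart from nothing but its
  derived arithmetic symbols, which are finitely many as well.\<close>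

lemma ex_countable_sub_signature:
  assumes "wf_signature \<Sigma>" "is_formula \<Sigma> \<phi>"
  obtains \<Sigma>' where "sub_signature \<Sigma>' \<Sigma>" "wf_signature \<Sigma>'" "is_formula \<Sigma>' \<phi>" "countable_signature \<Sigma>'" "objs \<Sigma>' \<noteq> {}"
proof -
  note sym = is_formula_symbols[OF assms(2)] and fin = finite_symbols_fm[of \<phi>]
  define ends :: "'a \<times> 'a \<Rightarrow> 'a set" where "ends = (\<lambda>a. {fst a, snd a})"
  define O' where "O' = set1_fm \<phi> \<union> (\<Union>c\<in>set2_fm \<phi>. ends (con_sort \<Sigma> c)) \<union>
    (\<Union>f\<in>set3_fm \<phi>. ends (snd (fun_sort \<Sigma> f)) \<union> (\<Union>a\<in>set (fst (fun_sort \<Sigma> f)). ends a))"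
  define \<Sigma>' :: "('a, 'b, 'c) signature" where "\<Sigma>' = \<lparr> objs = O', con_syms = set2_fm \<phi>, fun_syms = set3_fm \<phi>,
    con_sort = con_sort \<Sigma>, fun_sort = fun_sort \<Sigma> \<rparr>"
  have sort: "ends a \<subseteq> S \<longleftrightarrow> a \<in> S \<times> S" for a and S :: "'a set" by (auto simp: ends_def mem_Times_iff)
  have "O' \<subseteq> objs \<Sigma>"
  proof -
    have "ends (con_sort \<Sigma> c) \<subseteq> objs \<Sigma>" if "c \<in> set2_fm \<phi>" for c
      unfolding sort using that sym assms(1) by (auto simp: wf_signature_def sorts_def)
    moreover have "ends (snd (fun_sort \<Sigma> f)) \<subseteq> objs \<Sigma>" if "f \<in> set3_fm \<phi>" for f
      unfolding sort using that sym assms(1) by (auto simp: wf_signature_def sorts_def)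
    moreover have "ends a \<subseteq> objs \<Sigma>" if "f \<in> set3_fm \<phi>" "a \<in> set (fst (fun_sort \<Sigma> f))" for f a
      unfolding sort using that sym assms(1) by (auto simp: wf_signature_def sorts_def)
    moreover have "set1_fm \<phi> \<subseteq> objs \<Sigma>" using sym by blast
    ultimately show ?thesis unfolding O'_def by (simp only: Un_least UN_least)
  qed
  then have sub: "sub_signature \<Sigma>' \<Sigma>" using sym by (simp add: sub_signature_def \<Sigma>'_def)
  have wf: "wf_signature \<Sigma>'"
  proof -
    have c: "con_sort \<Sigma> c \<in> O' \<times> O'" if "c \<in> set2_fm \<phi>" for c
      unfolding sort[symmetric] using that unfolding O'_def by blast
    have f: "set (fst (fun_sort \<Sigma> f)) \<subseteq> O' \<times> O' \<and> snd (fun_sort \<Sigma> f) \<in> O' \<times> O'" if "f \<in> set3_fm \<phi>" for f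
    proof (intro conjI subsetI)
      show "a \<in> O' \<times> O'" if "a \<in> set (fst (fun_sort \<Sigma> f))" for a
        unfolding sort[symmetric] using that \<open>f \<in> set3_fm \<phi>\<close> unfolding O'_def by blast
      show "snd (fun_sort \<Sigma> f) \<in> O' \<times> O'"
        unfolding sort[symmetric] using \<open>f \<in> set3_fm \<phi>\<close> unfolding O'_def by blast
    qed
    show ?thesis using c f by (simp add: wf_signature_def sorts_def \<Sigma>'_def)
  qed
  have fm: "is_formula \<Sigma>' \<phi>"
    by (rule restrict_is_formula[OF assms(2)]) (auto simp: \<Sigma>'_def O'_def)
  have "finite (ends a)" for a by (simp add: ends_def)
  then have "finite O'" using fin unfolding O'_def by auto
  then have cnt: "countable_signature \<Sigma>'" using fin by (auto simp: countable_signature_def \<Sigma>'_def countable_finite)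
  \<comment> \<open>Every formula contains an equation, whose terms have a sort, so there is at
    least one object.\<close>
  have "sorts \<Sigma>' \<noteq> {}"
  proof -
    have "is_formula \<Sigma>' \<psi> \<Longrightarrow> sorts \<Sigma>' \<noteq> {}" for \<psi>
      by (induction \<psi>) (use has_sort_sorts[OF wf] in auto)
    then show ?thesis using fm by blast
  qed
  then have "objs \<Sigma>' \<noteq> {}" by (auto simp: sorts_def)
  with sub wf fm cnt show thesis by (rule that)
qed

lemma is_model_agree:
  assumes sub: "sub_signature \<Sigma>' \<Sigma>" and fm: "is_formula \<Sigma>' \<phi>"
    and dom: "\<And>s. s \<in> sorts \<Sigma>' \<Longrightarrow> dom_set \<I> s = dom_set \<J> s"
    and con: "\<And>c. c \<in> all_consts \<Sigma>' \<Longrightarrow> con \<I> c = con \<J> c"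
    and fn: "\<And>f. f \<in> all_funs \<Sigma>' \<Longrightarrow> fn \<I> f = fn \<J> f"
    and interp: "is_interp \<Sigma>' \<I>" and model: "is_model \<Sigma> \<J> \<phi>"
  shows "is_model \<Sigma>' \<I> \<phi>"
proof -
  have eval: "eval \<I> \<beta> t = eval \<J> \<beta> t" if "has_sort \<Sigma>' t a" for t a \<beta>
    using that
  proof (induction rule: has_sort.induct)
    case (3 f ts)
    then have "map (eval \<I> \<beta>) ts = map (eval \<J> \<beta>) ts"
      by (auto simp: list_all2_conv_all_nth in_set_conv_nth)
    then show ?case using fn[OF 3(1)] by (simp del: map_eq_conv)
  qed (simp_all add: con)
  have sat: "sat \<I> \<beta> \<psi> \<longleftrightarrow> sat \<J> \<beta> \<psi>" if "is_formula \<Sigma>' \<psi>" for \<psi> \<beta>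
    using that by (induction \<psi> arbitrary: \<beta>) (auto simp: eval dom)
  have J: "is_interp \<Sigma> \<J>" using model by (simp add: is_model_iff)
  obtain \<beta>0 where \<beta>0: "well_assigned \<Sigma> \<J> \<beta>0" using ex_well_assigned[OF J] by blast
  have "sat \<I> \<beta> \<phi>" if \<beta>: "well_assigned \<Sigma>' \<I> \<beta>" for \<beta>
  proof -
    \<comment> \<open>A well-sorted assignment for the small signature may be arbitrary at the
      remaining sorts; it is repaired there, away from the free variables of \<phi>.\<close>
    define \<beta>' where "\<beta>' x = (if snd x \<in> sorts \<Sigma>' then \<beta> x else \<beta>0 x)" for x
    have "\<beta>' x \<in> dom_set \<J> (snd x)" if "snd x \<in> sorts \<Sigma>" for x
      using that \<beta> \<beta>0 dom unfolding well_assigned_def \<beta>'_def by (cases "snd x \<in> sorts \<Sigma>'") simp_all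
    then have "well_assigned \<Sigma> \<J> \<beta>'" unfolding well_assigned_def by blast
    then have "sat \<J> \<beta>' \<phi>" using model by (simp add: is_model_iff)
    moreover have "sat \<J> \<beta>' \<phi> \<longleftrightarrow> sat \<J> \<beta> \<phi>"
      by (rule sat_cong) (use free_vars_sorts[OF fm] in \<open>simp add: \<beta>'_def split_paired_all\<close>)
    ultimately show ?thesis using sat[OF fm] by blast
  qed
  with interp show ?thesis by (simp add: is_model_iff)
qed

text \<open>
  A model over a smaller signature extends to the whole signature: the additional objects are
  identified with one of the old ones, and the additional symbols are interpreted by zero.
\<close>

lemma entails_sub_signature:
  assumes sub: "sub_signature \<Sigma>' \<Sigma>" and wf: "wf_signature \<Sigma>" "wf_signature \<Sigma>'" and fm: "is_formula \<Sigma>' \<phi>"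
    and ne: "objs \<Sigma>' \<noteq> {}" and ent: "entails TYPE('m) \<Sigma> (axioms \<Sigma>) \<phi>"
  shows "entails TYPE('m) \<Sigma>' (axioms \<Sigma>') \<phi>"
  unfolding entails_def
proof (intro allI impI)
  fix \<I> :: "('a, 'b, 'c, 'm) interp"
  assume "is_interp \<Sigma>' \<I> \<and> (\<forall>\<alpha>\<in>axioms \<Sigma>'. is_model \<Sigma>' \<I> \<alpha>)"
  then have I: "is_interp \<Sigma>' \<I>" and pre: "preadditive \<Sigma>' \<I>" using models_axioms_iff by blast+
  obtain o0 where o0: "o0 \<in> objs \<Sigma>'" using ne by blast
  \<comment> \<open>A retraction of all objects onto those of the small signature; every arithmetic
    symbol of the extension is interpreted through it.\<close>
  define \<pi> where "\<pi> u = (if u \<in> objs \<Sigma>' then u else o0)" for u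
  have \<pi>: "\<pi> u \<in> objs \<Sigma>'" "u \<in> objs \<Sigma>' \<Longrightarrow> \<pi> u = u" for u using o0 by (auto simp: \<pi>_def)
  define z where "z a = con \<I> (Zero (\<pi> (fst a)) (\<pi> (snd a)))" for a
  define \<J> :: "('a, 'b, 'c, 'm) interp" where
    "\<J> = \<lparr> dom_set = (\<lambda>a. dom_set \<I> (\<pi> (fst a), \<pi> (snd a))),
       con = (\<lambda>c. case c of Zero u v \<Rightarrow> con \<I> (Zero (\<pi> u) (\<pi> v))
         | Con c \<Rightarrow> if c \<in> con_syms \<Sigma>' then con \<I> (Con c) else z (con_sort \<Sigma> c)),
       fn = (\<lambda>f. case f of Uminus u v \<Rightarrow> fn \<I> (Uminus (\<pi> u) (\<pi> v)) | Plus u v \<Rightarrow> fn \<I> (Plus (\<pi> u) (\<pi> v))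
         | Times u v w \<Rightarrow> fn \<I> (Times (\<pi> u) (\<pi> v) (\<pi> w))
         | Fun f \<Rightarrow> if f \<in> fun_syms \<Sigma>' then fn \<I> (Fun f) else (\<lambda>_. z (snd (fun_sort \<Sigma> f)))) \<rparr>"
  have zero: "con \<I> (Zero u v) \<in> dom_set \<I> (u, v)" if "u \<in> objs \<Sigma>'" "v \<in> objs \<Sigma>'" for u v
    using I that unfolding is_interp_def by (elim conjE ballE[of _ _ "Zero u v"]) (auto simp: all_consts_def)
  have z: "z a \<in> dom_set \<J> a" for a by (simp add: z_def \<J>_def zero \<pi>(1))
  have dom: "dom_set \<J> a = dom_set \<I> a" if "a \<in> sorts \<Sigma>'" for a
    using that by (auto simp: \<J>_def sorts_def \<pi>(2))
  have con: "con \<J> c = con \<I> c" if "c \<in> all_consts \<Sigma>'" for c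
    using that by (auto simp: \<J>_def all_consts_def \<pi>(2))
  have fn: "fn \<J> f = fn \<I> f" if "f \<in> all_funs \<Sigma>'" for f
    using that by (auto simp: \<J>_def all_funs_def \<pi>(2))
  have fn_closed: "fn \<I> f as \<in> dom_set \<I> (snd (func_sort \<Sigma>' f))"
    if "f \<in> all_funs \<Sigma>'" "list_all2 (\<lambda>a s. a \<in> dom_set \<I> s) as (fst (func_sort \<Sigma>' f))" for f as
    using I that by (simp add: is_interp_def)
  have "is_interp \<Sigma> \<J>"
    unfolding is_interp_def
  proof (intro conjI ballI allI impI)
    show "dom_set \<J> s \<noteq> {}" for s using z by blast
  next
    fix c assume c: "c \<in> all_consts \<Sigma>"
    show "con \<J> c \<in> dom_set \<J> (const_sort \<Sigma> c)"
    proof (cases "c \<in> all_consts \<Sigma>'")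
      case True
      then have "const_sort \<Sigma> c \<in> sorts \<Sigma>'"
        using sub_signature_consts[OF sub True] has_sort_sorts[OF wf(2) has_sort.intros(2)[OF True]] by simp
      moreover have "con \<I> c \<in> dom_set \<I> (const_sort \<Sigma>' c)" using I True by (simp add: is_interp_def)
      ultimately show ?thesis
        using con[OF True] dom sub_signature_consts[OF sub True] by simp
    next
      case False
      show ?thesis
      proof (cases c)
        case (Zero u v)
        then show ?thesis using z[of "(u, v)"] by (simp add: \<J>_def z_def)
      next
        case (Con d)
        then have "d \<notin> con_syms \<Sigma>'" using False by (auto simp: all_consts_def)
        then show ?thesis using Con z by (simp add: \<J>_def)
      qed
    qed
  next
    fix f as assume f: "f \<in> all_funs \<Sigma>" and as: "list_all2 (\<lambda>a s. a \<in> dom_set \<J> s) as (fst (func_sort \<Sigma> f))"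
    show "fn \<J> f as \<in> dom_set \<J> (snd (func_sort \<Sigma> f))"
    proof (cases f)
      case (Uminus u v)
      then show ?thesis
        using as fn_closed[of "Uminus (\<pi> u) (\<pi> v)" as] \<pi>(1) by (auto simp: \<J>_def all_funs_def list_all2_Cons2)
    next
      case (Plus u v)
      then show ?thesis
        using as fn_closed[of "Plus (\<pi> u) (\<pi> v)" as] \<pi>(1) by (auto simp: \<J>_def all_funs_def list_all2_Cons2)
    next
      case (Times u v w)
      then show ?thesis
        using as fn_closed[of "Times (\<pi> u) (\<pi> v) (\<pi> w)" as] \<pi>(1) by (auto simp: \<J>_def all_funs_def list_all2_Cons2)
    next
      case (Fun g)
      show ?thesis
      proof (cases "g \<in> fun_syms \<Sigma>'")
        case True
        then have mem: "Fun g \<in> all_funs \<Sigma>'" by (simp add: all_funs_def)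
        have sorts: "set (fst (fun_sort \<Sigma> g)) \<subseteq> sorts \<Sigma>'" "snd (fun_sort \<Sigma> g) \<in> sorts \<Sigma>'"
          "fun_sort \<Sigma>' g = fun_sort \<Sigma> g"
          using wf(2) True sub by (auto simp: wf_signature_def sub_signature_def)
        have "list_all2 (\<lambda>a s. a \<in> dom_set \<I> s) as (fst (fun_sort \<Sigma> g))"
          unfolding list_all2_conv_all_nth
        proof (intro conjI allI impI)
          have as': "list_all2 (\<lambda>a s. a \<in> dom_set \<J> s) as (fst (fun_sort \<Sigma> g))" using as Fun by simp
          then show len: "length as = length (fst (fun_sort \<Sigma> g))" by (rule list_all2_lengthD)
          fix i assume i: "i < length as"
          then have "fst (fun_sort \<Sigma> g) ! i \<in> sorts \<Sigma>'" using sorts(1) len by auto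
          from dom[OF this] list_all2_nthD[OF as' i] show "as ! i \<in> dom_set \<I> (fst (fun_sort \<Sigma> g) ! i)" by simp
        qed
        then show ?thesis using fn_closed[OF mem] fn[OF mem] dom[OF sorts(2)] sorts(3) Fun by simp
      next
        case False
        then show ?thesis using Fun z by (simp add: \<J>_def)
      qed
    qed
  qed
  moreover have "preadditive \<Sigma> \<J>"
    unfolding preadditive_def
  proof (intro ballI)
    fix u u' v v'
    \<comment> \<open>The laws of \<open>\<J>\<close> at some objects are those of
      \<open>\<I>\<close> at their images under \<pi>.\<close>
    show "preadditive_laws \<J> u u' v v'"
      using pre[unfolded preadditive_def, rule_format, OF \<pi>(1)[of u] \<pi>(1)[of u'] \<pi>(1)[of v] \<pi>(1)[of v']]
      by (simp add: \<J>_def preadditive_laws_def)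
  qed
  ultimately have "is_model \<Sigma> \<J> \<phi>" using ent models_axioms_iff unfolding entails_def by blast
  then show "is_model \<Sigma>' \<I> \<phi>"
    by (rule is_model_agree[OF sub fm _ _ _ I, rotated 3]) (simp_all add: dom con fn)
qed

section \<open>The procedure\<close>

lemma wf_ack_sig: "wf_signature \<Sigma> \<Longrightarrow> wf_signature (ack_sig \<Sigma>)"
  by (auto simp: wf_signature_def ack_sig_def sorts_def split: ack_const.splits)

text \<open>A refuted \<psi> would give a refutation of its Ackermann reduction with the same
  arithmetic part, hence in a preadditive semicategory. As \<psi> is closed, \<beta> may first be
  replaced by a well-sorted assignment.\<close>

lemma ackermann_sound:
  assumes "wf_signature \<Sigma>" "is_interp \<Sigma> \<I>" "preadditive \<Sigma> \<I>" "is_formula \<Sigma> \<psi>" "quantifier_free \<psi>"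
    "free_vars \<psi> = []" "idealisation (ackermann \<psi>)"
  shows "sat \<I> \<beta> \<psi>"
proof (rule ccontr)
  assume unsat: "\<not> sat \<I> \<beta> \<psi>"
  obtain \<beta>' where \<beta>': "well_assigned \<Sigma> \<I> \<beta>'" using ex_well_assigned[OF assms(2)] by blast
  have "sat \<I> \<beta>' \<psi> \<longleftrightarrow> sat \<I> \<beta> \<psi>" by (rule sat_cong) (simp add: assms(6))
  with unsat have unsat': "\<not> sat \<I> \<beta>' \<psi>" by simp
  obtain \<J> where J: "is_interp (ack_sig \<Sigma>) \<J>" "same_arith \<I> \<J>" "\<not> sat \<J> \<beta>' (ackermann \<psi>)"
    using ackermann_unsat[OF assms(1,2) \<beta>' assms(4,5) unsat'] .
  have pre: "preadditive (ack_sig \<Sigma>) \<J>"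
    using preadditive_cong[OF J(2), of \<Sigma> "ack_sig \<Sigma>"] assms(3) by simp
  have "(\<Union>u\<in>set (terms_fm \<psi>). set (vars_tm u)) = {}"
    using free_vars_quantifier_free[OF assms(5)] assms(6) by simp
  then have "nonarith_funs_tm t = [] \<and> vars_tm t = []" if "t \<in> set (terms_fm (ackermann \<psi>))" for t
    using ackermann_props(3,4)[OF assms(4,5) that] by simp
  from idealisation_sound[OF J(1) pre wf_ack_sig[OF assms(1)] ackermann_props(1,2)[OF assms(4,5)] this assms(7)]
  show False using J(3) by blast
qed

text \<open>The type of the countermodel depends on the symbols and not on \<psi>, so countermodels
  to infinitely many formulas can form one sequence.\<close>

lemma ackermann_complete:
  fixes \<psi> :: "('o, 'c, 'f) fm"
  assumes "is_formula \<Sigma> \<psi>" "quantifier_free \<psi>" "free_vars \<psi> = []" "\<not> idealisation (ackermann \<psi>)"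
  obtains \<I> :: "('o, 'c, 'f, (('c, 'f) ack_const) free_alg) interp" where
    "is_interp \<Sigma> \<I>" "preadditive \<Sigma> \<I>" "\<not> sat \<I> \<beta> \<psi>"
proof -
  have "(\<Union>u\<in>set (terms_fm \<psi>). set (vars_tm u)) = {}"
    using free_vars_quantifier_free[OF assms(2)] assms(3) by simp
  then have "nonarith_funs_tm t = [] \<and> vars_tm t = []" if "t \<in> set (terms_fm (ackermann \<psi>))" for t
    using ackermann_props(3,4)[OF assms(1,2) that] by simp
  from idealisation_complete[OF ackermann_props(1,2)[OF assms(1,2)] this assms(4)]
  obtain \<J> :: "('o, ('c, 'f) ack_const, 'f, (('c, 'f) ack_const) free_alg) interp" where
    J: "is_interp (ack_sig \<Sigma>) \<J>" "preadditive (ack_sig \<Sigma>) \<J>" "\<not> sat \<J> \<beta> (ackermann \<psi>)"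
    by metis
  obtain \<I> where I: "is_interp \<Sigma> \<I>" "same_arith \<I> \<J>" "\<not> sat \<I> \<beta> \<psi>"
    using ackermann_unsat_conv[OF J(1) assms(2) J(3)] .
  show thesis
    by (rule that[OF I(1) _ I(3)]) (use preadditive_cong[OF I(2), of \<Sigma> "ack_sig \<Sigma>"] J(2) in simp)
qed

section \<open>The axioms as universally quantified equations\<close>

lemma has_sort_Var: "u \<in> objs \<Sigma> \<Longrightarrow> v \<in> objs \<Sigma> \<Longrightarrow> has_sort \<Sigma> (Var (i, (u, v))) (u, v)"
  using has_sort.intros(1)[of "(i, (u, v))" \<Sigma>] by (simp add: sorts_def)

lemma has_sort_Zero: "u \<in> objs \<Sigma> \<Longrightarrow> v \<in> objs \<Sigma> \<Longrightarrow> has_sort \<Sigma> (Const (Zero u v)) (u, v)"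
  using has_sort.intros(2)[of "Zero u v" \<Sigma>] by (simp add: all_consts_def)

lemma has_sort_Uminus:
  "u \<in> objs \<Sigma> \<Longrightarrow> v \<in> objs \<Sigma> \<Longrightarrow> has_sort \<Sigma> s (u, v) \<Longrightarrow> has_sort \<Sigma> (App (Uminus u v) [s]) (u, v)"
  using has_sort.intros(3)[of "Uminus u v" \<Sigma> "[s]"] by (simp add: all_funs_def)

lemma has_sort_Plus:
  "u \<in> objs \<Sigma> \<Longrightarrow> v \<in> objs \<Sigma> \<Longrightarrow> has_sort \<Sigma> s (u, v) \<Longrightarrow> has_sort \<Sigma> t (u, v) \<Longrightarrow>
   has_sort \<Sigma> (tm_add u v s t) (u, v)"
  using has_sort.intros(3)[of "Plus u v" \<Sigma> "[s, t]"] by (simp add: all_funs_def)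

lemma has_sort_Times:
  "u \<in> objs \<Sigma> \<Longrightarrow> v \<in> objs \<Sigma> \<Longrightarrow> w \<in> objs \<Sigma> \<Longrightarrow> has_sort \<Sigma> s (w, v) \<Longrightarrow> has_sort \<Sigma> t (u, w) \<Longrightarrow>
   has_sort \<Sigma> (tm_mult u v w s t) (u, v)"
  using has_sort.intros(3)[of "Times u v w" \<Sigma> "[s, t]"] by (simp add: all_funs_def)

text \<open>The limit construction transfers quantifier-free formulas only. The axioms fit because
  each is a string of universal quantifiers before an equation of well-sorted terms.\<close>

lemma axioms_universal:
  assumes "\<alpha> \<in> axioms \<Sigma>"
  obtains xs s t a where "\<alpha> = foldr All xs (Eq s t)" "snd ` set xs \<subseteq> sorts \<Sigma>" "has_sort \<Sigma> s a" "has_sort \<Sigma> t a"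
proof -
  note srt = has_sort_Var has_sort_Zero has_sort_Uminus has_sort_Plus has_sort_Times
  obtain u u' v v' where o: "u \<in> objs \<Sigma>" "u' \<in> objs \<Sigma>" "v \<in> objs \<Sigma>" "v' \<in> objs \<Sigma>"
    and \<alpha>: "\<alpha> \<in> {ax_mult_assoc u u' v v', ax_add_assoc u v, ax_add_zero u v, ax_add_minus u v,
      ax_add_comm u v, ax_distrib_left u v v', ax_distrib_right u v v'}"
    using assms unfolding axioms_def by blast
  from \<alpha> consider "\<alpha> = ax_mult_assoc u u' v v'" | "\<alpha> = ax_add_assoc u v" | "\<alpha> = ax_add_zero u v"
    | "\<alpha> = ax_add_minus u v" | "\<alpha> = ax_add_comm u v" | "\<alpha> = ax_distrib_left u v v'" | "\<alpha> = ax_distrib_right u v v'"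
    by blast
  then show thesis
  proof cases
    case 1
    show thesis
      by (rule that[of "[(0, (v', v)), (1, (u', v')), (2, (u, u'))]" _ _ "(u, v)"], unfold 1 ax_mult_assoc_def Let_def foldr.simps o_apply id_apply, rule refl)
        (use o in \<open>auto simp: sorts_def intro!: srt\<close>)
  next
    case 2
    show thesis
      by (rule that[of "[(0, (u, v)), (1, (u, v)), (2, (u, v))]" _ _ "(u, v)"], unfold 2 ax_add_assoc_def Let_def foldr.simps o_apply id_apply, rule refl)
        (use o in \<open>auto simp: sorts_def intro!: srt\<close>)
  next
    case 3
    show thesis
      by (rule that[of "[(0, (u, v))]" _ _ "(u, v)"], unfold 3 ax_add_zero_def Let_def foldr.simps o_apply id_apply, rule refl)
        (use o in \<open>auto simp: sorts_def intro!: srt\<close>)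
  next
    case 4
    show thesis
      by (rule that[of "[(0, (u, v))]" _ _ "(u, v)"], unfold 4 ax_add_minus_def Let_def foldr.simps o_apply id_apply, rule refl)
        (use o in \<open>auto simp: sorts_def intro!: srt\<close>)
  next
    case 5
    show thesis
      by (rule that[of "[(0, (u, v)), (1, (u, v))]" _ _ "(u, v)"], unfold 5 ax_add_comm_def Let_def foldr.simps o_apply id_apply, rule refl)
        (use o in \<open>auto simp: sorts_def intro!: srt\<close>)
  next
    case 6
    show thesis
      by (rule that[of "[(0, (v', v)), (1, (u, v')), (2, (u, v'))]" _ _ "(u, v)"], unfold 6 ax_distrib_left_def Let_def foldr.simps o_apply id_apply, rule refl)
        (use o in \<open>auto simp: sorts_def intro!: srt\<close>)
  next
    case 7
    show thesis
      by (rule that[of "[(0, (v', v)), (1, (v', v)), (2, (u, v'))]" _ _ "(u, v)"], unfold 7 ax_distrib_right_def Let_def foldr.simps o_apply id_apply, rule refl)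
        (use o in \<open>auto simp: sorts_def intro!: srt\<close>)
  qed
qed

text \<open>If no \<open>\<psi> n\<close> is idealised, each has a countermodel
  \<open>\<I> n\<close>, which also refutes the instances up to \<open>n\<close>. Their limit
  refutes every Herbrand instance over the subsignature, and the reduct of the limit is a
  countermodel of \<phi>. The condition on \<open>\<psi>\<close> is weak enough to cover the ground
  case, where the disjunctions do not grow.\<close>

lemma entails_imp_idealisable:
  fixes \<Sigma> :: "('o, 'c, 'f) signature" and \<phi> :: "('o, 'c, 'f) fm" and enum :: "nat \<Rightarrow> ('o, 'c, 'f) hfm"
  assumes wf: "wf_signature \<Sigma>" and fm: "is_formula \<Sigma> \<phi>" and enum: "herbrand_expansion \<Sigma> \<phi> \<subseteq> range enum"
    and inf: "infinite (UNIV :: 'm set)" and ent: "entails TYPE('m) \<Sigma> (axioms \<Sigma>) \<phi>"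
    and \<psi>: "\<And>n. is_formula (herbrand_sig \<Sigma> \<phi>) (\<psi> n)" "\<And>n. quantifier_free (\<psi> n)" "\<And>n. free_vars (\<psi> n) = []"
    and disj: "\<And>(\<I> :: ('o, 'c ext, 'f ext, (('c ext, 'f ext) ack_const) free_alg) interp) n i \<beta>. i \<le> n \<Longrightarrow> sat \<I> \<beta> (enum i) \<Longrightarrow> sat \<I> \<beta> (\<psi> n)"
  shows "\<exists>n. idealisation (ackermann (\<psi> n))"
proof (rule ccontr)
  assume none: "\<nexists>n. idealisation (ackermann (\<psi> n))"
  let ?H = "herbrand_sig \<Sigma> \<phi>"
  \<comment> \<open>All formulas evaluated under this assignment will be ground, so its values are
    immaterial and need not respect the sorts.\<close>
  let ?\<beta> = "\<lambda>_. 0 :: (('c ext, 'f ext) ack_const) free_alg"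
  have "\<exists>\<I> :: ('o, 'c ext, 'f ext, (('c ext, 'f ext) ack_const) free_alg) interp.
      is_interp ?H \<I> \<and> preadditive ?H \<I> \<and> \<not> sat \<I> ?\<beta> (\<psi> n)" for n
    using ackermann_complete[OF \<psi>(1-3)] none by metis
  then obtain \<I> :: "nat \<Rightarrow> ('o, 'c ext, 'f ext, (('c ext, 'f ext) ack_const) free_alg) interp" where
    I: "\<And>n. is_interp ?H (\<I> n)" "\<And>n. preadditive ?H (\<I> n)" "\<And>n. \<not> sat (\<I> n) ?\<beta> (\<psi> n)"
    by metis
  obtain \<Sigma>' where sub: "sub_signature \<Sigma>' \<Sigma>" and wf': "wf_signature \<Sigma>'" and fm': "is_formula \<Sigma>' \<phi>"
    and cnt: "countable_signature \<Sigma>'" and ne: "objs \<Sigma>' \<noteq> {}"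
    using ex_countable_sub_signature[OF wf fm] .
  let ?H' = "herbrand_sig \<Sigma>' \<phi>"
  have subH: "sub_signature ?H' ?H" by (rule sub_signature_herbrand_sig[OF sub])
  have wfH: "wf_signature ?H'" by (rule wf_herbrand_sig[OF wf' fm'])
  have cntH: "countable_signature ?H'"
    using cnt by (auto simp: countable_signature_def herbrand_sig_def Let_def countable_finite)
  obtain \<J> :: "('o, 'c ext, 'f ext, 'm) interp" where J: "is_interp ?H' \<J>" and
    transfer: "\<And>\<chi> \<beta>. quantifier_free \<chi> \<Longrightarrow> is_formula ?H' \<chi> \<Longrightarrow>
       (\<And>\<tau>. ground_subst ?H' \<tau> \<Longrightarrow> \<forall>\<^sub>F n in sequentially. sat (\<I> n) ?\<beta> (map_terms (subst_tm \<tau>) \<chi>)) \<Longrightarrow>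
       well_assigned ?H' \<J> \<beta> \<Longrightarrow> sat \<J> \<beta> \<chi>"
    using term_model[OF wfH cntH inf, of \<I> ?\<beta>] by blast
  have I': "is_interp ?H' (\<I> n)" "preadditive ?H' (\<I> n)" for n
    using sub_signature_is_interp[OF subH I(1)] sub_signature_preadditive[OF subH I(2)] by auto
  have "is_model ?H' \<J> \<alpha>" if \<alpha>: "\<alpha> \<in> axioms ?H'" for \<alpha>
  proof -
    obtain xs s t a where xs: "\<alpha> = foldr All xs (Eq s t)" "snd ` set xs \<subseteq> sorts ?H'"
      and st: "has_sort ?H' s a" "has_sort ?H' t a"
      using axioms_universal[OF \<alpha>] .
    have "sat \<J> \<beta> (Eq s t)" if \<beta>: "well_assigned ?H' \<J> \<beta>" for \<beta>
    proof (rule transfer[OF _ _ _ \<beta>])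
      fix \<tau> assume \<tau>: "ground_subst ?H' \<tau>"
      have "sat (\<I> n) ?\<beta> (map_terms (subst_tm \<tau>) (Eq s t))" for n
      proof -
        obtain \<beta>1 where \<beta>1: "well_assigned ?H' (\<I> n) \<beta>1" using ex_well_assigned[OF I'(1)] by blast
        \<comment> \<open>The axioms are known for well-sorted assignments. Evaluating the ground
          terms of \<tau> under \<open>\<beta>1\<close> gives such an assignment, with the values
          that the substituted terms have under \<open>?\<beta>\<close>.\<close>
        define \<gamma> where "\<gamma> x = eval (\<I> n) \<beta>1 (\<tau> x)" for x
        have gr: "has_sort ?H' (\<tau> x) (snd x)" "vars_tm (\<tau> x) = []" if "snd x \<in> sorts ?H'" for x
          using \<tau> that unfolding ground_subst_def ground_terms_def by blast+
        have "\<gamma> x \<in> dom_set (\<I> n) (snd x)" if "snd x \<in> sorts ?H'" for x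
          unfolding \<gamma>_def by (rule eval_in_dom[OF gr(1)[OF that] I'(1) \<beta>1])
        then have "well_assigned ?H' (\<I> n) \<gamma>" unfolding well_assigned_def by blast
        moreover have "is_model ?H' (\<I> n) \<alpha>"
          using models_axioms_iff[OF I'(1)] I'(2) \<alpha> by blast
        then have "\<forall>\<beta>. well_assigned ?H' (\<I> n) \<beta> \<longrightarrow> sat (\<I> n) \<beta> (foldr All xs (Eq s t))"
          unfolding is_model_iff xs(1) by blast
        then have "\<forall>\<beta>. well_assigned ?H' (\<I> n) \<beta> \<longrightarrow> sat (\<I> n) \<beta> (Eq s t)"
          unfolding sat_foldr_All_well_assigned[OF xs(2)] .
        ultimately have "sat (\<I> n) \<gamma> (Eq s t)" by blast
        moreover have "eval (\<I> n) \<gamma> r = eval (\<I> n) ?\<beta> (subst_tm \<tau> r)" if r: "has_sort ?H' r a" for r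
          unfolding eval_subst
        proof (rule eval_cong)
          fix x assume "x \<in> set (vars_tm r)"
          then have "vars_tm (\<tau> x) = []" using gr(2) has_sort_vars[OF r] by blast
          then show "\<gamma> x = eval (\<I> n) ?\<beta> (\<tau> x)" unfolding \<gamma>_def by (intro eval_cong) simp
        qed
        ultimately show ?thesis using st by simp
      qed
      then show "\<forall>\<^sub>F n in sequentially. sat (\<I> n) ?\<beta> (map_terms (subst_tm \<tau>) (Eq s t))" by simp
    qed (use st in auto)
    then have "\<forall>\<beta>. well_assigned ?H' \<J> \<beta> \<longrightarrow> sat \<J> \<beta> (foldr All xs (Eq s t))"
      unfolding sat_foldr_All_well_assigned[OF xs(2)] by blast
    then show ?thesis using J unfolding is_model_iff xs(1) by blast
  qed
  then have preJ: "preadditive ?H' \<J>" using models_axioms_iff[OF J] by blast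
  have refuted: "\<not> sat \<J> \<beta> (herbrand_matrix \<phi>)" if \<beta>: "well_assigned ?H' \<J> \<beta>" for \<beta>
  proof -
    have "sat \<J> \<beta> (Neg (herbrand_matrix \<phi>))"
    proof (rule transfer[OF _ _ _ \<beta>])
      fix \<tau> assume \<tau>: "ground_subst ?H' \<tau>"
      \<comment> \<open>The Herbrand expansion prescribes the identity outside the Herbrand
        variables; as the matrix has no other free variables, the change does not affect it.\<close>
      define \<tau>' where "\<tau>' x = (if x \<in> set (herbrand_vars \<phi>) then \<tau> x else Var x)" for x
      have "has_sort ?H (\<tau>' x) (snd x) \<and> vars_tm (\<tau>' x) = []" if "x \<in> set (herbrand_vars \<phi>)" for x
      proof -
        have "snd x \<in> sorts ?H'" using herbrand_vars_sorts[OF wf' fm'] that by auto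
        then have "\<tau> x \<in> ground_terms ?H' (snd x)" using \<tau> unfolding ground_subst_def by blast
        then show ?thesis
          using sub_signature_has_sort[OF subH] that by (simp add: ground_terms_def \<tau>'_def)
      qed
      moreover have "\<tau>' x = Var x" if "x \<notin> set (herbrand_vars \<phi>)" for x
        using that by (simp add: \<tau>'_def)
      ultimately have "map_terms (subst_tm \<tau>') (herbrand_matrix \<phi>) \<in> herbrand_expansion \<Sigma> \<phi>"
        unfolding herbrand_expansion_def by (intro CollectI exI[of _ \<tau>']) (simp del: split_paired_All)
      then obtain k where k: "enum k = map_terms (subst_tm \<tau>') (herbrand_matrix \<phi>)" using enum by (metis rangeE subsetD)
      \<comment> \<open>The instance occurs at position \<open>k\<close> of the enumeration, so
        every countermodel from stage \<open>k\<close> on refutes it; this gives the eventual truth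
        of the negation.\<close>
      have "sat (\<I> n) ?\<beta> (map_terms (subst_tm \<tau>) (Neg (herbrand_matrix \<phi>)))" if "k \<le> n" for n
      proof -
        have "\<not> sat (\<I> n) ?\<beta> (enum k)" using disj[OF that] I(3)[of n] by blast
        moreover have "sat (\<I> n) (\<lambda>x. eval (\<I> n) ?\<beta> (\<tau>' x)) (herbrand_matrix \<phi>) \<longleftrightarrow>
            sat (\<I> n) (\<lambda>x. eval (\<I> n) ?\<beta> (\<tau> x)) (herbrand_matrix \<phi>)"
          by (rule sat_cong) (use free_vars_herbrand_matrix[OF wf' fm'] in \<open>auto simp: \<tau>'_def\<close>)
        ultimately show ?thesis
          unfolding k map_terms.simps sat.simps sat_subst[OF quantifier_free_herbrand_matrix[OF wf' fm']] by blast
      qed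
      then show "\<forall>\<^sub>F n in sequentially. sat (\<I> n) ?\<beta> (map_terms (subst_tm \<tau>) (Neg (herbrand_matrix \<phi>)))"
        by (rule eventually_sequentiallyI)
    qed (use quantifier_free_herbrand_matrix[OF wf' fm'] is_formula_herbrand_matrix[OF wf' fm'] in auto)
    then show ?thesis by simp
  qed
  let ?K = "reduct Old Old \<J> :: ('o, 'c, 'f, 'm) interp"
  have K: "is_interp \<Sigma>' ?K" by (rule is_interp_reduct_Old[OF J])
  have "preadditive \<Sigma>' ?K" using preadditive_cong[OF same_arith_reduct, of \<Sigma>' ?H' Old Old \<J>] preJ by simp
  then have "\<forall>\<alpha>\<in>axioms \<Sigma>'. is_model \<Sigma>' ?K \<alpha>" using models_axioms_iff[OF K] by blast
  moreover have "\<not> is_model \<Sigma>' ?K \<phi>" by (rule herbrand_refuted_imp[OF wf' fm' J refuted])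
  moreover have "entails TYPE('m) \<Sigma>' (axioms \<Sigma>') \<phi>" by (rule entails_sub_signature[OF sub wf wf' fm' ne ent])
  ultimately show False using K unfolding entails_def by blast
qed

text \<open>The Skolem expansion of a countermodel of \<phi> refutes the matrix under all
  well-sorted assignments, in particular those given by ground terms. It thus refutes all instances,
  although \<psi> holds in it by \<open>ackermann_sound\<close> and forces one of them.\<close>

lemma idealisable_imp_entails:
  fixes \<Sigma> :: "('o, 'c, 'f) signature" and \<phi> :: "('o, 'c, 'f) fm"
  assumes wf: "wf_signature \<Sigma>" and fm: "is_formula \<Sigma> \<phi>" and H: "S \<subseteq> herbrand_expansion \<Sigma> \<phi>"
    and \<psi>: "is_formula (herbrand_sig \<Sigma> \<phi>) \<psi>" "quantifier_free \<psi>" "free_vars \<psi> = []"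
    and disj: "\<And>(\<I> :: ('o, 'c ext, 'f ext, 'm) interp) \<beta>. sat \<I> \<beta> \<psi> \<Longrightarrow> \<exists>\<chi>\<in>S. sat \<I> \<beta> \<chi>"
    and ideal: "idealisation (ackermann \<psi>)"
  shows "entails TYPE('m) \<Sigma> (axioms \<Sigma>) \<phi>"
  unfolding entails_def
proof (intro allI impI, rule ccontr)
  fix \<I> :: "('o, 'c, 'f, 'm) interp"
  assume I: "is_interp \<Sigma> \<I> \<and> (\<forall>\<alpha>\<in>axioms \<Sigma>. is_model \<Sigma> \<I> \<alpha>)" and not: "\<not> is_model \<Sigma> \<I> \<phi>"
  let ?H = "herbrand_sig \<Sigma> \<phi>"
  obtain \<J> where J: "is_interp ?H \<J>" "reduct Old Old \<J> = \<I>"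
    "\<And>\<beta>. well_assigned ?H \<J> \<beta> \<Longrightarrow> \<not> sat \<J> \<beta> (herbrand_matrix \<phi>)"
    using Skolem_expansion[OF wf fm conjunct1[OF I] not] by blast
  have "preadditive \<Sigma> \<I>" using I models_axioms_iff by blast
  then have pre: "preadditive ?H \<J>"
    using preadditive_cong[OF same_arith_reduct, of \<Sigma> ?H Old Old \<J>] J(2) by simp
  obtain \<beta> where \<beta>: "well_assigned ?H \<J> \<beta>" using ex_well_assigned[OF J(1)] by blast
  have "sat \<J> \<beta> \<psi>" by (rule ackermann_sound[OF wf_herbrand_sig[OF wf fm] J(1) pre \<psi> ideal])
  then obtain \<chi> where \<chi>: "\<chi> \<in> herbrand_expansion \<Sigma> \<phi>" "sat \<J> \<beta> \<chi>" using disj H by blast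
  then obtain \<tau> where \<chi>_def: "\<chi> = map_terms (subst_tm \<tau>) (herbrand_matrix \<phi>)"
    and \<tau>: "\<And>x. if x \<in> set (herbrand_vars \<phi>) then has_sort ?H (\<tau> x) (snd x) \<and> vars_tm (\<tau> x) = [] else \<tau> x = Var x"
    unfolding herbrand_expansion_def by blast
  have "eval \<J> \<beta> (\<tau> x) \<in> dom_set \<J> (snd x)" if "snd x \<in> sorts ?H" for x
  proof (cases "x \<in> set (herbrand_vars \<phi>)")
    case True
    then have "has_sort ?H (\<tau> x) (snd x)" using \<tau>[of x] by simp
    then show ?thesis by (rule eval_in_dom[OF _ J(1) \<beta>])
  next
    case False
    then have "\<tau> x = Var x" using \<tau>[of x] by simp
    then show ?thesis using \<beta> that unfolding well_assigned_def by simp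
  qed
  then have "well_assigned ?H \<J> (\<lambda>x. eval \<J> \<beta> (\<tau> x))" unfolding well_assigned_def by blast
  then show False
    using J(3) \<chi>(2) sat_subst[OF quantifier_free_herbrand_matrix[OF wf fm]] unfolding \<chi>_def by blast
qed

lemma herbrand_expansion_props:
  assumes wf: "wf_signature \<Sigma>" and fm: "is_formula \<Sigma> \<phi>" and \<chi>: "\<chi> \<in> herbrand_expansion \<Sigma> \<phi>"
  shows "is_formula (herbrand_sig \<Sigma> \<phi>) \<chi>" "quantifier_free \<chi>" "free_vars \<chi> = []"
proof -
  let ?H = "herbrand_sig \<Sigma> \<phi>"
  note qf = quantifier_free_herbrand_matrix[OF wf fm]
  obtain \<tau> where \<chi>_def: "\<chi> = map_terms (subst_tm \<tau>) (herbrand_matrix \<phi>)"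
    and \<tau>: "\<And>x. if x \<in> set (herbrand_vars \<phi>) then has_sort ?H (\<tau> x) (snd x) \<and> vars_tm (\<tau> x) = [] else \<tau> x = Var x"
    using \<chi> unfolding herbrand_expansion_def by blast
  have "has_sort ?H (\<tau> x) (snd x)" if "snd x \<in> sorts ?H" for x
    using \<tau>[of x] has_sort.intros(1)[OF that] by (cases "x \<in> set (herbrand_vars \<phi>)") simp_all
  then show "is_formula ?H \<chi>"
    unfolding \<chi>_def by (intro is_formula_map_terms[OF qf is_formula_herbrand_matrix[OF wf fm]] has_sort_subst)
  show "quantifier_free \<chi>" using qf by (simp add: \<chi>_def)
  have "vars_tm (\<tau> x) = []" if "x \<in> set (free_vars (herbrand_matrix \<phi>))" for x
    using \<tau>[of x] subsetD[OF free_vars_herbrand_matrix[OF wf fm] that] by simp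
  then have "set (free_vars \<chi>) = {}" unfolding \<chi>_def free_vars_subst[OF qf] by simp
  then show "free_vars \<chi> = []" by simp
qed

text \<open>Groundness leaves no existential variables, so the only admissible substitution is the
  identity and the expansion has a single element.\<close>

lemma herbrand_expansion_ground:
  assumes "ground_fm (herbrand_nf \<phi>)" "\<chi> \<in> herbrand_expansion \<Sigma> \<phi>"
  shows "\<chi> = map_terms (subst_tm Var) (herbrand_matrix \<phi>)"
proof -
  have "herbrand_vars \<phi> = []" using assms(1) by (cases "herbrand_vars \<phi>") (simp_all add: herbrand_nf_def)
  then obtain \<tau> where "\<chi> = map_terms (subst_tm \<tau>) (herbrand_matrix \<phi>)" "\<forall>x. \<tau> x = Var x"
    using assms(2) unfolding herbrand_expansion_def by auto
  moreover from this(2) have "\<tau> = Var" by (intro ext) blast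
  ultimately show ?thesis by simp
qed

section \<open>The run of the procedure\<close>

fun disj_upto :: "(nat \<Rightarrow> ('o, 'c, 'f) fm) \<Rightarrow> nat \<Rightarrow> ('o, 'c, 'f) fm" where
  "disj_upto enum 0 = enum 0"
| "disj_upto enum (Suc n) = Or (disj_upto enum n) (enum (Suc n))"

lemma sat_disj_upto: "sat \<I> \<beta> (disj_upto enum n) \<longleftrightarrow> (\<exists>i\<le>n. sat \<I> \<beta> (enum i))"
  by (induction n) (auto simp: le_Suc_eq)

lemma disj_upto_props:
  assumes "\<And>i. is_formula \<Sigma> (enum i) \<and> quantifier_free (enum i) \<and> free_vars (enum i) = []"
  shows "is_formula \<Sigma> (disj_upto enum n)" "quantifier_free (disj_upto enum n)" "free_vars (disj_upto enum n) = []"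
  by (induction n) (use assms in simp_all)

text \<open>The disjunction whose Ackermann reduction is added for pass \<open>n + 1\<close>. In the
  ground case the procedure never extends its first formula.\<close>

definition nth_disj :: "(nat \<Rightarrow> ('o, 'c, 'f) hfm) \<Rightarrow> ('o, 'c, 'f) fm \<Rightarrow> nat \<Rightarrow> ('o, 'c, 'f) hfm" where
  "nth_disj enum \<phi> n = (if ground_fm (herbrand_nf \<phi>) then enum 0 else disj_upto enum n)"

lemma verified_within_mono: "verified_within \<P> m \<phi> \<Longrightarrow> m \<le> n \<Longrightarrow> verified_within \<P> n \<phi>"
  unfolding verified_within_def by (meson le_trans)

text \<open>The pass is iterated without the loop guard, so states after the return occur as well;
  there \<open>returned\<close> keeps its value. Before the return, \<open>k\<close> iterations lead
  to the beginning of pass \<open>Suc k\<close>.\<close>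

lemma procedure_states:
  fixes \<P> :: "(('c ext, 'f ext) ack_const, 's) membership_proc" and enum :: "nat \<Rightarrow> ('o, 'c, 'f) hfm"
    and \<phi> :: "('o, 'c, 'f) fm"
  defines "st \<equiv> \<lambda>k. (one_pass \<P> enum \<phi> ^^ k) (start enum)"
  shows "returned (st k) = None \<Longrightarrow> pass (st k) = Suc k \<and> disj (st k) = nth_disj enum \<phi> k \<and>
      acks (st k) = map (\<lambda>i. ackermann (nth_disj enum \<phi> i)) [0..<Suc k]"
    and "returned (st k) \<noteq> None \<Longrightarrow> returned (st k) = Some True \<and>
      (\<exists>n i. verified_within \<P> n (ackermann (nth_disj enum \<phi> i)))"
proof (induction k)
  case 0
  { case 1
    show ?case by (simp add: st_def start_def nth_disj_def) }
  { case 2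
    then show ?case by (simp add: st_def start_def) }
next
  case (Suc k)
  have step: "st (Suc k) = one_pass \<P> enum \<phi> (st k)" by (simp add: st_def)
  let ?v = "\<exists>j\<in>{1..pass (st k)}. verified_within \<P> (pass (st k)) (acks (st k) ! (j - 1))"
  { case 1
    have nv: "\<not> ?v"
    proof
      assume ?v
      then have "returned (st (Suc k)) = Some True" unfolding step one_pass_def by (simp add: Let_def)
      with 1 show False by simp
    qed
    have "returned (st k) = None"
      using 1 nv unfolding step one_pass_def by (simp add: Let_def split: if_splits)
    note IH = Suc(1)[OF this]
    have last: "last (acks (st k)) = ackermann (nth_disj enum \<phi> k)" using IH by simp
    show ?case
    proof (cases "ground_fm (herbrand_nf \<phi>)")
      case True
      then have "st (Suc k) = st k\<lparr>pass := pass (st k) + 1, acks := acks (st k) @ [last (acks (st k))]\<rparr>"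
        using nv unfolding step one_pass_def by (simp add: Let_def)
      then show ?thesis using IH last True by (simp add: nth_disj_def)
    next
      case False
      let ?\<psi> = "Or (disj (st k)) (enum (pass (st k)))"
      have "st (Suc k) = st k\<lparr>pass := pass (st k) + 1, disj := ?\<psi>, acks := acks (st k) @ [ackermann ?\<psi>]\<rparr>"
        using nv False unfolding step one_pass_def by (simp add: Let_def)
      then show ?thesis using IH False by (simp add: nth_disj_def)
    qed }
  { case 2
    show ?case
    proof (cases "returned (st k) = None")
      case True
      note IH = Suc(1)[OF True]
      have v: ?v using 2 True unfolding step one_pass_def by (auto simp: Let_def split: if_splits)
      then have "returned (st (Suc k)) = Some True" unfolding step one_pass_def by (simp add: Let_def)
      moreover obtain j where "j \<in> {1..Suc k}" "verified_within \<P> (Suc k) (acks (st k) ! (j - 1))"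
        using v IH by auto
      then have "verified_within \<P> (Suc k) (ackermann (nth_disj enum \<phi> (j - 1)))"
        using IH nth_map_upt[of "j - 1" "Suc k" 0 "\<lambda>i. ackermann (nth_disj enum \<phi> i)"]
        by (simp del: upt_Suc nth_map add: less_Suc_eq_le le_diff_conv)
      ultimately show ?thesis by blast
    next
      case False
      then have "returned (st (Suc k)) = Some True"
        using Suc(2)[OF False] unfolding step one_pass_def by (simp add: Let_def)
      then show ?thesis using Suc(2)[OF False] by blast
    qed }
qed

lemma procedure_cases:
  fixes \<P> :: "(('c ext, 'f ext) ack_const, 's) membership_proc" and enum :: "nat \<Rightarrow> ('o, 'c, 'f) hfm"
  assumes "semi_decides_membership \<P>"
  shows "procedure \<P> enum \<phi> =
    (if \<exists>n. idealisation (ackermann (nth_disj enum \<phi> n)) then Some True else None)"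
proof -
  let ?st = "\<lambda>k. (one_pass \<P> enum \<phi> ^^ k) (start enum)"
  note states = procedure_states[of _ \<P> enum \<phi>]
  have halt_iff: "(\<exists>k. returned (?st k) \<noteq> None) \<longleftrightarrow> (\<exists>n. idealisation (ackermann (nth_disj enum \<phi> n)))"
  proof
    assume "\<exists>k. returned (?st k) \<noteq> None"
    then obtain k where "returned (?st k) \<noteq> None" ..
    from states(2)[OF this] show "\<exists>n. idealisation (ackermann (nth_disj enum \<phi> n))"
      using ex_verified_within_iff[OF assms] by blast
  next
    assume "\<exists>n. idealisation (ackermann (nth_disj enum \<phi> n))"
    then obtain i m where v: "verified_within \<P> m (ackermann (nth_disj enum \<phi> i))"
      using ex_verified_within_iff[OF assms] by blast
    \<comment> \<open>At pass \<open>Suc k\<close> the list is long enough to contain the reduction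
      with index \<open>i\<close>, and the budget is at least the \<open>m\<close> operations
      needed.\<close>
    define k where "k = max i m"
    show "\<exists>k. returned (?st k) \<noteq> None"
    proof (rule ccontr)
      assume "\<nexists>k. returned (?st k) \<noteq> None"
      then have none: "returned (?st k) = None" for k by blast
      note s = states(1)[OF none[of k]]
      have acks: "acks (?st k) ! (Suc i - 1) = ackermann (nth_disj enum \<phi> i)"
        using s nth_map_upt[of i "Suc k" 0 "\<lambda>i. ackermann (nth_disj enum \<phi> i)"]
        by (simp add: k_def less_Suc_eq_le del: upt_Suc nth_map)
      have "Suc i \<in> {1..pass (?st k)}" using s by (simp add: k_def)
      moreover have "verified_within \<P> (pass (?st k)) (acks (?st k) ! (Suc i - 1))"
        unfolding acks by (rule verified_within_mono[OF v]) (use s in \<open>simp add: k_def\<close>)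
      ultimately have "\<exists>j\<in>{1..pass (?st k)}. verified_within \<P> (pass (?st k)) (acks (?st k) ! (j - 1))" ..
      then have "returned (?st (Suc k)) = Some True" by (simp add: one_pass_def)
      with none[of "Suc k"] show False by simp
    qed
  qed
  show ?thesis
  proof (cases "\<exists>k. returned (?st k) \<noteq> None")
    case True
    \<comment> \<open>The loop combinator stops at the first state that violates its guard, which is
      the state with this index.\<close>
    define k where "k = (LEAST k. returned (?st k) \<noteq> None)"
    have "returned (?st k) \<noteq> None" unfolding k_def using True by (rule LeastI_ex)
    from states(2)[OF this] have "procedure \<P> enum \<phi> = Some True"
      using True by (simp add: procedure_def while_option_def k_def)
    then show ?thesis using True halt_iff by simp
  next
    case False
    then have "procedure \<P> enum \<phi> = None" by (simp add: procedure_def while_option_def)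
    then show ?thesis using False halt_iff by simp
  qed
qed

theorem theorem3p16:
  fixes \<Sigma> :: "('o, 'c, 'f) signature"
    and \<phi> :: "('o, 'c, 'f) fm"
    and \<P> :: "(('c ext, 'f ext) ack_const, 's) membership_proc"
    and enum :: "nat \<Rightarrow> ('o, 'c, 'f) hfm"
  assumes "wf_signature \<Sigma>"
    and "is_formula \<Sigma> \<phi>"
    and "semi_decides_membership \<P>"
    and "range enum = herbrand_expansion \<Sigma> \<phi>"
    and "infinite (UNIV :: 'm set)"
  shows "(procedure \<P> enum \<phi> = Some True \<longleftrightarrow> entails TYPE('m) \<Sigma> (axioms \<Sigma>) \<phi>) \<and>
         (\<not> entails TYPE('m) \<Sigma> (axioms \<Sigma>) \<phi> \<longrightarrow> procedure \<P> enum \<phi> = None)"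
proof -
  let ?\<psi> = "nth_disj enum \<phi>"
  have enum: "is_formula (herbrand_sig \<Sigma> \<phi>) (enum i) \<and> quantifier_free (enum i) \<and> free_vars (enum i) = []" for i
    using herbrand_expansion_props[OF assms(1,2), of "enum i"] assms(4) by blast
  have \<psi>: "is_formula (herbrand_sig \<Sigma> \<phi>) (?\<psi> n)" "quantifier_free (?\<psi> n)" "free_vars (?\<psi> n) = []" for n
    using enum disj_upto_props[OF enum] by (simp_all add: nth_disj_def)
  have "(\<exists>n. idealisation (ackermann (?\<psi> n))) \<longleftrightarrow> entails TYPE('m) \<Sigma> (axioms \<Sigma>) \<phi>"
  proof
    assume "\<exists>n. idealisation (ackermann (?\<psi> n))"
    then obtain n where n: "idealisation (ackermann (?\<psi> n))" ..
    show "entails TYPE('m) \<Sigma> (axioms \<Sigma>) \<phi>"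
    proof (rule idealisable_imp_entails[OF assms(1,2) _ \<psi> _ n])
      show "range enum \<subseteq> herbrand_expansion \<Sigma> \<phi>" using assms(4) by simp
      show "\<exists>\<chi>\<in>range enum. sat \<I> \<beta> \<chi>" if "sat \<I> \<beta> (?\<psi> n)" for \<I> :: "('o, 'c ext, 'f ext, 'm) interp" and \<beta>
        using that by (auto simp: nth_disj_def sat_disj_upto split: if_splits)
    qed
  next
    assume ent: "entails TYPE('m) \<Sigma> (axioms \<Sigma>) \<phi>"
    show "\<exists>n. idealisation (ackermann (?\<psi> n))"
    proof (rule entails_imp_idealisable[OF assms(1,2) _ assms(5) ent \<psi>])
      show "herbrand_expansion \<Sigma> \<phi> \<subseteq> range enum" using assms(4) by simp
      fix \<I> :: "('o, 'c ext, 'f ext, (('c ext, 'f ext) ack_const) free_alg) interp" and n i \<beta>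
      assume "i \<le> n" "sat \<I> \<beta> (enum i)"
      \<comment> \<open>In the ground case the expansion is a singleton and the enumeration is
        constant, so keeping only its first member loses nothing.\<close>
      moreover have "enum i = enum 0" if "ground_fm (herbrand_nf \<phi>)"
        using herbrand_expansion_ground[OF that] assms(4) by (metis rangeI)
      ultimately show "sat \<I> \<beta> (?\<psi> n)" by (auto simp: nth_disj_def sat_disj_upto)
    qed
  qed
  then show ?thesis by (simp add: procedure_cases[OF assms(3)])
qed

end
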